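(* Let $\Omega,\widetilde{\Omega}\subset\mathbb R^n$, $n\ge 2$, be domains, let $1<q<\infty$, let $w:\mathbb R^n\to[0,\infty)$ be a weight with $w^q\in A_q$, and let $\varphi:\Omega\to\widetilde{\Omega}$ be a homeomorphism. Then $\varphi$ generates, by the rule $\varphi^*(f)=f\circ\varphi$, a bounded composition operator $$\varphi^{*}:L^{1}_{\infty}(\widetilde{\Omega})\to L^{1}_{q}(\Omega,w)$$ if and only if $\varphi$ belongs to the weighted Sobolev space $L^{1}_{q}(\Omega,w;\widetilde{\Omega})$.
   Context: A weight is a locally integrable nonnegative function $w$ on $\mathbb R^n$. For $1<p<\infty$, $w^p\in A_p$ (Muckenhoupt condition) means $\sup_{B}\big(\frac1{|B|}\int_B w^p\big)^{1/p}\big(\frac1{|B|}\int_B w^{-p'}\big)^{1/p'}<\infty$, the supremum over all balls $B\subset\mathbb R^n$, $1/p+1/p'=1$. For an open set $\Omega$ and $1\le p<\infty$, $L^1_p(\Omega,w)$ is the space of locally integrable weakly differentiable functions $f:\Omega\to\mathbb R$ with finite seminorm $\|f\mid L^1_p(\Omega,w)\|=\big(\int_\Omega|\nabla f|^p w^p\,dx\big)^{1/p}$; $L^1_p(\Omega)$ is the case $w\equiv1$, and $L^1_\infty(\Omega)$ is the space of locally integrable weakly differentiable functions with seminorm $\operatorname{ess\,sup}_\Omega|\nabla f|$. A homeomorphism $\varphi:\Omega\to\widetilde\Omega$ belongs to $L^1_q(\Omega,w;\widetilde\Omega)$ if its coordinate functions belong to $L^1_q(\Omega,w)$. $\varphi$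 generates a bounded composition operator $\varphi^*:L^1_p(\widetilde\Omega)\to L^1_q(\Omega,w)$ if for every $f\in L^1_p(\widetilde\Omega)$ the composition $f\circ\varphi$ is defined (quasi-everywhere) and belongs to $L^1_q(\Omega,w)$, and there is a constant $K<\infty$ with $\|f\circ\varphi\mid L^1_q(\Omega,w)\|\le K\|f\mid L^1_p(\widetilde\Omega)\|$ for all such $f$. *)

theory Defs
  imports "HOL-Analysis.Analysis"
begin

fun Ck_fun :: "nat \<Rightarrow> ('a::euclidean_space \<Rightarrow> real) \<Rightarrow> bool" where
  "Ck_fun 0 \<psi> = continuous_on UNIV \<psi>"
| "Ck_fun (Suc k) \<psi> = (\<psi> differentiable_on UNIV \<and>
      (\<forall>b\<in>Basis. Ck_fun k (\<lambda>x. frechet_derivative \<psi> (at x) b)))"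

definition smooth_fun :: "('a::euclidean_space \<Rightarrow> real) \<Rightarrow> bool" where
  "smooth_fun \<psi> \<longleftrightarrow> (\<forall>k. Ck_fun k \<psi>)"

definition test_fun :: "'a::euclidean_space set \<Rightarrow> ('a \<Rightarrow> real) \<Rightarrow> bool" where
  "test_fun \<Omega> \<psi> \<longleftrightarrow> smooth_fun \<psi> \<and> compact (closure {x. \<psi> x \<noteq> 0})
      \<and> closure {x. \<psi> x \<noteq> 0} \<subseteq> \<Omega>"

definition domain :: "'a::euclidean_space set \<Rightarrow> bool" where
  "domain \<Omega> \<longleftrightarrow> open \<Omega> \<and> connected \<Omega> \<and> \<Omega> \<noteq> {}"

definition loc_integrable :: "'a::euclidean_space set \<Rightarrow> ('a \<Rightarrow> real) \<Rightarrow> bool" where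
  "loc_integrable \<Omega> f \<longleftrightarrow>
     (\<forall>K. compact K \<and> K \<subseteq> \<Omega> \<longrightarrow> set_integrable lebesgue K f)"

definition is_weak_grad :: "'a::euclidean_space set \<Rightarrow> ('a \<Rightarrow> real) \<Rightarrow> ('a \<Rightarrow> 'a) \<Rightarrow> bool" where
  "is_weak_grad \<Omega> f g \<longleftrightarrow>
     (\<forall>b\<in>Basis. loc_integrable \<Omega> (\<lambda>x. g x \<bullet> b)) \<and>
     (\<forall>\<psi> b. test_fun \<Omega> \<psi> \<and> b \<in> Basis \<longrightarrow>
        (LINT x:\<Omega>|lebesgue. f x * frechet_derivative \<psi> (at x) b)
          = - (LINT x:\<Omega>|lebesgue. (g x \<bullet> b) * \<psi> x))"

definition weakly_diff :: "'a::euclidean_space set \<Rightarrow> ('a \<Rightarrow> real) \<Rightarrow> bool" where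
  "weakly_diff \<Omega> f \<longleftrightarrow> loc_integrable \<Omega> f \<and> (\<exists>g. is_weak_grad \<Omega> f g)"

definition weak_grad :: "'a::euclidean_space set \<Rightarrow> ('a \<Rightarrow> real) \<Rightarrow> 'a \<Rightarrow> 'a" where
  "weak_grad \<Omega> f = (SOME g. is_weak_grad \<Omega> f g)"

definition grad_energy :: "'a::euclidean_space set \<Rightarrow> ('a \<Rightarrow> real) \<Rightarrow> real \<Rightarrow> ('a \<Rightarrow> real) \<Rightarrow> ennreal" where
  "grad_energy \<Omega> w p f =
     (\<integral>\<^sup>+ x\<in>\<Omega>. ennreal (norm (weak_grad \<Omega> f x) powr p * w x powr p) \<partial>lebesgue)"

definition in_L1p :: "'a::euclidean_space set \<Rightarrow> ('a \<Rightarrow> real) \<Rightarrow> real \<Rightarrow> ('a \<Rightarrow> real) \<Rightarrow> bool" where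
  "in_L1p \<Omega> w p f \<longleftrightarrow> weakly_diff \<Omega> f \<and> grad_energy \<Omega> w p f < \<infinity>"

definition L1p_norm :: "'a::euclidean_space set \<Rightarrow> ('a \<Rightarrow> real) \<Rightarrow> real \<Rightarrow> ('a \<Rightarrow> real) \<Rightarrow> real" where
  "L1p_norm \<Omega> w p f = enn2real (grad_energy \<Omega> w p f) powr (1 / p)"

definition in_L1inf :: "'a::euclidean_space set \<Rightarrow> ('a \<Rightarrow> real) \<Rightarrow> bool" where
  "in_L1inf \<Omega> f \<longleftrightarrow> weakly_diff \<Omega> f \<and>
     (\<exists>C. AE x in lebesgue. x \<in> \<Omega> \<longrightarrow> norm (weak_grad \<Omega> f x) \<le> C)"

definition L1inf_norm :: "'a::euclidean_space set \<Rightarrow> ('a \<Rightarrow> real) \<Rightarrow> real" where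
  "L1inf_norm \<Omega> f = Inf {C. AE x in lebesgue. x \<in> \<Omega> \<longrightarrow> norm (weak_grad \<Omega> f x) \<le> C}"

definition map_in_L1p :: "'a::euclidean_space set \<Rightarrow> ('a \<Rightarrow> real) \<Rightarrow> real \<Rightarrow> ('a \<Rightarrow> 'a) \<Rightarrow> bool" where
  "map_in_L1p \<Omega> w p \<phi> \<longleftrightarrow> (\<forall>b\<in>Basis. in_L1p \<Omega> w p (\<lambda>x. \<phi> x \<bullet> b))"

definition weight :: "('a::euclidean_space \<Rightarrow> real) \<Rightarrow> bool" where
  "weight w \<longleftrightarrow> (\<forall>x. 0 \<le> w x) \<and> loc_integrable UNIV w"

text \<open>w^p in A_p (Muckenhoupt), 1 < p < infinity, p' = p/(p-1). Finiteness of the supremum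
  forces w > 0 a.e. (otherwise the w^{-p'} integral is infinite) and integrability on balls.\<close>
definition Muckenhoupt_pow :: "real \<Rightarrow> ('a::euclidean_space \<Rightarrow> real) \<Rightarrow> bool" where
  "Muckenhoupt_pow p w \<longleftrightarrow>
     (let p' = p / (p - 1) in
      (AE x in lebesgue. 0 < w x) \<and>
      (\<exists>C. \<forall>c r. 0 < r \<longrightarrow>
          set_integrable lebesgue (ball c r) (\<lambda>x. w x powr p) \<and>
          set_integrable lebesgue (ball c r) (\<lambda>x. w x powr (- p')) \<and>
          ((1 / measure lebesgue (ball c r)) * (LINT x:ball c r|lebesgue. w x powr p)) powr (1 / p)
          * ((1 / measure lebesgue (ball c r)) * (LINT x:ball c r|lebesgue. w x powr (- p'))) powr (1 / p')
          \<le> C))"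

text \<open>Bounded composition operator L^1_infinity(Omega~) -> L^1_q(Omega,w).  Functions in
  L^1_infinity are locally Lipschitz; since every point has positive infinity-capacity,
  "quasi-everywhere" means "everywhere" and the composition is taken with the continuous
  representative.\<close>
definition bounded_comp_op_inf :: "'a::euclidean_space set \<Rightarrow> 'a set \<Rightarrow> ('a \<Rightarrow> real) \<Rightarrow> real \<Rightarrow> ('a \<Rightarrow> 'a) \<Rightarrow> bool" where
  "bounded_comp_op_inf \<Omega> \<Omega>' w q \<phi> \<longleftrightarrow>
     (\<exists>K::real. \<forall>f. in_L1inf \<Omega>' f \<and> continuous_on \<Omega>' f \<longrightarrow>
        in_L1p \<Omega> w q (f \<circ> \<phi>) \<and> L1p_norm \<Omega> w q (f \<circ> \<phi>) \<le> K * L1inf_norm \<Omega>' f)"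

end

theory Submission
  imports Defs
begin

text \<open>Only the sufficiency of \<open>\<phi> \<in> L\<^sup>1\<^sub>q(\<Omega>, w)\<close> needs work; for the necessity one tests the
  operator on the coordinate functions. A continuous \<open>f\<close> with \<open>\<bar>\<nabla>f\<bar> \<le> C\<close> is \<open>C\<close>-Lipschitz on balls, hence small increments
  of \<open>u = f \<circ> \<phi>\<close> are at most \<open>C\<close> times the sum of those of the coordinates of \<open>\<phi>\<close>. Moving translations onto
  test functions, where the mean value theorem applies, this gives
  \<open>\<bar>\<integral> u \<partial>\<^sub>b\<psi>\<bar> \<le> \<integral> M \<bar>\<psi>\<bar>\<close> with \<open>M = C \<Sum>\<^sub>i \<bar>\<partial>\<^sub>b\<phi>\<^sub>i\<bar>\<close>. The functional \<open>\<psi> \<mapsto> - \<integral> u \<partial>\<^sub>b\<psi>\<close> is therefore given by a density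
  bounded by \<open>M\<close>, which is the weak derivative of \<open>u\<close>, and the weight enters only through the
  pointwise bound on the gradient.\<close>

section \<open>Test functions\<close>

text \<open>A pointwise chain rule is out of reach: the gradient of \<open>f\<close> is controlled
  only almost everywhere, and \<open>\<phi>\<close> may carry a set of positive measure into the
  exceptional null set. This is why only increments of \<open>f\<close> are used. The mean value
  theorem produces integrals against a test function shifted by an unknown amount. The unknown shift
  is harmless, since these integrals depend continuously on it and it tends to 0 with the increment.
  The bound on the functional is of \<open>L^1\<close> type with a density \<open>M\<close> that is
  only locally integrable, while a Hilbert space argument wants a quadratic bound. Choosing a
  positive \<open>\<rho>\<close> with \<open>M * \<rho>\<close> integrable, the inequality
  \<open>2 * M * \<bar>a\<bar> \<le> (M / \<rho>) * a^2 + M * \<rho>\<close> gives one: a quadratic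
  functional becomes bounded below, its minimiser yields the density, and the bound by
  \<open>M\<close> is recovered afterwards from the one-sided fundamental lemma.\<close>

lemma Ck_fun_SucI:
  assumes "\<And>x. (f has_derivative f' x) (at x)" "\<And>b. b \<in> Basis \<Longrightarrow> Ck_fun k (\<lambda>x. f' x b)"
  shows "Ck_fun (Suc k) f"
proof -
  have "frechet_derivative f (at x) = f' x" for x
    using frechet_derivative_at[OF assms(1)] by simp
  then show ?thesis
    using assms by (auto simp: differentiable_on_def differentiable_def intro: has_derivative_at_withinI)
qed

lemma Ck_fun_Suc_has_derivative:
  assumes "Ck_fun (Suc k) f"
  shows "(f has_derivative frechet_derivative f (at x)) (at x)"
  using assms by (simp add: differentiable_on_def frechet_derivative_works)

lemma Ck_fun_SucD: "Ck_fun (Suc k) f \<Longrightarrow> Ck_fun k f"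
proof (induction k arbitrary: f)
  case 0
  then show ?case by (simp add: differentiable_imp_continuous_on)
next
  case (Suc k)
  then show ?case by simp
qed

lemma Ck_fun_const: "Ck_fun k (\<lambda>_. c)"
  by (induction k arbitrary: c) (auto simp del: Ck_fun.simps(2) intro: Ck_fun_SucI[where f' = "\<lambda>_ _. 0"])

lemma Ck_fun_inner: "Ck_fun k (\<lambda>x. x \<bullet> b)"
proof (cases k)
  case (Suc k')
  show ?thesis unfolding Suc
    by (rule Ck_fun_SucI[where f' = "\<lambda>_ h. h \<bullet> b"]) (auto intro!: derivative_eq_intros Ck_fun_const)
qed (auto intro!: continuous_intros)

lemma Ck_fun_add: "Ck_fun k f \<Longrightarrow> Ck_fun k g \<Longrightarrow> Ck_fun k (\<lambda>x. f x + g x)"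
proof (induction k arbitrary: f g)
  case 0
  then show ?case by (simp add: continuous_on_add)
next
  case (Suc k)
  show ?case
  proof (rule Ck_fun_SucI)
    show "((\<lambda>x. f x + g x) has_derivative (\<lambda>h. frechet_derivative f (at x) h + frechet_derivative g (at x) h)) (at x)" for x
      by (intro has_derivative_add Ck_fun_Suc_has_derivative[OF Suc.prems(1)] Ck_fun_Suc_has_derivative[OF Suc.prems(2)])
    show "Ck_fun k (\<lambda>x. frechet_derivative f (at x) b + frechet_derivative g (at x) b)" if "b \<in> Basis" for b
      using Suc.prems that by (intro Suc.IH) auto
  qed
qed

text \<open>The product rule leaves one factor undifferentiated in each term, so the induction also
  needs \<open>Ck_fun k\<close> of the factors themselves, which \<open>Ck_fun_SucD\<close>
  supplies.\<close>

lemma Ck_fun_mult: "Ck_fun k f \<Longrightarrow> Ck_fun k g \<Longrightarrow> Ck_fun k (\<lambda>x. f x * g x)"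
proof (induction k arbitrary: f g)
  case 0
  then show ?case by (simp add: continuous_on_mult)
next
  case (Suc k)
  show ?case
  proof (rule Ck_fun_SucI)
    show "((\<lambda>x. f x * g x) has_derivative
        (\<lambda>h. f x * frechet_derivative g (at x) h + frechet_derivative f (at x) h * g x)) (at x)" for x
      by (intro has_derivative_mult Ck_fun_Suc_has_derivative[OF Suc.prems(1)] Ck_fun_Suc_has_derivative[OF Suc.prems(2)])
    show "Ck_fun k (\<lambda>x. f x * frechet_derivative g (at x) b + frechet_derivative f (at x) b * g x)" if "b \<in> Basis" for b
      using Suc.prems that
      by (intro Ck_fun_add Suc.IH Ck_fun_SucD[OF Suc.prems(1)] Ck_fun_SucD[OF Suc.prems(2)]) auto
  qed
qed

lemma smooth_fun_const: "smooth_fun (\<lambda>_. c)"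
  by (simp add: smooth_fun_def Ck_fun_const)

lemma smooth_fun_inner: "smooth_fun (\<lambda>x. x \<bullet> b)"
  by (simp add: smooth_fun_def Ck_fun_inner)

lemma smooth_fun_add: "smooth_fun f \<Longrightarrow> smooth_fun g \<Longrightarrow> smooth_fun (\<lambda>x. f x + g x)"
  by (simp add: smooth_fun_def Ck_fun_add)

lemma smooth_fun_mult: "smooth_fun f \<Longrightarrow> smooth_fun g \<Longrightarrow> smooth_fun (\<lambda>x. f x * g x)"
  by (simp add: smooth_fun_def Ck_fun_mult)

lemma smooth_fun_sum: "(\<And>i. i \<in> I \<Longrightarrow> smooth_fun (f i)) \<Longrightarrow> smooth_fun (\<lambda>x. \<Sum>i\<in>I. f i x)"
  by (induction I rule: infinite_finite_induct) (auto intro: smooth_fun_const smooth_fun_add)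

text \<open>Stone-Weierstrass delivers functions of this kind, and they become test functions once
  multiplied by one. A linear building block is smooth because it is a combination of
  coordinates.\<close>

lemma smooth_fun_real_polynomial: "real_polynomial_function p \<Longrightarrow> smooth_fun p"
proof (induction rule: real_polynomial_function.induct)
  case (linear f)
  have "f x = (\<Sum>b\<in>Basis. (x \<bullet> b) * f b)" for x
  proof -
    have "f x = f (\<Sum>b\<in>Basis. (x \<bullet> b) *\<^sub>R b)" by (simp add: euclidean_representation)
    also have "\<dots> = (\<Sum>b\<in>Basis. (x \<bullet> b) * f b)"
      using linear by (simp add: bounded_linear.linear linear_sum linear_cmul)
    finally show ?thesis .
  qed
  then have f: "f = (\<lambda>x. \<Sum>b\<in>Basis. (x \<bullet> b) * f b)" by blast
  show ?case
    by (subst f) (intro smooth_fun_sum smooth_fun_mult smooth_fun_inner smooth_fun_const)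
qed (auto intro: smooth_fun_const smooth_fun_add smooth_fun_mult)

lemma smooth_fun_has_derivative:
  "smooth_fun f \<Longrightarrow> (f has_derivative frechet_derivative f (at x)) (at x)"
  unfolding smooth_fun_def using Ck_fun_Suc_has_derivative by blast

lemma smooth_fun_continuous_on: "smooth_fun f \<Longrightarrow> continuous_on S f"
  unfolding smooth_fun_def by (meson Ck_fun.simps(1) continuous_on_subset subset_UNIV)

lemma smooth_fun_frechet_derivative:
  "smooth_fun f \<Longrightarrow> b \<in> Basis \<Longrightarrow> smooth_fun (\<lambda>x. frechet_derivative f (at x) b)"
  unfolding smooth_fun_def by (metis Ck_fun.simps(2))

text \<open>For \<open>m = 0\<close> this is the classical function \<open>exp (- 1 / s)\<close>
  extended by 0. The powers of \<open>1 / s\<close> make the derivative of each member a linear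
  combination of members, as an induction on the order of differentiability requires.\<close>

definition exp_bump :: "nat \<Rightarrow> real \<Rightarrow> real" where
  "exp_bump m s = (if s > 0 then exp (- 1 / s) / s ^ m else 0)"

text \<open>With \<open>t = 1 / s\<close> the limit from the right becomes that of
  \<open>t ^ m / exp t\<close> at infinity.\<close>

lemma exp_bump_tendsto_0: "(exp_bump m \<longlongrightarrow> 0) (at 0)"
proof -
  have "((\<lambda>t::real. t ^ m / exp t) \<longlongrightarrow> 0) at_top" by (rule tendsto_power_div_exp_0)
  then have "((\<lambda>s. inverse s ^ m / exp (inverse s)) \<longlongrightarrow> 0) (at_right (0::real))"
    by (rule filterlim_compose[OF _ filterlim_inverse_at_top_right])
  moreover have "eventually (\<lambda>s. inverse s ^ m / exp (inverse s) = exp_bump m s) (at_right 0)"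
    unfolding eventually_at_right_field
    by (rule exI[of _ 1]) (auto simp: exp_bump_def exp_minus field_simps)
  ultimately have "(exp_bump m \<longlongrightarrow> 0) (at_right 0)" by (rule Lim_transform_eventually)
  moreover have "(exp_bump m \<longlongrightarrow> 0) (at_left 0)"
    by (rule Lim_transform_eventually[OF tendsto_const])
       (auto simp: eventually_at_left_field exp_bump_def intro!: exI[of _ "-1"])
  ultimately show ?thesis by (simp add: filterlim_split_at_real)
qed

lemma exp_bump_deriv:
  "(exp_bump m has_real_derivative exp_bump (m + 2) s - real m * exp_bump (m + 1) s) (at s)"
proof -
  consider "s > 0" | "s < 0" | "s = 0" by linarith
  then show ?thesis
  proof cases
    case 1
    have "((\<lambda>s. exp (- 1 / s) / s ^ m) has_real_derivative
        exp_bump (m + 2) s - real m * exp_bump (m + 1) s) (at s)"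
    proof -
      have "((\<lambda>s. s ^ m) has_real_derivative real m * (s ^ m / s)) (at s)"
        using 1 DERIV_pow[of m s] by (cases m) simp_all
      moreover have "((\<lambda>s. exp (- 1 / s)) has_real_derivative exp (- 1 / s) / (s * s)) (at s)"
        using 1 by (auto intro!: derivative_eq_intros simp: field_simps)
      ultimately have D: "((\<lambda>s. exp (- 1 / s) / s ^ m) has_real_derivative
          (exp (- 1 / s) / (s * s) * s ^ m - exp (- 1 / s) * (real m * (s ^ m / s))) / (s ^ m * s ^ m)) (at s)"
        using 1 by (intro DERIV_divide) auto
      have eq: "(A / (s * s) * P - A * (k * (P / s))) / (P * P) = A / (P * (s * s)) - k * (A / (P * s))"
        if "P > 0" for A P k :: real
        using 1 that by (simp add: field_simps)
      have "s ^ m > 0" using 1 by simp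
      have E: "exp_bump (m + 2) s - real m * exp_bump (m + 1) s
          = exp (- 1 / s) / (s ^ m * (s * s)) - real m * (exp (- 1 / s) / (s ^ m * s))"
        unfolding exp_bump_def using 1 by (simp add: power_add power2_eq_square mult_ac)
      from D show ?thesis
        unfolding eq[OF \<open>s ^ m > 0\<close>] E .
    qed
    moreover have ev: "\<forall>\<^sub>F x in nhds s. exp_bump m x = exp (- 1 / x) / x ^ m"
      using eventually_nhds_in_open[of "{0<..}" s] 1 by (auto elim!: eventually_mono simp: exp_bump_def)
    ultimately show ?thesis by (simp only: DERIV_cong_ev[OF refl ev refl])
  next
    case 2
    have "((\<lambda>s. 0) has_real_derivative exp_bump (m + 2) s - real m * exp_bump (m + 1) s) (at s)"
      using 2 by (simp add: exp_bump_def)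
    moreover have ev: "\<forall>\<^sub>F x in nhds s. exp_bump m x = 0"
      using eventually_nhds_in_open[of "{..<0}" s] 2 by (auto elim!: eventually_mono simp: exp_bump_def)
    ultimately show ?thesis by (simp only: DERIV_cong_ev[OF refl ev refl])
  next
    case 3
    \<comment> \<open>At 0 the difference quotient of one member of the family is exactly the next
      member, so \<open>exp_bump_tendsto_0\<close> gives the derivative.\<close>
    have "(\<lambda>h. (exp_bump m (0 + h) - exp_bump m 0) / h) = exp_bump (Suc m)"
      by (auto simp: exp_bump_def fun_eq_iff)
    then have "(exp_bump m has_real_derivative 0) (at 0)"
      unfolding DERIV_def using exp_bump_tendsto_0 by metis
    then show ?thesis using 3 by (simp add: exp_bump_def)
  qed
qed

text \<open>The induction ranges over all \<open>m\<close>, because differentiation raises the index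
  by one and by two.\<close>

lemma Ck_fun_exp_bump:
  assumes "smooth_fun p"
  shows "Ck_fun k (\<lambda>x. exp_bump m (p x))"
proof (induction k arbitrary: m)
  case 0
  have "continuous_on UNIV (exp_bump m)"
    by (rule DERIV_continuous_on) (rule has_field_derivative_at_within[OF exp_bump_deriv])
  then show ?case
    using smooth_fun_continuous_on[OF assms] 
    by (auto intro!: continuous_on_compose2[of UNIV "exp_bump m"])
next
  case (Suc k)
  show ?case
  proof (rule Ck_fun_SucI)
    fix x
    show "((\<lambda>x. exp_bump m (p x)) has_derivative 
      (\<lambda>h. frechet_derivative p (at x) h * (exp_bump (m + 2) (p x) + (- real m) * exp_bump (m + 1) (p x)))) (at x)"
      using has_derivative_compose[OF smooth_fun_has_derivative[OF assms] exp_bump_deriv[of m "p x", unfolded has_field_derivative_def]]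
      by (simp add: mult.commute)
  next
    fix b :: 'a assume "b \<in> Basis"
    then have "Ck_fun k (\<lambda>x. frechet_derivative p (at x) b)"
      using smooth_fun_frechet_derivative[OF assms] smooth_fun_def by blast
    then show "Ck_fun k (\<lambda>x. frechet_derivative p (at x) b * (exp_bump (m + 2) (p x) + (- real m) * exp_bump (m + 1) (p x)))"
      by (intro Ck_fun_mult Ck_fun_add Ck_fun_const Suc)
  qed
qed

section \<open>Test functions: supports, bumps and approximation\<close>

lemma test_funI:
  assumes "smooth_fun \<psi>" "compact K" "K \<subseteq> \<Omega>" "\<And>x. x \<notin> K \<Longrightarrow> \<psi> x = 0"
  shows "test_fun \<Omega> \<psi>"
proof -
  have "closure {x. \<psi> x \<noteq> 0} \<subseteq> K"
    using assms(2,4) compact_imp_closed by (intro closure_minimal) auto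
  then show ?thesis
    unfolding test_fun_def using assms compact_Int_closed[of K "closure {x. \<psi> x \<noteq> 0}"]
    by (auto simp: Int_absorb1)
qed

lemma test_funE:
  assumes "test_fun \<Omega> \<psi>"
  obtains K where "smooth_fun \<psi>" "compact K" "K \<subseteq> \<Omega>" "\<And>x. x \<notin> K \<Longrightarrow> \<psi> x = 0"
proof
  show "smooth_fun \<psi>" "compact (closure {x. \<psi> x \<noteq> 0})" "closure {x. \<psi> x \<noteq> 0} \<subseteq> \<Omega>"
    using assms by (auto simp: test_fun_def)
  show "\<And>x. x \<notin> closure {x. \<psi> x \<noteq> 0} \<Longrightarrow> \<psi> x = 0"
    using closure_subset by force
qed

lemma test_fun_mult:
  assumes "smooth_fun p" "test_fun \<Omega> \<psi>" shows "test_fun \<Omega> (\<lambda>x. p x * \<psi> x)"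
proof -
  from assms(2) obtain K where "smooth_fun \<psi>" "compact K" "K \<subseteq> \<Omega>" "\<And>x. x \<notin> K \<Longrightarrow> \<psi> x = 0"
    by (rule test_funE) auto
  then show ?thesis using assms(1) by (intro test_funI[of _ K] smooth_fun_mult) auto
qed

lemma test_fun_add:
  assumes "test_fun \<Omega> \<psi>" "test_fun \<Omega> \<eta>" shows "test_fun \<Omega> (\<lambda>x. \<psi> x + \<eta> x)"
proof -
  from assms(1) obtain K where "smooth_fun \<psi>" "compact K" "K \<subseteq> \<Omega>" "\<And>x. x \<notin> K \<Longrightarrow> \<psi> x = 0"
    by (rule test_funE) auto
  moreover from assms(2) obtain K' where "smooth_fun \<eta>" "compact K'" "K' \<subseteq> \<Omega>" "\<And>x. x \<notin> K' \<Longrightarrow> \<eta> x = 0"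
    by (rule test_funE) auto
  ultimately show ?thesis by (intro test_funI[of _ "K \<union> K'"] smooth_fun_add) auto
qed

lemma test_fun_cmult: "test_fun \<Omega> \<psi> \<Longrightarrow> test_fun \<Omega> (\<lambda>x. c * \<psi> x)"
  by (rule test_fun_mult[OF smooth_fun_const])

lemma test_fun_zero: "test_fun \<Omega> (\<lambda>_. 0)"
  by (rule test_funI[of _ "{}"]) (auto intro: smooth_fun_const)

lemma test_fun_sum: "(\<And>i. i \<in> I \<Longrightarrow> test_fun \<Omega> (f i)) \<Longrightarrow> test_fun \<Omega> (\<lambda>x. \<Sum>i\<in>I. f i x)"
  by (induction I rule: infinite_finite_induct) (auto intro: test_fun_zero test_fun_add)

lemma test_fun_mono: "test_fun A \<psi> \<Longrightarrow> A \<subseteq> B \<Longrightarrow> test_fun B \<psi>"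
  by (auto simp: test_fun_def)

lemma test_fun_ball_exists:
  fixes c :: "'a::euclidean_space"
  assumes "0 < r"
  obtains \<psi> where "test_fun (cball c r) \<psi>" "\<And>x. 0 \<le> \<psi> x" "\<And>x. x \<in> ball c r \<Longrightarrow> 0 < \<psi> x"
proof
  \<comment> \<open>This is \<open>r^2 - (dist c x)^2\<close>, positive exactly on the open ball. It
    is written out in coordinates so that the closure rules for sums and products show
    smoothness.\<close>
  define p where "p x = (\<Sum>b\<in>Basis. (x \<bullet> b + (- (c \<bullet> b))) * (-1 * (x \<bullet> b + (- (c \<bullet> b))))) + r\<^sup>2" for x :: 'a
  have p_eq: "p x = r\<^sup>2 - (dist c x)\<^sup>2" for x
  proof -
    have "(dist c x)\<^sup>2 = (x - c) \<bullet> (x - c)"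
      by (simp only: dist_norm norm_minus_commute[of c] power2_norm_eq_inner)
    also have "\<dots> = (\<Sum>b\<in>Basis. (x \<bullet> b - c \<bullet> b) * (x \<bullet> b - c \<bullet> b))"
      by (subst euclidean_inner) (simp add: inner_diff_left)
    finally have "(dist c x)\<^sup>2 = (\<Sum>b\<in>Basis. (x \<bullet> b - c \<bullet> b) * (x \<bullet> b - c \<bullet> b))" .
    moreover have "(\<Sum>b\<in>Basis. (x \<bullet> b + - (c \<bullet> b)) * (- 1 * (x \<bullet> b + - (c \<bullet> b))))
        = - (\<Sum>b\<in>Basis. (x \<bullet> b - c \<bullet> b) * (x \<bullet> b - c \<bullet> b))"
      by (simp only: sum_negf[symmetric]) (simp add: algebra_simps)
    ultimately show ?thesis unfolding p_def by linarith
  qed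
  have "smooth_fun p"
    unfolding p_def by (intro smooth_fun_add smooth_fun_sum smooth_fun_mult smooth_fun_inner smooth_fun_const)
  then have sm: "smooth_fun (\<lambda>x. exp_bump 0 (p x))"
    unfolding smooth_fun_def[of "\<lambda>x. exp_bump 0 (p x)"] by (blast intro: Ck_fun_exp_bump)
  show "test_fun (cball c r) (\<lambda>x. exp_bump 0 (p x))"
    by (rule test_funI[OF sm, of "cball c r"])
       (use assms in \<open>auto simp: exp_bump_def p_eq dest: power_less_imp_less_base\<close>)
  show "0 \<le> exp_bump 0 (p x)" for x by (simp add: exp_bump_def)
  show "0 < exp_bump 0 (p x)" if "x \<in> ball c r" for x
    using that by (simp add: exp_bump_def p_eq power_strict_mono)
qed

text \<open>Finitely many balls around points of \<open>K\<close> cover it, and the sum of their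
  bumps is positive there. The result serves as the weight of the error in
  \<open>test_fun_approx\<close>.\<close>

lemma test_fun_pos_on_compact:
  fixes \<Omega> :: "'a::euclidean_space set"
  assumes "open \<Omega>" "compact K" "K \<subseteq> \<Omega>"
  obtains \<sigma> where "test_fun \<Omega> \<sigma>" "\<And>x. 0 \<le> \<sigma> x" "\<And>x. x \<in> K \<Longrightarrow> 0 < \<sigma> x"
proof -
  have "\<exists>\<psi> U. test_fun \<Omega> \<psi> \<and> (\<forall>x. 0 \<le> \<psi> x) \<and> open U \<and> y \<in> U \<and> (\<forall>x\<in>U. 0 < \<psi> x)" if "y \<in> K" for y
  proof -
    have "y \<in> \<Omega>" using assms that by blast
    obtain r where r: "r > 0" "cball y r \<subseteq> \<Omega>"
      using open_contains_cball_eq[OF assms(1)] \<open>y \<in> \<Omega>\<close> by auto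
    obtain \<psi> where "test_fun (cball y r) \<psi>" "\<And>x. 0 \<le> \<psi> x" "\<And>x. x \<in> ball y r \<Longrightarrow> 0 < \<psi> x"
      using test_fun_ball_exists[OF r(1)] by blast
    then show ?thesis using r test_fun_mono
      by (intro exI[of _ \<psi>] exI[of _ "ball y r"]) auto
  qed
  then obtain \<psi> U where *: "\<And>y. y \<in> K \<Longrightarrow> test_fun \<Omega> (\<psi> y) \<and> (\<forall>x. 0 \<le> \<psi> y x) \<and> open (U y) \<and> y \<in> U y \<and> (\<forall>x\<in>U y. 0 < \<psi> y x)"
    by metis
  obtain D where D: "D \<subseteq> K" "finite D" "K \<subseteq> (\<Union>y\<in>D. U y)"
    using compactE_image[OF assms(2), of K U] * by blast
  show ?thesis
  proof
    show "test_fun \<Omega> (\<lambda>x. \<Sum>y\<in>D. \<psi> y x)" using * D by (intro test_fun_sum) auto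
    show "0 \<le> (\<Sum>y\<in>D. \<psi> y x)" for x using * D by (intro sum_nonneg) auto
    show "0 < (\<Sum>y\<in>D. \<psi> y x)" if "x \<in> K" for x
    proof -
      obtain y where "y \<in> D" "x \<in> U y" using D \<open>x \<in> K\<close> by blast
      then show ?thesis using * D by (intro sum_pos2[of D y]) auto
    qed
  qed
qed

text \<open>Stone--Weierstrass is applied to \<open>c / \<sigma>\<close>, so that multiplying the polynomial by \<open>\<sigma>\<close>
  yields a compactly supported approximation of \<open>c\<close> without any mollification.\<close>
lemma test_fun_approx:
  fixes \<Omega> :: "'a::euclidean_space set"
  assumes \<sigma>: "test_fun \<Omega> \<sigma>" "\<And>x. 0 \<le> \<sigma> x" "\<And>x. x \<in> K \<Longrightarrow> 0 < \<sigma> x"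
    and K: "compact K" and c: "continuous_on UNIV c" "\<And>x. x \<notin> K \<Longrightarrow> c x = 0" and "0 < e"
  obtains \<eta> where "test_fun \<Omega> \<eta>" "\<And>x. \<bar>\<eta> x - c x\<bar> \<le> e * \<sigma> x"
proof -
  from \<sigma>(1) obtain S where S: "smooth_fun \<sigma>" "compact S" "S \<subseteq> \<Omega>" "\<And>x. x \<notin> S \<Longrightarrow> \<sigma> x = 0"
    by (rule test_funE) auto
  \<comment> \<open>Zeros of \<open>\<sigma>\<close> lie in the open set \<open>- K\<close>, where
    \<open>c\<close> and hence the quotient are 0; the two open pieces cover the space.\<close>
  have "continuous_on UNIV (\<lambda>x. c x / \<sigma> x)"
  proof -
    have "continuous_on ({x. 0 < \<sigma> x} \<union> - K) (\<lambda>x. c x / \<sigma> x)"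
    proof (rule continuous_on_open_Un)
      show "open {x. 0 < \<sigma> x}"
        using smooth_fun_continuous_on[OF S(1)] by (intro open_Collect_less) auto
      show "open (- K)" using K by (simp add: compact_imp_closed open_Compl)
      show "continuous_on {x. 0 < \<sigma> x} (\<lambda>x. c x / \<sigma> x)"
        by (intro continuous_on_divide smooth_fun_continuous_on[OF S(1)] continuous_on_subset[OF c(1)]) auto
      show "continuous_on (- K) (\<lambda>x. c x / \<sigma> x)"
        using c(2) by (auto intro: continuous_on_eq[of _ "\<lambda>_. 0"])
    qed
    moreover have "{x. 0 < \<sigma> x} \<union> - K = UNIV" using \<sigma>(3) by auto
    ultimately show ?thesis by simp
  qed
  then have "continuous_on S (\<lambda>x. c x / \<sigma> x)"
    by (rule continuous_on_subset) simp
  from Stone_Weierstrass_real_polynomial_function[OF S(2) this \<open>0 < e\<close>]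
  obtain p where p: "real_polynomial_function p" "\<And>x. x \<in> S \<Longrightarrow> \<bar>c x / \<sigma> x - p x\<bar> < e"
    by blast
  show ?thesis
  proof
    show "test_fun \<Omega> (\<lambda>x. p x * \<sigma> x)"
      by (rule test_fun_mult[OF smooth_fun_real_polynomial[OF p(1)] \<sigma>(1)])
    show "\<bar>p x * \<sigma> x - c x\<bar> \<le> e * \<sigma> x" for x
    proof (cases "\<sigma> x = 0")
      case True
      then have "x \<notin> K" using \<sigma>(3)[of x] by auto
      then show ?thesis using True c(2)[of x] by simp
    next
      case False
      then have "x \<in> S" using S(4)[of x] by blast
      have "p x * \<sigma> x - c x = - ((c x / \<sigma> x - p x) * \<sigma> x)" using False by (simp add: field_simps)
      also have "\<bar>\<dots>\<bar> = \<bar>c x / \<sigma> x - p x\<bar> * \<sigma> x" using \<sigma>(2)[of x] by (simp add: abs_mult)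
      also have "\<dots> \<le> e * \<sigma> x" using p(2)[OF \<open>x \<in> S\<close>] \<sigma>(2)[of x] by (intro mult_right_mono) auto
      finally show ?thesis .
    qed
  qed
qed

section \<open>The fundamental lemma and weak gradients\<close>

text \<open>The set need not be open: for compact \<open>K\<close>, \<open>cc_fun K c\<close>
  records that the support stays inside \<open>K\<close>, which keeps track of supports under
  translation.\<close>

definition cc_fun :: "'a::euclidean_space set \<Rightarrow> ('a \<Rightarrow> real) \<Rightarrow> bool" where
  "cc_fun \<Omega> c \<longleftrightarrow> continuous_on UNIV c \<and> (\<exists>K. compact K \<and> K \<subseteq> \<Omega> \<and> (\<forall>x. x \<notin> K \<longrightarrow> c x = 0))"

lemma cc_funI: "continuous_on UNIV c \<Longrightarrow> compact K \<Longrightarrow> K \<subseteq> \<Omega> \<Longrightarrow> (\<And>x. x \<notin> K \<Longrightarrow> c x = 0) \<Longrightarrow> cc_fun \<Omega> c"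
  unfolding cc_fun_def by blast

lemma cc_funE:
  assumes "cc_fun \<Omega> c"
  obtains K where "continuous_on UNIV c" "compact K" "K \<subseteq> \<Omega>" "\<And>x. x \<notin> K \<Longrightarrow> c x = 0"
  using assms unfolding cc_fun_def by blast

lemma test_fun_imp_cc_fun: "test_fun \<Omega> \<psi> \<Longrightarrow> cc_fun \<Omega> \<psi>"
  by (erule test_funE) (rule cc_funI, auto intro: smooth_fun_continuous_on)

lemma cc_fun_mult: "cc_fun \<Omega> c \<Longrightarrow> continuous_on UNIV d \<Longrightarrow> cc_fun \<Omega> (\<lambda>x. d x * c x)"
  by (erule cc_funE) (rule cc_funI, auto intro: continuous_on_mult)

lemma cc_fun_abs: "cc_fun \<Omega> c \<Longrightarrow> cc_fun \<Omega> (\<lambda>x. \<bar>c x\<bar>)"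
  by (erule cc_funE) (rule cc_funI, auto intro: continuous_intros)

lemma cc_fun_bounded:
  assumes "cc_fun \<Omega> c"
  obtains B where "0 < B" "\<And>x. \<bar>c x\<bar> \<le> B"
proof -
  from assms obtain K where K: "continuous_on UNIV c" "compact K" "\<And>x. x \<notin> K \<Longrightarrow> c x = 0"
    by (rule cc_funE) blast
  have "bounded (c ` K)"
    using K by (intro compact_imp_bounded compact_continuous_image continuous_on_subset[OF K(1)]) auto
  then obtain B where B: "B > 0" "\<And>x. x \<in> K \<Longrightarrow> \<bar>c x\<bar> \<le> B"
    unfolding bounded_pos by auto
  show ?thesis
  proof
    show "0 < B" by fact
    show "\<bar>c x\<bar> \<le> B" for x using B K(3)[of x] by (cases "x \<in> K") auto
  qed
qed

section \<open>Products of locally integrable and compactly supported functions\<close>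

lemma continuous_on_UNIV_measurable_lebesgue:
  fixes c :: "'a::euclidean_space \<Rightarrow> 'b::euclidean_space"
  shows "continuous_on UNIV c \<Longrightarrow> c \<in> borel_measurable lebesgue"
  using continuous_imp_measurable_on_sets_lebesgue[of UNIV c] by (simp add: lebesgue_on_UNIV_eq)

lemma loc_integrable_mult_bounded:
  fixes h c :: "'a::euclidean_space \<Rightarrow> real"
  assumes h: "loc_integrable \<Omega> h" and K: "compact K" "K \<subseteq> \<Omega>"
    and c: "c \<in> borel_measurable lebesgue" "\<And>x. \<bar>c x\<bar> \<le> B" "\<And>x. x \<notin> K \<Longrightarrow> c x = 0"
  shows "integrable lebesgue (\<lambda>x. h x * c x)"
proof -
  have int: "integrable lebesgue (\<lambda>x. indicator K x *\<^sub>R h x)"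
    using h K unfolding loc_integrable_def set_integrable_def by blast
  have eq: "(\<lambda>x. h x * c x) = (\<lambda>x. (indicator K x *\<^sub>R h x) * c x)"
    using c(3) by (auto simp: fun_eq_iff indicator_def)
  have meas: "(\<lambda>x. indicator K x *\<^sub>R h x) \<in> borel_measurable lebesgue"
    using int by (rule borel_measurable_integrable)
  show ?thesis unfolding eq
  proof (rule Bochner_Integration.integrable_bound[of _ "\<lambda>x. B * (indicator K x *\<^sub>R h x)"])
    show "integrable lebesgue (\<lambda>x. B * (indicator K x *\<^sub>R h x))" using int by (rule integrable_mult_right)
    show "(\<lambda>x. (indicator K x *\<^sub>R h x) * c x) \<in> borel_measurable lebesgue"
      using meas c(1) by (rule borel_measurable_times)
    show "AE x in lebesgue. norm ((indicator K x *\<^sub>R h x) * c x) \<le> norm (B * (indicator K x *\<^sub>R h x))"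
    proof (rule AE_I2)
      fix x
      have "\<bar>c x\<bar> \<le> \<bar>B\<bar>" using c(2)[of x] by linarith
      then have "\<bar>c x\<bar> * \<bar>indicator K x *\<^sub>R h x\<bar> \<le> \<bar>B\<bar> * \<bar>indicator K x *\<^sub>R h x\<bar>"
        by (rule mult_right_mono) simp
      then show "norm ((indicator K x *\<^sub>R h x) * c x) \<le> norm (B * (indicator K x *\<^sub>R h x))"
        by (simp add: abs_mult mult.commute)
    qed
  qed
qed

lemma loc_integrable_mult_cc:
  assumes "loc_integrable \<Omega> h" "cc_fun \<Omega> c"
  shows "integrable lebesgue (\<lambda>x. h x * c x)"
proof -
  from assms(2) obtain K where K: "continuous_on UNIV c" "compact K" "K \<subseteq> \<Omega>" "\<And>x. x \<notin> K \<Longrightarrow> c x = 0"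
    by (rule cc_funE) blast
  obtain B where "\<And>x. \<bar>c x\<bar> \<le> B" by (rule cc_fun_bounded[OF assms(2)]) blast
  then show ?thesis
    using loc_integrable_mult_bounded[OF assms(1) K(2,3) continuous_on_UNIV_measurable_lebesgue[OF K(1)]] K(4) by blast
qed

lemma continuous_on_imp_loc_integrable:
  fixes h :: "'a::euclidean_space \<Rightarrow> real"
  assumes "continuous_on \<Omega> h"
  shows "loc_integrable \<Omega> h"
  unfolding loc_integrable_def
proof (intro allI impI)
  fix K assume K: "compact K \<and> K \<subseteq> \<Omega>"
  have "integrable lborel (\<lambda>x. indicator K x *\<^sub>R h x)"
    by (rule borel_integrable_compact) (use K assms continuous_on_subset in auto)
  then show "set_integrable lebesgue K h"
    unfolding set_integrable_def
    using integrable_completion borel_measurable_integrable by blast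
qed

lemma set_integral_cc:
  assumes "cc_fun \<Omega> c"
  shows "(LINT x:\<Omega>|lebesgue. h x * c x) = (\<integral>x. h x * c x \<partial>lebesgue)"
proof -
  from assms obtain K where "K \<subseteq> \<Omega>" "\<And>x. x \<notin> K \<Longrightarrow> c x = 0"
    by (rule cc_funE) blast
  then have "(\<lambda>x. indicator \<Omega> x *\<^sub>R (h x * c x)) = (\<lambda>x. h x * c x)"
    by (auto simp: fun_eq_iff indicator_def)
  then show ?thesis unfolding set_lebesgue_integral_def by simp
qed

lemma test_fun_frechet_derivative:
  assumes "test_fun \<Omega> \<psi>" "b \<in> Basis"
  shows "test_fun \<Omega> (\<lambda>x. frechet_derivative \<psi> (at x) b)"
proof -
  from assms(1) obtain K where K: "smooth_fun \<psi>" "compact K" "K \<subseteq> \<Omega>" "\<And>x. x \<notin> K \<Longrightarrow> \<psi> x = 0"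
    by (rule test_funE) blast
  show ?thesis
  proof (rule test_funI[OF smooth_fun_frechet_derivative[OF K(1) assms(2)] K(2,3)])
    fix x assume x: "x \<notin> K"
    have "(\<psi> has_derivative (\<lambda>_. 0)) (at x)"
    proof (rule has_derivative_transform_within_open)
      show "((\<lambda>_. 0) has_derivative (\<lambda>_. 0)) (at x)" by simp
      show "open (- K)" "x \<in> - K" using K(2) x by (auto simp: compact_imp_closed)
      show "\<And>y. y \<in> - K \<Longrightarrow> 0 = \<psi> y" using K(4) by simp
    qed
    then have "frechet_derivative \<psi> (at x) = (\<lambda>_. 0)" by (metis frechet_derivative_at)
    then show "frechet_derivative \<psi> (at x) b = 0" by simp
  qed
qed

text \<open>Test functions and their derivatives vanish outside \<open>\<Omega>\<close>, so the
  integrals may run over the whole space, where translation is available.\<close>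

lemma is_weak_grad_iff:
  "is_weak_grad \<Omega> f g \<longleftrightarrow>
     (\<forall>b\<in>Basis. loc_integrable \<Omega> (\<lambda>x. g x \<bullet> b)) \<and>
     (\<forall>\<psi> b. test_fun \<Omega> \<psi> \<and> b \<in> Basis \<longrightarrow>
        (\<integral>x. f x * frechet_derivative \<psi> (at x) b \<partial>lebesgue) = - (\<integral>x. (g x \<bullet> b) * \<psi> x \<partial>lebesgue))"
proof -
  have 1: "(LINT x:\<Omega>|lebesgue. f x * frechet_derivative \<psi> (at x) b) = (\<integral>x. f x * frechet_derivative \<psi> (at x) b \<partial>lebesgue)"
    if "test_fun \<Omega> \<psi>" "b \<in> Basis" for \<psi> b
    by (rule set_integral_cc[OF test_fun_imp_cc_fun[OF test_fun_frechet_derivative[OF that]]])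
  have 2: "(LINT x:\<Omega>|lebesgue. (g x \<bullet> b) * \<psi> x) = (\<integral>x. (g x \<bullet> b) * \<psi> x \<partial>lebesgue)"
    if "test_fun \<Omega> \<psi>" for \<psi> b
    by (rule set_integral_cc[OF test_fun_imp_cc_fun[OF that]])
  show ?thesis unfolding is_weak_grad_def
    by (intro conj_cong refl iff_allI imp_cong) (simp add: 1 2)
qed

text \<open>If \<open>\<eta>\<close> is a test function within \<open>e * \<sigma>\<close> of
  \<open>c\<close>, then \<open>\<eta> + e * \<sigma>\<close> is a nonnegative test function within
  \<open>2 * e * \<sigma>\<close> of \<open>c\<close>. Replacing \<open>c\<close> by it costs at
  most \<open>2 * e\<close> times the integral of \<open>\<bar>h\<bar> * \<sigma>\<close>.\<close>

lemma integral_cc_nonneg: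
  fixes h :: "'a::euclidean_space \<Rightarrow> real"
  assumes \<Omega>: "open \<Omega>" and h: "loc_integrable \<Omega> h"
    and nonneg: "\<And>\<psi>. test_fun \<Omega> \<psi> \<Longrightarrow> (\<And>x. 0 \<le> \<psi> x) \<Longrightarrow> 0 \<le> (\<integral>x. h x * \<psi> x \<partial>lebesgue)"
    and c: "cc_fun \<Omega> c" "\<And>x. 0 \<le> c x"
  shows "0 \<le> (\<integral>x. h x * c x \<partial>lebesgue)"
proof -
  from c(1) obtain K where K: "continuous_on UNIV c" "compact K" "K \<subseteq> \<Omega>" "\<And>x. x \<notin> K \<Longrightarrow> c x = 0"
    by (rule cc_funE) blast
  obtain \<sigma> where \<sigma>: "test_fun \<Omega> \<sigma>" "\<And>x. 0 \<le> \<sigma> x" "\<And>x. x \<in> K \<Longrightarrow> 0 < \<sigma> x"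
    by (rule test_fun_pos_on_compact[OF \<Omega> K(2,3)]) blast
  define A where "A = (\<integral>x. \<bar>h x\<bar> * \<sigma> x \<partial>lebesgue)"
  have int_\<sigma>: "integrable lebesgue (\<lambda>x. h x * \<sigma> x)"
    by (rule loc_integrable_mult_cc[OF h test_fun_imp_cc_fun[OF \<sigma>(1)]])
  have int_A: "integrable lebesgue (\<lambda>x. \<bar>h x\<bar> * \<sigma> x)"
    using integrable_abs[OF int_\<sigma>] \<sigma>(2) by (simp add: abs_mult)
  have int_c: "integrable lebesgue (\<lambda>x. h x * c x)" by (rule loc_integrable_mult_cc[OF h c(1)])
  have "A \<ge> 0" unfolding A_def using \<sigma>(2) by (intro integral_nonneg_AE) auto
  have *: "- 2 * e * A \<le> (\<integral>x. h x * c x \<partial>lebesgue)" if e: "e > 0" for e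
  proof -
    obtain \<eta> where \<eta>: "test_fun \<Omega> \<eta>" "\<And>x. \<bar>\<eta> x - c x\<bar> \<le> e * \<sigma> x"
      by (rule test_fun_approx[OF \<sigma> K(2,1,4) \<open>e > 0\<close>]) (auto intro: that)
    have "test_fun \<Omega> (\<lambda>x. \<eta> x + e * \<sigma> x)" by (intro test_fun_add test_fun_cmult \<eta> \<sigma>)
    moreover have "0 \<le> \<eta> x + e * \<sigma> x" for x using \<eta>(2)[of x] c(2)[of x] by linarith
    ultimately have "0 \<le> (\<integral>x. h x * (\<eta> x + e * \<sigma> x) \<partial>lebesgue)" by (rule nonneg)
    also have "\<dots> \<le> (\<integral>x. h x * c x + (2 * e) * (\<bar>h x\<bar> * \<sigma> x) \<partial>lebesgue)"
    proof (rule integral_mono)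
      have "integrable lebesgue (\<lambda>x. h x * \<eta> x)"
        by (rule loc_integrable_mult_cc[OF h test_fun_imp_cc_fun[OF \<eta>(1)]])
      then have "integrable lebesgue (\<lambda>x. h x * \<eta> x + e * (h x * \<sigma> x))"
        using int_\<sigma> by (intro Bochner_Integration.integrable_add integrable_mult_right) auto
      then show "integrable lebesgue (\<lambda>x. h x * (\<eta> x + e * \<sigma> x))" by (simp add: algebra_simps)
      show "integrable lebesgue (\<lambda>x. h x * c x + (2 * e) * (\<bar>h x\<bar> * \<sigma> x))"
        by (intro Bochner_Integration.integrable_add integrable_mult_right int_c int_A)
      fix x
      have "h x * (\<eta> x + e * \<sigma> x) - h x * c x \<le> \<bar>h x\<bar> * \<bar>\<eta> x + e * \<sigma> x - c x\<bar>"
        by (metis abs_ge_self abs_mult right_diff_distrib)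
      also have "\<dots> \<le> \<bar>h x\<bar> * (2 * e * \<sigma> x)"
        using \<eta>(2)[of x] by (intro mult_left_mono) auto
      finally show "h x * (\<eta> x + e * \<sigma> x) \<le> h x * c x + (2 * e) * (\<bar>h x\<bar> * \<sigma> x)" by (simp add: algebra_simps)
    qed
    also have "\<dots> = (\<integral>x. h x * c x \<partial>lebesgue) + 2 * e * A"
      unfolding A_def using int_c int_A
      by (subst Bochner_Integration.integral_add) (auto intro: integrable_mult_right)
    finally show ?thesis by simp
  qed
  show ?thesis
  proof (rule field_le_epsilon)
    fix e :: real assume "e > 0"
    have "2 * (e / (2 * (A + 1))) * A \<le> e"
      using \<open>A \<ge> 0\<close> \<open>e > 0\<close> by (simp add: field_simps)
    then show "0 \<le> (\<integral>x. h x * c x \<partial>lebesgue) + e"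
      using *[of "e / (2 * (A + 1))"] \<open>A \<ge> 0\<close> \<open>e > 0\<close> by simp
  qed
qed

text \<open>The indicator of \<open>K\<close> is the pointwise limit of continuous tents around
  \<open>K\<close>, and dominated convergence carries the sign over from
  \<open>integral_cc_nonneg\<close>.\<close>

lemma integral_compact_nonneg:
  fixes h :: "'a::euclidean_space \<Rightarrow> real"
  assumes \<Omega>: "open \<Omega>" and h: "loc_integrable \<Omega> h"
    and nonneg: "\<And>\<psi>. test_fun \<Omega> \<psi> \<Longrightarrow> (\<And>x. 0 \<le> \<psi> x) \<Longrightarrow> 0 \<le> (\<integral>x. h x * \<psi> x \<partial>lebesgue)"
    and K: "compact K" "K \<subseteq> \<Omega>"
  shows "0 \<le> (\<integral>x. h x * indicator K x \<partial>lebesgue)"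
proof (cases "K = {}")
  case False
  obtain r where r: "r > 0" "{x. infdist x K \<le> r} \<subseteq> \<Omega>"
    by (rule compact_in_open_separated[OF False K(1) \<Omega> K(2)]) blast
  \<comment> \<open>The factor \<open>Suc n\<close> instead of \<open>n\<close> makes already the
    widest tent \<open>c 0\<close> vanish outside the \<open>r\<close>-neighbourhood of
    \<open>K\<close>; this tent then dominates all the others.\<close>
  define c where "c n x = max 0 (1 - real (Suc n) / r * infdist x K)" for n x
  have cc: "cc_fun \<Omega> (c n)" for n
  proof (rule cc_funI[of _ "{x. infdist x K \<le> r}"])
    show "continuous_on UNIV (c n)" unfolding c_def by (intro continuous_intros)
    show "compact {x. infdist x K \<le> r}" by (rule compact_infdist_le[OF False K(1) r(1)])
    show "{x. infdist x K \<le> r} \<subseteq> \<Omega>" by fact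
    fix x assume "x \<notin> {x. infdist x K \<le> r}"
    then have "1 \<le> infdist x K / r" using r by simp
    also have "\<dots> \<le> real (Suc n) * (infdist x K / r)"
      using r infdist_nonneg[of x K] mult_right_mono[of 1 "real (Suc n)" "infdist x K / r"] by simp
    finally show "c n x = 0" by (simp add: c_def)
  qed
  have c_le: "\<bar>c n x\<bar> \<le> c 0 x" for n x
  proof -
    have "1 / r * infdist x K \<le> real (Suc n) / r * infdist x K"
      using r infdist_nonneg[of x K] by (intro mult_right_mono divide_right_mono) auto
    then show ?thesis by (auto simp: c_def)
  qed
  have lim: "(\<lambda>n. c n x) \<longlonglongrightarrow> indicator K x" for x
  proof (cases "x \<in> K")
    case True
    then have "c n x = 1" for n by (simp add: c_def)
    then show ?thesis using True by simp
  next
    case x: False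
    then have "infdist x K > 0"
      using K(1) False by (metis compact_imp_closed in_closed_iff_infdist_zero infdist_nonneg less_eq_real_def)
    obtain N :: nat where N: "r / infdist x K < N" using reals_Archimedean2 by blast
    have "c n x = 0" if "n \<ge> N" for n
    proof -
      have "r \<le> real (Suc n) * infdist x K"
      proof -
        have "r < real N * infdist x K" using N \<open>infdist x K > 0\<close> by (simp add: field_simps)
        also have "\<dots> \<le> real (Suc n) * infdist x K"
          using \<open>n \<ge> N\<close> \<open>infdist x K > 0\<close> by (intro mult_right_mono) auto
        finally show ?thesis by simp
      qed
      then show ?thesis using r by (simp add: c_def field_simps)
    qed
    then have "\<forall>\<^sub>F n in sequentially. c n x = 0" using eventually_sequentially by blast
    then show ?thesis using x by (simp add: tendsto_eventually)
  qed
  have "(\<lambda>n. \<integral>x. h x * c n x \<partial>lebesgue) \<longlonglongrightarrow> (\<integral>x. h x * indicator K x \<partial>lebesgue)"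
  proof (rule integral_dominated_convergence[where w = "\<lambda>x. \<bar>h x * c 0 x\<bar>"])
    have "(indicator K :: 'a \<Rightarrow> real) \<in> borel_measurable lebesgue"
      using K by (intro borel_measurable_indicator fmeasurableD[OF lmeasurable_compact])
    then have "integrable lebesgue (\<lambda>x. h x * indicator K x)"
      by (rule loc_integrable_mult_bounded[OF h K, of _ 1]) (auto simp: indicator_def)
    then show "(\<lambda>x. h x * indicator K x) \<in> borel_measurable lebesgue"
      by (rule borel_measurable_integrable)
    show "(\<lambda>x. h x * c n x) \<in> borel_measurable lebesgue" for n
      by (rule borel_measurable_integrable[OF loc_integrable_mult_cc[OF h cc]])
    show "integrable lebesgue (\<lambda>x. \<bar>h x * c 0 x\<bar>)"
      by (rule integrable_abs[OF loc_integrable_mult_cc[OF h cc]])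
    show "AE x in lebesgue. (\<lambda>n. h x * c n x) \<longlonglongrightarrow> h x * indicator K x"
      by (intro AE_I2 tendsto_mult tendsto_const lim)
    show "AE x in lebesgue. norm (h x * c n x) \<le> \<bar>h x * c 0 x\<bar>" for n
      unfolding real_norm_def abs_mult
      by (intro AE_I2 mult_left_mono order_trans[OF c_le abs_ge_self]) simp
  qed
  moreover have "0 \<le> (\<integral>x. h x * c n x \<partial>lebesgue)" for n
    by (rule integral_cc_nonneg[OF \<Omega> h nonneg cc]) (auto simp: c_def)
  ultimately show ?thesis using LIMSEQ_le_const by blast
qed simp

text \<open>A closed part of the set where \<open>h\<close> is negative has an integral of both
  signs, so it is null. By inner regularity the whole set is null.\<close>

lemma AE_nonneg_on_compact:
  fixes h :: "'a::euclidean_space \<Rightarrow> real"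
  assumes K: "compact K" and h: "set_integrable lebesgue K h"
    and nonneg: "\<And>T. compact T \<Longrightarrow> T \<subseteq> K \<Longrightarrow> 0 \<le> (\<integral>x. h x * indicator T x \<partial>lebesgue)"
  shows "AE x in lebesgue. x \<in> K \<longrightarrow> 0 \<le> h x"
proof -
  let ?k = "\<lambda>x. indicator K x *\<^sub>R h x"
  have k: "integrable lebesgue ?k" using h by (simp add: set_integrable_def)
  then have [measurable]: "?k \<in> borel_measurable lebesgue" by (rule borel_measurable_integrable)
  define S where "S = {x \<in> space lebesgue. ?k x < 0}"
  have SK: "S \<subseteq> K" by (auto simp: S_def indicator_def split: if_splits)
  have S: "S \<in> sets lebesgue" unfolding S_def by measurable
  have T0: "emeasure lebesgue T = 0" if T: "closed T" "T \<subseteq> S" for T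
  proof -
    have cT: "compact T" using T SK K by (metis closed_Int_compact inf.absorb1 subset_trans)
    have meas_T: "T \<in> sets lebesgue" by (intro sets_completionI_sets) (simp add: T(1))
    have eq: "(\<lambda>x. h x * indicator T x) = (\<lambda>x. indicator T x *\<^sub>R ?k x)"
      using T SK by (auto simp: fun_eq_iff indicator_def)
    have int: "integrable lebesgue (\<lambda>x. - (indicator T x *\<^sub>R ?k x))"
      using integrable_mult_indicator[OF meas_T k] by simp
    have neg: "0 \<le> - (indicator T x *\<^sub>R ?k x)" for x
      using T(2) by (auto simp: S_def indicator_def)
    have "(\<integral>x. - (indicator T x *\<^sub>R ?k x) \<partial>lebesgue) \<le> 0"
      using nonneg[OF cT] T(2) SK unfolding eq by simp
    then have "(\<integral>x. - (indicator T x *\<^sub>R ?k x) \<partial>lebesgue) = 0"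
      using neg by (intro antisym integral_nonneg_AE) auto
    then have "AE x in lebesgue. - (indicator T x *\<^sub>R ?k x) = 0"
      using integral_nonneg_eq_0_iff_AE[OF int] neg by auto
    then have "AE x in lebesgue. x \<notin> T"
      using T(2) by (auto simp: S_def indicator_def elim!: eventually_mono)
    then show ?thesis using meas_T by (simp add: AE_iff_measurable[of T])
  qed
  have "emeasure lebesgue S \<le> 0 + ennreal e" if "e > 0" for e
  proof -
    obtain T where T: "closed T" "T \<subseteq> S" "emeasure lebesgue (S - T) < ennreal e"
      by (rule sets_lebesgue_inner_closed[OF S \<open>e > 0\<close>]) blast
    have "emeasure lebesgue S \<le> emeasure lebesgue T + emeasure lebesgue (S - T)"
      using T S emeasure_subadditive[of T lebesgue "S - T"]
      by (metis Diff_partition borel_closed sets.Diff sets_completionI_sets sets_lborel)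
    then show ?thesis using T0[OF T(1,2)] T(3) by (metis add.left_neutral less_imp_le order_trans)
  qed
  then have "emeasure lebesgue S = 0"
    using ennreal_le_epsilon[of 0 "emeasure lebesgue S"] by auto
  then have "AE x in lebesgue. x \<notin> S" using S by (simp add: AE_iff_measurable[of S])
  then show ?thesis by eventually_elim (auto simp: S_def)
qed

text \<open>The fundamental lemma of the calculus of variations in one-sided form, obtained by
  exhausting \<open>\<Omega>\<close> with compact sets. Used twice it gives uniqueness of weak
  gradients; applied to \<open>M - G\<close> and \<open>M + G\<close> it later gives
  \<open>\<bar>G\<bar> \<le> M\<close>.\<close>

lemma AE_nonneg_if_integral_test_fun_nonneg:
  fixes h :: "'a::euclidean_space \<Rightarrow> real"
  assumes \<Omega>: "open \<Omega>" and h: "loc_integrable \<Omega> h"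
    and nonneg: "\<And>\<psi>. test_fun \<Omega> \<psi> \<Longrightarrow> (\<And>x. 0 \<le> \<psi> x) \<Longrightarrow> 0 \<le> (\<integral>x. h x * \<psi> x \<partial>lebesgue)"
  shows "AE x in lebesgue. x \<in> \<Omega> \<longrightarrow> 0 \<le> h x"
proof -
  obtain C :: "nat \<Rightarrow> 'a set" where C: "\<And>n. compact (C n)" "\<And>n. C n \<subseteq> \<Omega>" "\<Union>(range C) = \<Omega>"
    using open_Union_compact_subsets[OF \<Omega>] by metis
  have "AE x in lebesgue. x \<in> C n \<longrightarrow> 0 \<le> h x" for n
  proof (rule AE_nonneg_on_compact[OF C(1)])
    show "set_integrable lebesgue (C n) h" using h C unfolding loc_integrable_def by blast
    show "0 \<le> (\<integral>x. h x * indicator T x \<partial>lebesgue)" if "compact T" "T \<subseteq> C n" for T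
      using C(2)[of n] that by (intro integral_compact_nonneg[OF \<Omega> h nonneg]) auto
  qed
  then have "AE x in lebesgue. \<forall>n. x \<in> C n \<longrightarrow> 0 \<le> h x" unfolding AE_all_countable by blast
  then show ?thesis unfolding C(3)[symmetric] by eventually_elim blast
qed

lemma loc_integrable_diff:
  "loc_integrable \<Omega> f \<Longrightarrow> loc_integrable \<Omega> g \<Longrightarrow> loc_integrable \<Omega> (\<lambda>x. f x - g x)"
  unfolding loc_integrable_def by (auto intro: set_integral_diff(1))

lemma AE_eq_if_integral_test_fun_eq:
  fixes f g :: "'a::euclidean_space \<Rightarrow> real"
  assumes \<Omega>: "open \<Omega>" and fg: "loc_integrable \<Omega> f" "loc_integrable \<Omega> g"
    and eq: "\<And>\<psi>. test_fun \<Omega> \<psi> \<Longrightarrow> (\<integral>x. f x * \<psi> x \<partial>lebesgue) = (\<integral>x. g x * \<psi> x \<partial>lebesgue)"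
  shows "AE x in lebesgue. x \<in> \<Omega> \<longrightarrow> f x = g x"
proof -
  have diff: "(\<integral>x. (u x - v x) * \<psi> x \<partial>lebesgue) = (\<integral>x. u x * \<psi> x \<partial>lebesgue) - (\<integral>x. v x * \<psi> x \<partial>lebesgue)"
    if "loc_integrable \<Omega> u" "loc_integrable \<Omega> v" "test_fun \<Omega> \<psi>" for u v \<psi>
    unfolding left_diff_distrib
    by (intro Bochner_Integration.integral_diff loc_integrable_mult_cc[where \<Omega> = \<Omega>] test_fun_imp_cc_fun that)
  have "AE x in lebesgue. x \<in> \<Omega> \<longrightarrow> 0 \<le> f x - g x"
    by (rule AE_nonneg_if_integral_test_fun_nonneg[OF \<Omega> loc_integrable_diff[OF fg]]) (simp add: diff[OF fg] eq)
  moreover have "AE x in lebesgue. x \<in> \<Omega> \<longrightarrow> 0 \<le> g x - f x"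
    by (rule AE_nonneg_if_integral_test_fun_nonneg[OF \<Omega> loc_integrable_diff[OF fg(2,1)]]) (simp add: diff[OF fg(2,1)] eq)
  ultimately show ?thesis by eventually_elim auto
qed

text \<open>Since \<open>weak_grad\<close> is an arbitrary choice among weak gradients, this is what
  lets estimates on a concrete weak gradient speak about \<open>weak_grad\<close> and the
  energy.\<close>

lemma is_weak_grad_unique:
  assumes "open \<Omega>" "is_weak_grad \<Omega> f g" "is_weak_grad \<Omega> f g'"
  shows "AE x in lebesgue. x \<in> \<Omega> \<longrightarrow> g x = g' x"
proof -
  have "AE x in lebesgue. x \<in> \<Omega> \<longrightarrow> g x \<bullet> b = g' x \<bullet> b" if "b \<in> Basis" for b
    by (rule AE_eq_if_integral_test_fun_eq)
       (use assms that in \<open>unfold is_weak_grad_iff, auto dest!: spec[of _ b]\<close>)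
  then have "AE x in lebesgue. \<forall>b\<in>Basis. x \<in> \<Omega> \<longrightarrow> g x \<bullet> b = g' x \<bullet> b"
    by (intro AE_finite_allI) auto
  then show ?thesis by eventually_elim (auto intro: euclidean_eqI)
qed

lemma is_weak_grad_weak_grad: "is_weak_grad \<Omega> f g \<Longrightarrow> is_weak_grad \<Omega> f (weak_grad \<Omega> f)"
  unfolding weak_grad_def by (rule someI[of "is_weak_grad \<Omega> f"])

lemma weak_grad_AE_eq:
  assumes "open \<Omega>" "is_weak_grad \<Omega> f g"
  shows "AE x in lebesgue. x \<in> \<Omega> \<longrightarrow> weak_grad \<Omega> f x = g x"
  using is_weak_grad_unique[OF assms(1) is_weak_grad_weak_grad[OF assms(2)] assms(2)] .

section \<open>Translates of weakly differentiable functions\<close>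

lemma frechet_derivative_sum_Basis:
  fixes \<psi> :: "'a::euclidean_space \<Rightarrow> real"
  assumes "smooth_fun \<psi>"
  shows "frechet_derivative \<psi> (at x) h = (\<Sum>b\<in>Basis. (h \<bullet> b) * frechet_derivative \<psi> (at x) b)"
proof -
  have lin: "linear (frechet_derivative \<psi> (at x))"
    using smooth_fun_has_derivative[OF assms] by (rule has_derivative_linear)
  have "frechet_derivative \<psi> (at x) h = frechet_derivative \<psi> (at x) (\<Sum>b\<in>Basis. (h \<bullet> b) *\<^sub>R b)"
    by (simp add: euclidean_representation)
  also have "\<dots> = (\<Sum>b\<in>Basis. (h \<bullet> b) * frechet_derivative \<psi> (at x) b)"
    using lin by (simp add: linear_sum linear_cmul)
  finally show ?thesis .
qed

lemma test_fun_directional_derivative: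
  assumes "test_fun \<Omega> \<psi>"
  shows "test_fun \<Omega> (\<lambda>x. frechet_derivative \<psi> (at x) h)"
proof -
  have "smooth_fun \<psi>" using assms by (simp add: test_fun_def)
  then show ?thesis
    by (subst frechet_derivative_sum_Basis)
       (auto intro!: test_fun_sum test_fun_cmult test_fun_frechet_derivative assms)
qed

lemma smooth_fun_line_derivative:
  assumes "smooth_fun \<psi>"
  shows "((\<lambda>t. \<psi> (y - t *\<^sub>R h)) has_real_derivative - frechet_derivative \<psi> (at (y - t *\<^sub>R h)) h) (at t)"
proof -
  let ?D = "frechet_derivative \<psi> (at (y - t *\<^sub>R h))"
  have "((\<lambda>t. y - t *\<^sub>R h) has_derivative (\<lambda>s. - (s *\<^sub>R h))) (at t)"
    by (auto intro!: derivative_eq_intros)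
  then have "((\<lambda>t. \<psi> (y - t *\<^sub>R h)) has_derivative (\<lambda>s. ?D (- (s *\<^sub>R h)))) (at t)"
    by (rule has_derivative_compose[OF _ smooth_fun_has_derivative[OF assms]])
  moreover have "(\<lambda>s. ?D (- (s *\<^sub>R h))) = (*) (- ?D h)"
    using has_derivative_linear[OF smooth_fun_has_derivative[OF assms], of "y - t *\<^sub>R h"]
    by (auto simp: linear_neg linear_cmul)
  ultimately show ?thesis by (simp add: has_field_derivative_def)
qed

text \<open>Only \<open>\<psi>\<close> is differentiated, so integrability of \<open>u\<close>
  suffices: the difference quotients of \<open>\<psi>\<close> along \<open>h\<close> are bounded by
  the supremum \<open>B\<close> of the directional derivative, and \<open>\<bar>u\<bar> * B\<close>
  dominates.\<close>

lemma integral_shift_has_derivative: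
  fixes u \<psi> :: "'a::euclidean_space \<Rightarrow> real"
  assumes u: "integrable lebesgue u" and \<psi>: "test_fun UNIV \<psi>"
  shows "((\<lambda>t. \<integral>z. u z * \<psi> (z - t *\<^sub>R h) \<partial>lebesgue) has_real_derivative
      - (\<integral>z. u z * frechet_derivative \<psi> (at (z - t *\<^sub>R h)) h \<partial>lebesgue)) (at t)"
proof -
  let ?D = "\<lambda>y. frechet_derivative \<psi> (at y) h"
  have sm: "smooth_fun \<psi>" using \<psi> by (simp add: test_fun_def)
  have cc: "cc_fun UNIV \<psi>" "cc_fun UNIV ?D"
    using \<psi> test_fun_directional_derivative by (blast intro: test_fun_imp_cc_fun)+
  obtain B where B: "\<And>y. \<bar>?D y\<bar> \<le> B" by (rule cc_fun_bounded[OF cc(2)]) blast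
  have lip: "\<bar>\<psi> (z - t *\<^sub>R h) - \<psi> (z - s *\<^sub>R h)\<bar> \<le> B * \<bar>t - s\<bar>" for z s t
    using field_differentiable_bound[of UNIV "\<lambda>t. \<psi> (z - t *\<^sub>R h)" "\<lambda>t. - ?D (z - t *\<^sub>R h)" B t s]
      smooth_fun_line_derivative[OF sm] B by simp
  have int: "integrable lebesgue (\<lambda>z. u z * c (z - t *\<^sub>R h))" if c: "cc_fun UNIV c" for c t
  proof -
    obtain B where B: "\<And>y. \<bar>c y\<bar> \<le> B" by (rule cc_fun_bounded[OF c]) blast
    have "continuous_on UNIV c" using c by (simp add: cc_fun_def)
    then have "continuous_on UNIV (\<lambda>z. c (z - t *\<^sub>R h))"
      by (rule continuous_on_compose2) (auto intro: continuous_intros)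
    then have meas: "(\<lambda>z. c (z - t *\<^sub>R h)) \<in> borel_measurable lebesgue"
      by (rule continuous_on_UNIV_measurable_lebesgue)
    show ?thesis
    proof (rule Bochner_Integration.integrable_bound[OF integrable_mult_left[OF integrable_abs[OF u], of B]])
      show "(\<lambda>z. u z * c (z - t *\<^sub>R h)) \<in> borel_measurable lebesgue"
        by (intro borel_measurable_times borel_measurable_integrable[OF u] meas)
      show "AE z in lebesgue. norm (u z * c (z - t *\<^sub>R h)) \<le> norm (\<bar>u z\<bar> * B)"
        unfolding real_norm_def abs_mult abs_idempotent
        by (intro AE_I2 mult_left_mono order_trans[OF B abs_ge_self]) simp
    qed
  qed
  have "((\<lambda>s. ((\<integral>z. u z * \<psi> (z - (t + s) *\<^sub>R h) \<partial>lebesgue) - (\<integral>z. u z * \<psi> (z - t *\<^sub>R h) \<partial>lebesgue)) / s)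
      \<longlongrightarrow> - (\<integral>z. u z * ?D (z - t *\<^sub>R h) \<partial>lebesgue)) (at 0)"
  proof (subst tendsto_at_iff_sequentially, intro allI impI)
    fix X :: "nat \<Rightarrow> real" assume X: "\<forall>i. X i \<in> UNIV - {0}" "X \<longlonglongrightarrow> 0"
    have eq: "((\<integral>z. u z * \<psi> (z - (t + s) *\<^sub>R h) \<partial>lebesgue) - (\<integral>z. u z * \<psi> (z - t *\<^sub>R h) \<partial>lebesgue)) / s
        = (\<integral>z. u z * ((\<psi> (z - (t + s) *\<^sub>R h) - \<psi> (z - t *\<^sub>R h)) / s) \<partial>lebesgue)" for s
      by (subst Bochner_Integration.integral_diff[OF int[OF cc(1)] int[OF cc(1)], symmetric],
          subst integral_divide_zero[symmetric]) (simp add: right_diff_distrib)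
    have "(\<lambda>i. \<integral>z. u z * ((\<psi> (z - (t + X i) *\<^sub>R h) - \<psi> (z - t *\<^sub>R h)) / X i) \<partial>lebesgue)
      \<longlonglongrightarrow> (\<integral>z. u z * - ?D (z - t *\<^sub>R h) \<partial>lebesgue)"
    proof (rule integral_dominated_convergence[where w = "\<lambda>z. \<bar>u z\<bar> * B"])
      show "integrable lebesgue (\<lambda>z. \<bar>u z\<bar> * B)" using u by (intro integrable_mult_left integrable_abs)
      show "(\<lambda>z. u z * - ?D (z - t *\<^sub>R h)) \<in> borel_measurable lebesgue"
        using borel_measurable_integrable[OF int[OF cc(2), of t]] by simp
      show "(\<lambda>z. u z * ((\<psi> (z - (t + X i) *\<^sub>R h) - \<psi> (z - t *\<^sub>R h)) / X i)) \<in> borel_measurable lebesgue" for i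
      proof -
        have "(\<lambda>z. (u z * \<psi> (z - (t + X i) *\<^sub>R h) - u z * \<psi> (z - t *\<^sub>R h)) / X i) \<in> borel_measurable lebesgue"
          using borel_measurable_integrable[OF int[OF cc(1)]]
          by (intro borel_measurable_divide borel_measurable_diff) auto
        then show ?thesis by (simp add: right_diff_distrib)
      qed
      show "AE z in lebesgue. (\<lambda>i. u z * ((\<psi> (z - (t + X i) *\<^sub>R h) - \<psi> (z - t *\<^sub>R h)) / X i))
          \<longlonglongrightarrow> u z * - ?D (z - t *\<^sub>R h)"
      proof (intro AE_I2 tendsto_mult tendsto_const)
        fix z
        have "((\<lambda>s. (\<psi> (z - (t + s) *\<^sub>R h) - \<psi> (z - t *\<^sub>R h)) / s) \<longlongrightarrow> - ?D (z - t *\<^sub>R h)) (at 0)"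
          using smooth_fun_line_derivative[OF sm] unfolding DERIV_def .
        then show "(\<lambda>i. (\<psi> (z - (t + X i) *\<^sub>R h) - \<psi> (z - t *\<^sub>R h)) / X i) \<longlonglongrightarrow> - ?D (z - t *\<^sub>R h)"
          using X unfolding tendsto_at_iff_sequentially by (auto simp: o_def)
      qed
      show "AE z in lebesgue. norm (u z * ((\<psi> (z - (t + X i) *\<^sub>R h) - \<psi> (z - t *\<^sub>R h)) / X i)) \<le> \<bar>u z\<bar> * B" for i
      proof (rule AE_I2)
        fix z
        have "X i \<noteq> 0" using X by auto
        then have "\<bar>(\<psi> (z - (t + X i) *\<^sub>R h) - \<psi> (z - t *\<^sub>R h)) / X i\<bar> \<le> B"
          using lip[of z "t + X i" t] by (simp add: divide_simps)
        then show "norm (u z * ((\<psi> (z - (t + X i) *\<^sub>R h) - \<psi> (z - t *\<^sub>R h)) / X i)) \<le> \<bar>u z\<bar> * B"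
          unfolding real_norm_def abs_mult by (rule mult_left_mono) simp
      qed
    qed
    then show "((\<lambda>s. ((\<integral>z. u z * \<psi> (z - (t + s) *\<^sub>R h) \<partial>lebesgue) - (\<integral>z. u z * \<psi> (z - t *\<^sub>R h) \<partial>lebesgue)) / s) \<circ> X)
        \<longlonglongrightarrow> - (\<integral>z. u z * ?D (z - t *\<^sub>R h) \<partial>lebesgue)"
      by (simp add: eq o_def)
  qed
  then show ?thesis unfolding DERIV_def .
qed

lemma smooth_fun_shift:
  assumes "smooth_fun \<psi>" shows "smooth_fun (\<lambda>z. \<psi> (z - a))"
proof -
  have "Ck_fun k (\<lambda>z. f (z - a))" if "Ck_fun k f" for k and f :: "'a \<Rightarrow> real"
    using that
  proof (induction k arbitrary: f)
    case 0
    then show ?case by (auto intro!: continuous_on_compose2[of UNIV f] continuous_intros)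
  next
    case (Suc k)
    show ?case
    proof (rule Ck_fun_SucI)
      have "((\<lambda>z. z - a) has_derivative (\<lambda>h. h)) (at x)" for x
        by (auto intro!: derivative_eq_intros)
      then show "((\<lambda>z. f (z - a)) has_derivative frechet_derivative f (at (x - a))) (at x)" for x
        using has_derivative_compose[OF _ Ck_fun_Suc_has_derivative[OF Suc.prems]] by blast
      show "Ck_fun k (\<lambda>x. frechet_derivative f (at (x - a)) b)" if "b \<in> Basis" for b
        using Suc.prems \<open>b \<in> Basis\<close> by (intro Suc.IH[of "\<lambda>x. frechet_derivative f (at x) b"]) auto
    qed
  qed
  then show ?thesis using assms by (simp add: smooth_fun_def)
qed

lemma frechet_derivative_shift:
  assumes "smooth_fun \<psi>"
  shows "frechet_derivative (\<lambda>z. \<psi> (z - a)) (at x) = frechet_derivative \<psi> (at (x - a))"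
proof -
  have "((\<lambda>z. z - a) has_derivative (\<lambda>h. h)) (at x)"
    by (auto intro!: derivative_eq_intros)
  then have "((\<lambda>z. \<psi> (z - a)) has_derivative frechet_derivative \<psi> (at (x - a))) (at x)"
    using has_derivative_compose[OF _ smooth_fun_has_derivative[OF assms]] by blast
  then show ?thesis by (metis frechet_derivative_at)
qed

lemma is_weak_grad_direction:
  assumes g: "is_weak_grad \<Omega> u g" and u: "loc_integrable \<Omega> u" and \<psi>: "test_fun \<Omega> \<psi>"
  shows "(\<integral>x. u x * frechet_derivative \<psi> (at x) h \<partial>lebesgue) = - (\<integral>x. (g x \<bullet> h) * \<psi> x \<partial>lebesgue)"
proof -
  have sm: "smooth_fun \<psi>" using \<psi> by (simp add: test_fun_def)
  have gi: "integrable lebesgue (\<lambda>x. (g x \<bullet> b) * \<psi> x)" if "b \<in> Basis" for b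
    using g that unfolding is_weak_grad_iff
    by (intro loc_integrable_mult_cc[where \<Omega> = \<Omega>] test_fun_imp_cc_fun[OF \<psi>]) auto
  have ui: "integrable lebesgue (\<lambda>x. u x * frechet_derivative \<psi> (at x) b)" for b
    by (rule loc_integrable_mult_cc[OF u test_fun_imp_cc_fun[OF test_fun_directional_derivative[OF \<psi>]]])
  have "(\<integral>x. u x * frechet_derivative \<psi> (at x) h \<partial>lebesgue)
      = (\<integral>x. (\<Sum>b\<in>Basis. (h \<bullet> b) * (u x * frechet_derivative \<psi> (at x) b)) \<partial>lebesgue)"
    by (subst frechet_derivative_sum_Basis[OF sm]) (simp add: sum_distrib_left mult_ac)
  also have "\<dots> = (\<Sum>b\<in>Basis. (h \<bullet> b) * (\<integral>x. u x * frechet_derivative \<psi> (at x) b \<partial>lebesgue))"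
    using ui by (subst Bochner_Integration.integral_sum) auto
  also have "\<dots> = (\<Sum>b\<in>Basis. (h \<bullet> b) * - (\<integral>x. (g x \<bullet> b) * \<psi> x \<partial>lebesgue))"
    using g \<psi> unfolding is_weak_grad_iff by (intro sum.cong) auto
  also have "\<dots> = - (\<Sum>b\<in>Basis. (\<integral>x. (h \<bullet> b) * ((g x \<bullet> b) * \<psi> x) \<partial>lebesgue))"
    by (simp add: sum_negf)
  also have "\<dots> = - (\<integral>x. (\<Sum>b\<in>Basis. (h \<bullet> b) * ((g x \<bullet> b) * \<psi> x)) \<partial>lebesgue)"
    using gi by (subst Bochner_Integration.integral_sum) auto
  also have "\<dots> = - (\<integral>x. (g x \<bullet> h) * \<psi> x \<partial>lebesgue)"
    by (subst euclidean_inner[of "g _" h]) (simp add: sum_distrib_left mult_ac)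
  finally show ?thesis .
qed

text \<open>As long as the segments from \<open>K\<close> in direction \<open>h\<close> stay in
  \<open>\<Omega>\<close>, every translate \<open>\<psi> (z - t *\<^sub>R h)\<close> is itself a
  test function on \<open>\<Omega>\<close>. The weak gradient therefore expresses the derivative in
  \<open>t\<close> of the integral of \<open>u\<close> against it, and the mean value theorem on the
  interval from 0 to 1 applies.\<close>

lemma integral_shift_mean_value:
  assumes g: "is_weak_grad \<Omega> u g" and u: "loc_integrable \<Omega> u"
    and \<psi>: "test_fun K \<psi>" "compact K"
    and seg: "\<And>z t. z \<in> K \<Longrightarrow> 0 \<le> t \<Longrightarrow> t \<le> 1 \<Longrightarrow> z + t *\<^sub>R h \<in> \<Omega>"
  obtains \<xi> where "0 < \<xi>" "\<xi> < 1"
    "(\<integral>z. u z * \<psi> (z - h) \<partial>lebesgue) - (\<integral>z. u z * \<psi> z \<partial>lebesgue)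
      = (\<integral>z. (g z \<bullet> h) * \<psi> (z - \<xi> *\<^sub>R h) \<partial>lebesgue)"
proof -
  \<comment> \<open>The set swept out by \<open>K\<close> contains the supports of all translates
    with \<open>t\<close> between 0 and 1.\<close>
  define K' where "K' = (\<lambda>(t, z). z + t *\<^sub>R h) ` ({0..1} \<times> K)"
  have K': "compact K'" "K' \<subseteq> \<Omega>"
    unfolding K'_def using \<psi>(2) seg
    by (auto intro!: compact_continuous_image compact_Times continuous_intros simp: case_prod_unfold)
  have \<psi>K: "smooth_fun \<psi>" "\<And>z. z \<notin> K \<Longrightarrow> \<psi> z = 0"
    using \<psi>(1) by (auto elim!: test_funE)
  have DK: "frechet_derivative \<psi> (at z) h = 0" if "z \<notin> K" for z
    using test_fun_directional_derivative[OF \<psi>(1), of h] that by (auto elim!: test_funE)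
  \<comment> \<open>Cutting \<open>u\<close> off outside the swept set makes it integrable on the
    whole space without changing the integrals for \<open>t\<close> between 0 and 1.\<close>
  define v where "v z = indicator K' z *\<^sub>R u z" for z
  have v: "integrable lebesgue v"
    using u K' unfolding v_def loc_integrable_def set_integrable_def by blast
  have in_K': "z \<in> K'" if "z - t *\<^sub>R h \<in> K" "0 \<le> t" "t \<le> 1" for z t
    using that unfolding K'_def by (auto intro!: image_eqI[of _ _ "(t, z - t *\<^sub>R h)"])
  have test: "test_fun \<Omega> (\<lambda>z. \<psi> (z - t *\<^sub>R h))" if "0 \<le> t" "t \<le> 1" for t
  proof (rule test_funI[OF smooth_fun_shift[OF \<psi>K(1)] K'])
    show "\<psi> (z - t *\<^sub>R h) = 0" if "z \<notin> K'" for z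
      using in_K' \<open>0 \<le> t\<close> \<open>t \<le> 1\<close> that by (intro \<psi>K(2)) blast
  qed
  define F where "F t = (\<integral>z. v z * \<psi> (z - t *\<^sub>R h) \<partial>lebesgue)" for t
  have F_eq: "F t = (\<integral>z. u z * \<psi> (z - t *\<^sub>R h) \<partial>lebesgue)" if "0 \<le> t" "t \<le> 1" for t
    unfolding F_def v_def
    using in_K' that \<psi>K(2) by (intro Bochner_Integration.integral_cong) (auto simp: indicator_def)
  have F': "(F has_real_derivative (\<integral>z. (g z \<bullet> h) * \<psi> (z - t *\<^sub>R h) \<partial>lebesgue)) (at t)"
    if t: "0 \<le> t" "t \<le> 1" for t
  proof -
    have "(F has_real_derivative - (\<integral>z. v z * frechet_derivative \<psi> (at (z - t *\<^sub>R h)) h \<partial>lebesgue)) (at t)"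
      unfolding F_def by (rule integral_shift_has_derivative[OF v test_fun_mono[OF \<psi>(1)]]) simp
    moreover have "(\<integral>z. v z * frechet_derivative \<psi> (at (z - t *\<^sub>R h)) h \<partial>lebesgue)
        = (\<integral>z. u z * frechet_derivative \<psi> (at (z - t *\<^sub>R h)) h \<partial>lebesgue)"
      unfolding v_def using in_K' t DK by (intro Bochner_Integration.integral_cong) (auto simp: indicator_def)
    moreover have "\<dots> = - (\<integral>z. (g z \<bullet> h) * \<psi> (z - t *\<^sub>R h) \<partial>lebesgue)"
      using is_weak_grad_direction[OF g u test[OF t], of h] by (simp add: frechet_derivative_shift[OF \<psi>K(1)])
    ultimately show ?thesis by simp
  qed
  obtain \<xi> where \<xi>: "\<xi> > 0" "\<xi> < 1" "F 1 - F 0 = (1 - 0) * (\<integral>z. (g z \<bullet> h) * \<psi> (z - \<xi> *\<^sub>R h) \<partial>lebesgue)"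
    using MVT2[of 0 1 F "\<lambda>t. \<integral>z. (g z \<bullet> h) * \<psi> (z - t *\<^sub>R h) \<partial>lebesgue"] F' by auto
  then show ?thesis using that[of \<xi>] F_eq[of 0] F_eq[of 1] by simp
qed

section \<open>Translation invariance and pointwise increments\<close>

lemma integral_lebesgue_shift:
  fixes v :: "'a::euclidean_space \<Rightarrow> real"
  assumes "v \<in> borel_measurable borel"
  shows "(\<integral>z. v (z + h) \<partial>lebesgue) = (\<integral>z. v z \<partial>lebesgue)"
proof -
  have "(\<integral>z. v z \<partial>lebesgue) = (\<integral>z. v z \<partial>distr lborel borel ((+) h))"
    using assms by (simp add: integral_completion lborel_distr_plus)
  also have "\<dots> = (\<integral>z. v (h + z) \<partial>lborel)" by (rule integral_distr) (use assms in auto)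
  also have "\<dots> = (\<integral>z. v (z + h) \<partial>lebesgue)"
    using assms by (subst integral_completion) (auto simp: add.commute)
  finally show ?thesis by simp
qed

lemma cc_fun_times_continuous_on:
  fixes u :: "'a::euclidean_space \<Rightarrow> real"
  assumes "open \<Omega>" "continuous_on \<Omega> u" "cc_fun \<Omega> c"
  shows "cc_fun \<Omega> (\<lambda>z. u z * c z)"
proof -
  from assms(3) obtain K where K: "continuous_on UNIV c" "compact K" "K \<subseteq> \<Omega>" "\<And>x. x \<notin> K \<Longrightarrow> c x = 0"
    by (rule cc_funE) blast
  have "continuous_on (\<Omega> \<union> - K) (\<lambda>z. u z * c z)"
  proof (rule continuous_on_open_Un)
    show "open \<Omega>" by fact
    show "open (- K)" using K by (simp add: compact_imp_closed open_Compl)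
    show "continuous_on \<Omega> (\<lambda>z. u z * c z)"
      by (intro continuous_on_mult assms(2) continuous_on_subset[OF K(1)]) simp
    show "continuous_on (- K) (\<lambda>z. u z * c z)"
      using K(4) by (auto intro: continuous_on_eq[of _ "\<lambda>_. 0"])
  qed
  moreover have "\<Omega> \<union> - K = UNIV" using K by auto
  ultimately have "continuous_on UNIV (\<lambda>z. u z * c z)" by simp
  then show ?thesis using K by (intro cc_funI[of _ K]) auto
qed

lemma cc_fun_shift:
  assumes "cc_fun K c" "\<And>z. z \<in> K \<Longrightarrow> z + a \<in> \<Omega>"
  shows "cc_fun \<Omega> (\<lambda>z. c (z - a))"
proof -
  from assms(1) obtain C where C: "continuous_on UNIV c" "compact C" "C \<subseteq> K" "\<And>x. x \<notin> C \<Longrightarrow> c x = 0"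
    by (rule cc_funE) blast
  show ?thesis
  proof (rule cc_funI)
    show "continuous_on UNIV (\<lambda>z. c (z - a))"
      by (intro continuous_on_compose2[OF C(1)] continuous_intros) auto
    show "compact ((+) a ` C)" using C by (intro compact_translation)
    show "(+) a ` C \<subseteq> \<Omega>" using C(3) assms(2) by (auto simp: add.commute)
    show "c (z - a) = 0" if "z \<notin> (+) a ` C" for z
      using that C(4)[of "z - a"] by (auto simp: image_iff) (metis add.commute diff_add_cancel)
  qed
qed

lemma cc_fun_mono: "cc_fun K c \<Longrightarrow> K \<subseteq> \<Omega> \<Longrightarrow> cc_fun \<Omega> c"
  unfolding cc_fun_def by blast

text \<open>A discrete integration by parts. Nothing is known about \<open>u\<close> outside
  \<open>\<Omega>\<close>, but the products with \<open>c\<close> are continuous everywhere because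
  \<open>c\<close> cuts them off.\<close>

lemma cc_fun_difference:
  fixes u :: "'a::euclidean_space \<Rightarrow> real"
  assumes "open \<Omega>" "continuous_on \<Omega> u" "cc_fun K c"
    and "K \<subseteq> \<Omega>" "\<And>z. z \<in> K \<Longrightarrow> z + h \<in> \<Omega>"
  shows "integrable lebesgue (\<lambda>z. (u (z + h) - u z) * c z)"
    and "(\<integral>z. (u (z + h) - u z) * c z \<partial>lebesgue)
      = (\<integral>z. u z * c (z - h) \<partial>lebesgue) - (\<integral>z. u z * c z \<partial>lebesgue)"
proof -
  have 1: "cc_fun \<Omega> (\<lambda>z. u z * c (z - h))"
    by (intro cc_fun_times_continuous_on assms cc_fun_shift[OF assms(3)])
  have 2: "cc_fun \<Omega> (\<lambda>z. u z * c z)"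
    by (intro cc_fun_times_continuous_on assms cc_fun_mono[OF assms(3,4)])
  \<comment> \<open>This is the function of the first fact translated by \<open>- h\<close>, so it
    needs no continuity of \<open>u (z + h)\<close> away from the support of
    \<open>c\<close>.\<close>
  have "cc_fun UNIV (\<lambda>z. u (z + h) * c z)"
    using cc_fun_shift[OF 1, of "- h" UNIV] by simp
  then have i: "integrable lebesgue (\<lambda>z. u (z + h) * c z)" "integrable lebesgue (\<lambda>z. u z * c z)"
    using loc_integrable_mult_cc[OF continuous_on_imp_loc_integrable, of UNIV "\<lambda>_. 1"] cc_fun_mono[OF 2, of UNIV]
    by auto
  then show "integrable lebesgue (\<lambda>z. (u (z + h) - u z) * c z)" by (simp add: left_diff_distrib)
  have "(\<lambda>z. u z * c (z - h)) \<in> borel_measurable borel"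
    using 1 by (auto simp: cc_fun_def intro: borel_measurable_continuous_onI)
  from integral_lebesgue_shift[OF this, of h]
  show "(\<integral>z. (u (z + h) - u z) * c z \<partial>lebesgue)
      = (\<integral>z. u z * c (z - h) \<partial>lebesgue) - (\<integral>z. u z * c z \<partial>lebesgue)"
    using i by (simp add: left_diff_distrib)
qed

lemma is_weak_grad_loc_integrable:
  assumes "is_weak_grad \<Omega> f g"
  shows "loc_integrable \<Omega> (\<lambda>x. g x \<bullet> h)"
proof -
  have "loc_integrable \<Omega> (\<lambda>x. \<Sum>b\<in>Basis. (g x \<bullet> b) * (h \<bullet> b))"
    using assms unfolding is_weak_grad_def loc_integrable_def set_integrable_def
    by (auto simp: sum_distrib_left mult.assoc[symmetric] intro!: Bochner_Integration.integrable_sum integrable_mult_left)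
  then show ?thesis by (simp add: euclidean_inner[of _ h])
qed

lemma cc_fun_integrable: "cc_fun \<Omega> c \<Longrightarrow> integrable lebesgue c"
  using loc_integrable_mult_cc[OF continuous_on_imp_loc_integrable, of UNIV "\<lambda>_. 1" c] cc_fun_mono[of \<Omega> c UNIV]
  by auto

lemma cc_fun_integral_pos:
  fixes c :: "'a::euclidean_space \<Rightarrow> real"
  assumes c: "cc_fun \<Omega> c" "\<And>z. 0 \<le> c z" and pos: "\<And>z. z \<in> ball x r \<Longrightarrow> 0 < c z" and "0 < r"
  shows "0 < (\<integral>z. c z \<partial>lebesgue)"
proof -
  have int: "integrable lebesgue c" by (rule cc_fun_integrable[OF c(1)])
  have "(\<integral>z. c z \<partial>lebesgue) \<noteq> 0"
  proof
    assume "(\<integral>z. c z \<partial>lebesgue) = 0"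
    then have "AE z in lebesgue. c z = 0"
      using integral_nonneg_eq_0_iff_AE[OF int] c(2) by auto
    then have "AE z in lebesgue. z \<notin> ball x r"
      by eventually_elim (use pos in force)
    then have "ball x r \<in> null_sets lebesgue" by (simp add: AE_iff_null_sets)
    then have "negligible (ball x r)" by (simp add: negligible_iff_null_sets)
    moreover have "\<not> negligible (ball x r)"
      using open_not_negligible[of "ball x r"] \<open>0 < r\<close> by auto
    ultimately show False by blast
  qed
  then show ?thesis
    using integral_nonneg_AE[of c lebesgue] c(2) by (auto simp: less_le)
qed

text \<open>An increment that is too large at \<open>x\<close> stays too large on a small ball, by
  continuity. Integrated against a bump on that ball it contradicts the mean value formula, whose
  right-hand side is at most \<open>L * norm h\<close> times the integral of the bump. Convexity of
  \<open>U\<close> keeps the segments from \<open>z\<close> to \<open>z + h\<close> inside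
  \<open>\<Omega>\<close>.\<close>

lemma continuous_weak_grad_bounded_increment_le:
  fixes f :: "'a::euclidean_space \<Rightarrow> real"
  assumes f: "continuous_on \<Omega> f" "open \<Omega>" and g: "is_weak_grad \<Omega> f g"
    and bound: "AE z in lebesgue. z \<in> \<Omega> \<longrightarrow> norm (g z) \<le> L"
    and U: "convex U" "open U" "U \<subseteq> \<Omega>" "x \<in> U" "y \<in> U"
  shows "f y - f x \<le> L * norm (y - x)"
proof (rule ccontr)
  define h where "h = y - x"
  \<comment> \<open>Half of the excess: the other half gives a strict inequality at
    \<open>x\<close>, which persists nearby.\<close>
  define e where "e = (f y - f x - L * norm h) / 2"
  assume "\<not> f y - f x \<le> L * norm (y - x)"
  then have e: "e > 0" "f (x + h) - f x > L * norm h + e" unfolding e_def h_def by (auto simp: field_simps)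
  define W where "W = U \<inter> (\<lambda>z. z + h) -` U"
  have W: "open W" unfolding W_def
    by (intro continuous_open_preimage continuous_intros U(2))
  have "continuous_on W (\<lambda>z. f (z + h) - f z)"
    by (intro continuous_on_diff continuous_on_compose2[OF f(1)] continuous_on_subset[OF f(1)] continuous_intros)
       (use U W_def in auto)
  then have "open (W \<inter> (\<lambda>z. f (z + h) - f z) -` {L * norm h + e<..})"
    using W by (intro continuous_open_preimage) auto
  moreover have "x \<in> W \<inter> (\<lambda>z. f (z + h) - f z) -` {L * norm h + e<..}"
    using U e unfolding W_def h_def by auto
  ultimately obtain r where r: "r > 0" "cball x r \<subseteq> W \<inter> (\<lambda>z. f (z + h) - f z) -` {L * norm h + e<..}"
    using open_contains_cball_eq by blast
  obtain \<psi> where \<psi>: "test_fun (cball x r) \<psi>" "\<And>z. 0 \<le> \<psi> z" "\<And>z. z \<in> ball x r \<Longrightarrow> 0 < \<psi> z"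
    using test_fun_ball_exists[OF r(1)] by blast
  have \<psi>0: "\<psi> z = 0" if "z \<notin> cball x r" for z
    using \<psi>(1) that by (auto elim!: test_funE)
  note cc = test_fun_imp_cc_fun[OF \<psi>(1)]
  have seg: "z + t *\<^sub>R h \<in> \<Omega>" if "z \<in> cball x r" "0 \<le> t" "t \<le> 1" for z t
  proof -
    have "z \<in> U" "z + h \<in> U" using r(2) that(1) unfolding W_def by auto
    then have "(1 - t) *\<^sub>R z + t *\<^sub>R (z + h) \<in> U" using U(1) that by (simp add: convex_alt)
    then show ?thesis using U(3) by (auto simp: algebra_simps)
  qed
  obtain \<xi> where \<xi>: "0 < \<xi>" "\<xi> < 1" and eq:
    "(\<integral>z. f z * \<psi> (z - h) \<partial>lebesgue) - (\<integral>z. f z * \<psi> z \<partial>lebesgue)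
      = (\<integral>z. (g z \<bullet> h) * \<psi> (z - \<xi> *\<^sub>R h) \<partial>lebesgue)"
    by (rule integral_shift_mean_value[OF g continuous_on_imp_loc_integrable[OF f(1)] \<psi>(1) compact_cball seg])
       auto
  have KU: "cball x r \<subseteq> \<Omega>" "\<And>z. z \<in> cball x r \<Longrightarrow> z + h \<in> \<Omega>" using seg[of _ 0] seg[of _ 1] by auto
  note diff = cc_fun_difference[OF f(2,1) cc KU]
  have int: "integrable lebesgue \<psi>" by (rule cc_fun_integrable[OF cc])
  have cc': "cc_fun \<Omega> (\<lambda>z. \<psi> (z - \<xi> *\<^sub>R h))"
    by (rule cc_fun_shift[OF cc]) (use seg[of _ \<xi>] \<xi> in auto)
  have shift: "(\<integral>z. \<psi> (z - \<xi> *\<^sub>R h) \<partial>lebesgue) = (\<integral>z. \<psi> z \<partial>lebesgue)"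
    using integral_lebesgue_shift[of \<psi> "- (\<xi> *\<^sub>R h)"] cc by (auto simp: cc_fun_def intro: borel_measurable_continuous_onI)
  have "(L * norm h + e) * (\<integral>z. \<psi> z \<partial>lebesgue) = (\<integral>z. (L * norm h + e) * \<psi> z \<partial>lebesgue)"
    by simp
  also have "\<dots> \<le> (\<integral>z. (f (z + h) - f z) * \<psi> z \<partial>lebesgue)"
  proof (rule integral_mono)
    show "integrable lebesgue (\<lambda>z. (L * norm h + e) * \<psi> z)" using int by simp
    show "(L * norm h + e) * \<psi> z \<le> (f (z + h) - f z) * \<psi> z" for z
    proof (cases "z \<in> cball x r")
      case True
      then have "L * norm h + e \<le> f (z + h) - f z" using r(2) by fastforce
      then show ?thesis using \<psi>(2) by (intro mult_right_mono) auto
    qed (simp add: \<psi>0)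
  qed (rule diff(1))
  also have "\<dots> = (\<integral>z. (g z \<bullet> h) * \<psi> (z - \<xi> *\<^sub>R h) \<partial>lebesgue)" using diff(2) eq by simp
  also have "\<dots> \<le> (\<integral>z. (L * norm h) * \<psi> (z - \<xi> *\<^sub>R h) \<partial>lebesgue)"
  proof (rule integral_mono_AE)
    show "integrable lebesgue (\<lambda>z. (g z \<bullet> h) * \<psi> (z - \<xi> *\<^sub>R h))"
      by (rule loc_integrable_mult_cc[OF is_weak_grad_loc_integrable[OF g] cc'])
    show "integrable lebesgue (\<lambda>z. (L * norm h) * \<psi> (z - \<xi> *\<^sub>R h))"
      using cc_fun_integrable[OF cc'] by simp
    show "AE z in lebesgue. (g z \<bullet> h) * \<psi> (z - \<xi> *\<^sub>R h) \<le> (L * norm h) * \<psi> (z - \<xi> *\<^sub>R h)"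
      using bound
    proof eventually_elim
      case (elim z)
      show ?case
      proof (cases "z - \<xi> *\<^sub>R h \<in> cball x r")
        case True
        then have "z \<in> \<Omega>" using seg[OF True, of \<xi>] \<xi> by simp
        then have "g z \<bullet> h \<le> L * norm h"
          using elim norm_cauchy_schwarz[of "g z" h] mult_right_mono[of "norm (g z)" L "norm h"] by auto
        then show ?thesis using \<psi>(2) by (intro mult_right_mono)
      qed (simp add: \<psi>0)
    qed
  qed
  also have "\<dots> = L * norm h * (\<integral>z. \<psi> z \<partial>lebesgue)" by (simp add: shift)
  finally have "e * (\<integral>z. \<psi> z \<partial>lebesgue) \<le> 0" by (simp add: algebra_simps)
  moreover have "(\<integral>z. \<psi> z \<partial>lebesgue) > 0" by (rule cc_fun_integral_pos[OF cc \<psi>(2,3) r(1)])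
  ultimately show False using e(1) by (simp add: mult_le_0_iff)
qed

lemma continuous_weak_grad_bounded_lipschitz:
  fixes f :: "'a::euclidean_space \<Rightarrow> real"
  assumes "continuous_on \<Omega> f" "open \<Omega>" "is_weak_grad \<Omega> f g"
    and "AE z in lebesgue. z \<in> \<Omega> \<longrightarrow> norm (g z) \<le> L"
    and "convex U" "open U" "U \<subseteq> \<Omega>" "x \<in> U" "y \<in> U"
  shows "\<bar>f y - f x\<bar> \<le> L * norm (y - x)"
  using continuous_weak_grad_bounded_increment_le[OF assms]
    continuous_weak_grad_bounded_increment_le[OF assms(1-7) assms(9,8)]
  by (simp add: norm_minus_commute abs_le_iff)

section \<open>Integral bounds for increments\<close>

lemma compact_thickening:
  fixes K :: "'a::euclidean_space set"
  assumes "compact K" "open \<Omega>" "K \<subseteq> \<Omega>"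
  obtains r K' where "0 < r" "compact K'" "K' \<subseteq> \<Omega>" "K \<subseteq> interior K'" "\<And>z a. z \<in> K \<Longrightarrow> norm a \<le> r \<Longrightarrow> z + a \<in> K'"
proof -
  obtain r where r: "r > 0" "(\<Union>x\<in>K. cball x r) \<subseteq> \<Omega>"
    using compact_subset_open_imp_cball_epsilon_subset[OF assms] by blast
  define K' where "K' = {x + y |x y. x \<in> K \<and> y \<in> cball 0 r}"
  have in_K': "z + a \<in> K'" if "z \<in> K" "norm a \<le> r" for z a
    using that unfolding K'_def by auto
  have "K \<subseteq> interior K'"
  proof
    fix z assume z: "z \<in> K"
    have "w \<in> K'" if "w \<in> ball z r" for w
      using in_K'[OF z, of "w - z"] that by (simp add: dist_norm norm_minus_commute)
    then have "ball z r \<subseteq> K'" by blast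
    then show "z \<in> interior K'"
      using interior_maximal[of "ball z r" K'] r(1) by auto
  qed
  moreover have "compact K'" unfolding K'_def by (intro compact_sums assms compact_cball)
  moreover have "K' \<subseteq> \<Omega>" using r(2) unfolding K'_def by (force simp: dist_norm)
  ultimately show ?thesis using that r(1) in_K' by blast
qed

lemma loc_integrable_abs: "loc_integrable \<Omega> f \<Longrightarrow> loc_integrable \<Omega> (\<lambda>x. \<bar>f x\<bar>)"
  unfolding loc_integrable_def by (auto intro: set_integrable_abs)

text \<open>The shift acts on the continuous factor, so uniform continuity of \<open>c\<close> on a
  compact neighbourhood of its support suffices, however rough \<open>G\<close> is.\<close>

lemma integral_mult_shift_continuous:
  fixes G c :: "'a::euclidean_space \<Rightarrow> real"
  assumes "open \<Omega>" and G: "loc_integrable \<Omega> G" and c: "cc_fun \<Omega> c" and "0 < e"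
  obtains \<delta> where "0 < \<delta>"
    "\<And>a. norm a < \<delta> \<Longrightarrow> \<bar>(\<integral>z. G z * c (z - a) \<partial>lebesgue) - (\<integral>z. G z * c z \<partial>lebesgue)\<bar> \<le> e"
proof -
  from c obtain K where K: "continuous_on UNIV c" "compact K" "K \<subseteq> \<Omega>" "\<And>x. x \<notin> K \<Longrightarrow> c x = 0"
    by (rule cc_funE) blast
  obtain r K' where r: "0 < r" and K': "compact K'" "K' \<subseteq> \<Omega>" "K \<subseteq> interior K'"
    and thick: "\<And>z a. z \<in> K \<Longrightarrow> norm a \<le> r \<Longrightarrow> z + a \<in> K'"
    by (rule compact_thickening[OF K(2) assms(1) K(3)]) blast
  define A where "A = (\<integral>z. \<bar>indicator K' z *\<^sub>R G z\<bar> \<partial>lebesgue)"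
  have int_A: "integrable lebesgue (\<lambda>z. \<bar>indicator K' z *\<^sub>R G z\<bar>)"
    using G K' unfolding loc_integrable_def set_integrable_def by (intro integrable_abs) auto
  have "A \<ge> 0" unfolding A_def by (intro integral_nonneg_AE) auto
  \<comment> \<open>The summand 1 guards against \<open>A = 0\<close>.\<close>
  define d where "d = e / (A + 1)"
  have d: "d > 0" "d * A \<le> e" using \<open>A \<ge> 0\<close> \<open>0 < e\<close> by (auto simp: d_def field_simps)
  have "uniformly_continuous_on K' c"
    by (intro compact_uniformly_continuous continuous_on_subset[OF K(1)] K') simp
  then obtain \<delta> where \<delta>: "\<delta> > 0" "\<And>x y. x \<in> K' \<Longrightarrow> y \<in> K' \<Longrightarrow> dist y x < \<delta> \<Longrightarrow> dist (c y) (c x) < d"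
    unfolding uniformly_continuous_on_def using d(1) by metis
  show ?thesis
  proof
    show "0 < min \<delta> r" using r \<delta> by simp
    fix a :: 'a assume a: "norm a < min \<delta> r"
    have K_K': "K \<subseteq> K'" using K'(3) interior_subset by blast
    have z_in: "z \<in> K'" if "z - a \<in> K" for z using thick[OF that, of a] a by simp
    have cc: "cc_fun \<Omega> (\<lambda>z. c (z - a))"
      by (rule cc_fun_shift[of K]) (use K K' thick a in \<open>auto intro!: cc_funI[of _ K]\<close>)
    have diff: "\<bar>c (z - a) - c z\<bar> \<le> d * indicator K' z" for z
    proof (cases "z \<in> K'")
      case True
      show ?thesis
      proof (cases "z - a \<in> K'")
        case z: True
        have "dist (z - a) z < \<delta>" using a by (simp add: dist_norm)
        then show ?thesis using \<delta>(2)[OF True z] True by (simp add: dist_norm)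
      next
        case False
        then have "z - a \<notin> K" using K_K' by blast
        moreover have "z \<notin> K" using thick[of z "- a"] a False by auto
        ultimately show ?thesis using K(4) d(1) by simp
      qed
    next
      case False
      then have "z \<notin> K" "z - a \<notin> K" using K_K' z_in by auto
      then show ?thesis using K(4) d(1) by simp
    qed
    have i: "integrable lebesgue (\<lambda>z. G z * c (z - a))" "integrable lebesgue (\<lambda>z. G z * c z)"
      by (rule loc_integrable_mult_cc[OF G cc], rule loc_integrable_mult_cc[OF G c])
    have "\<bar>(\<integral>z. G z * c (z - a) \<partial>lebesgue) - (\<integral>z. G z * c z \<partial>lebesgue)\<bar>
        = \<bar>\<integral>z. G z * c (z - a) - G z * c z \<partial>lebesgue\<bar>" using i by simp
    also have "\<dots> \<le> (\<integral>z. d * \<bar>indicator K' z *\<^sub>R G z\<bar> \<partial>lebesgue)"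
    proof (rule integral_abs_bound_integral)
      show "integrable lebesgue (\<lambda>z. G z * c (z - a) - G z * c z)" using i by simp
      show "integrable lebesgue (\<lambda>z. d * \<bar>indicator K' z *\<^sub>R G z\<bar>)" using int_A by (rule integrable_mult_right)
      fix z
      have "\<bar>G z * c (z - a) - G z * c z\<bar> = \<bar>G z\<bar> * \<bar>c (z - a) - c z\<bar>"
        by (simp add: right_diff_distrib[symmetric] abs_mult)
      also have "\<dots> \<le> \<bar>G z\<bar> * (d * indicator K' z)" by (intro mult_left_mono diff) simp
      also have "\<dots> = d * \<bar>indicator K' z *\<^sub>R G z\<bar>" by (simp add: abs_mult indicator_def)
      finally show "\<bar>G z * c (z - a) - G z * c z\<bar> \<le> d * \<bar>indicator K' z *\<^sub>R G z\<bar>" .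
    qed
    also have "\<dots> \<le> e" using d(2) by (simp add: A_def)
    finally show "\<bar>(\<integral>z. G z * c (z - a) \<partial>lebesgue) - (\<integral>z. G z * c z \<partial>lebesgue)\<bar> \<le> e" .
  qed
qed

text \<open>The clipped quotient is a continuous substitute for the sign of \<open>d\<close>: its
  product with \<open>d\<close> is exactly \<open>\<bar>d\<bar>\<close> once
  \<open>\<bar>d\<bar> \<ge> e\<close>, and below that threshold \<open>\<bar>d\<bar>\<close> is
  itself less than \<open>e\<close>.\<close>

lemma abs_le_mult_clip: "0 < (e::real) \<Longrightarrow> \<bar>d\<bar> \<le> d * max (-1) (min 1 (d / e)) + e"
proof (cases "\<bar>d\<bar> < e")
  case True
  assume "0 < e"
  then have m: "max (-1) (min 1 (d / e)) = d / e" using True by (auto simp: field_simps abs_less_iff)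
  have "0 \<le> d * (d / e)" using \<open>0 < e\<close> by (simp add: zero_le_mult_iff zero_le_divide_iff)
  then show ?thesis unfolding m using True by linarith
next
  case False
  assume "0 < e"
  from False consider "e \<le> d" | "d \<le> - e" by linarith
  then show ?thesis
  proof cases
    case 1
    then have "1 \<le> d / e" using \<open>0 < e\<close> by simp
    then have m: "max (-1) (min 1 (d / e)) = 1" by simp
    show ?thesis unfolding m using 1 \<open>0 < e\<close> by simp
  next
    case 2
    then have "d / e \<le> -1" using \<open>0 < e\<close> by (simp add: divide_le_eq)
    then have m: "max (-1) (min 1 (d / e)) = -1" by simp
    show ?thesis unfolding m using 2 \<open>0 < e\<close> by simp
  qed
qed

text \<open>The sign of the increment is replaced by a test function, so that the weak gradient can be
  brought in by \<open>integral_shift_mean_value\<close>.\<close>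
lemma integral_abs_increment_le:
  fixes u :: "'a::euclidean_space \<Rightarrow> real"
  assumes \<Omega>: "open \<Omega>" and u: "continuous_on \<Omega> u" and g: "is_weak_grad \<Omega> u g"
    and K: "compact K" "K \<subseteq> interior K1" and K1: "compact K1"
    and K2: "compact K2" "K2 \<subseteq> \<Omega>" "\<And>z t. z \<in> K1 \<Longrightarrow> 0 \<le> t \<Longrightarrow> t \<le> 1 \<Longrightarrow> z + t *\<^sub>R h \<in> K2"
    and c: "cc_fun K c" "\<And>z. 0 \<le> c z"
    and B: "\<And>t. 0 \<le> t \<Longrightarrow> t \<le> 1 \<Longrightarrow> (\<integral>z. \<bar>g z \<bullet> h\<bar> * c (z - t *\<^sub>R h) \<partial>lebesgue) \<le> B"
  shows "(\<integral>z. \<bar>u (z + h) - u z\<bar> * c z \<partial>lebesgue) \<le> B"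
proof -
  have seg: "z + t *\<^sub>R h \<in> \<Omega>" if "z \<in> K1" "0 \<le> t" "t \<le> 1" for z t using K2 that by blast
  have K1\<Omega>: "K1 \<subseteq> \<Omega>" "\<And>z. z \<in> K1 \<Longrightarrow> z + h \<in> \<Omega>" using seg[of _ 0] seg[of _ 1] by auto
  have KK1: "K \<subseteq> K1" using K(2) interior_subset by blast
  define d where "d z = u (z + h) - u z" for z
  have d_cont: "continuous_on (interior K1) d"
    unfolding d_def
    by (intro continuous_on_diff continuous_on_compose2[OF u] continuous_on_subset[OF u] continuous_intros)
       (use K1\<Omega> interior_subset in blast)+
  have c0: "c z = 0" if "z \<notin> K" for z using c(1) that by (auto simp: cc_fun_def)
  obtain \<sigma> where \<sigma>: "test_fun (interior K1) \<sigma>" "\<And>x. 0 \<le> \<sigma> x" "\<And>x. x \<in> K \<Longrightarrow> 0 < \<sigma> x"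
    by (rule test_fun_pos_on_compact[OF open_interior K]) blast
  have \<sigma>K1: "cc_fun K1 \<sigma>" by (rule cc_fun_mono[OF test_fun_imp_cc_fun[OF \<sigma>(1)] interior_subset])
  have cK1: "cc_fun K1 c" by (rule cc_fun_mono[OF c(1) KK1])
  obtain S0 where S0: "0 < S0" "\<And>x. \<bar>\<sigma> x\<bar> \<le> S0" by (rule cc_fun_bounded[OF \<sigma>K1]) blast
  let ?G = "\<lambda>z. \<bar>g z \<bullet> h\<bar>"
  have G: "loc_integrable \<Omega> ?G" by (rule loc_integrable_abs[OF is_weak_grad_loc_integrable[OF g]])
  \<comment> \<open>The intermediate point \<open>\<xi>\<close> will depend on the test function and
    hence on \<open>e\<close>, so the error term is bounded uniformly over all shifts;
    \<open>K2\<close> contains all the shifted supports.\<close>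
  define S where "S = S0 * (\<integral>z. indicator K2 z *\<^sub>R ?G z \<partial>lebesgue)"
  have int_K2: "integrable lebesgue (\<lambda>z. indicator K2 z *\<^sub>R ?G z)"
    using G K2 unfolding loc_integrable_def set_integrable_def by blast
  have shift_cc: "cc_fun \<Omega> (\<lambda>z. \<psi> (z - t *\<^sub>R h))" if "cc_fun K1 \<psi>" "0 \<le> t" "t \<le> 1" for \<psi> t
    by (rule cc_fun_shift[OF \<open>cc_fun K1 \<psi>\<close>]) (use seg that in auto)
  have S: "(\<integral>z. ?G z * \<sigma> (z - t *\<^sub>R h) \<partial>lebesgue) \<le> S" if t: "0 \<le> t" "t \<le> 1" for t
  proof -
    have "(\<integral>z. ?G z * \<sigma> (z - t *\<^sub>R h) \<partial>lebesgue) \<le> (\<integral>z. S0 * (indicator K2 z *\<^sub>R ?G z) \<partial>lebesgue)"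
    proof (rule integral_mono)
      show "integrable lebesgue (\<lambda>z. ?G z * \<sigma> (z - t *\<^sub>R h))"
        by (rule loc_integrable_mult_cc[OF G shift_cc[OF \<sigma>K1 t]])
      show "integrable lebesgue (\<lambda>z. S0 * (indicator K2 z *\<^sub>R ?G z))" using int_K2 by (rule integrable_mult_right)
      show "?G z * \<sigma> (z - t *\<^sub>R h) \<le> S0 * (indicator K2 z *\<^sub>R ?G z)" for z
      proof (cases "z - t *\<^sub>R h \<in> K1")
        case True
        then have "z \<in> K2" using K2(3)[OF True t] by simp
        then show ?thesis
          using S0(2)[of "z - t *\<^sub>R h"] by (simp add: mult.commute[of S0] mult_left_mono)
      next
        case False
        then have "\<sigma> (z - t *\<^sub>R h) = 0" using \<sigma>K1 by (auto simp: cc_fun_def)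
        then show ?thesis using S0(1) by (simp add: indicator_def)
      qed
    qed
    then show ?thesis by (simp add: S_def)
  qed
  have int_d: "integrable lebesgue (\<lambda>z. d z * \<psi> z)" if "cc_fun K1 \<psi>" for \<psi>
    unfolding d_def by (rule cc_fun_difference(1)[OF \<Omega> u \<open>cc_fun K1 \<psi>\<close> K1\<Omega>])
  have int_abs_d: "integrable lebesgue (\<lambda>z. \<bar>d z\<bar> * \<psi> z)" if "cc_fun K1 \<psi>" "\<And>z. 0 \<le> \<psi> z" for \<psi>
    using integrable_abs[OF int_d[OF that(1)]] that(2) by (simp add: abs_mult)
  \<comment> \<open>The coefficients of \<open>e\<close> from three sources: the approximation error
    on the gradient side, the same error on the increment side, and the clipping of the
    sign.\<close>
  define Q where "Q = S + (\<integral>z. \<bar>d z\<bar> * \<sigma> z \<partial>lebesgue) + (\<integral>z. c z \<partial>lebesgue)"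
  have *: "(\<integral>z. \<bar>d z\<bar> * c z \<partial>lebesgue) \<le> B + e * Q" if e: "e > 0" for e
  proof -
    \<comment> \<open>The weight \<open>c\<close> times the continuous sign of the increment;
      \<open>d z * s z\<close> differs from \<open>\<bar>d z\<bar> * c z\<close> by at most
      \<open>e * c z\<close>.\<close>
    define s where "s z = max (-1) (min 1 (d z / e)) * c z" for z
    have "cc_fun (interior K1) s"
      unfolding s_def using e
      by (intro cc_fun_times_continuous_on cc_fun_mono[OF c(1) K(2)] continuous_intros d_cont) auto
    then have s: "continuous_on UNIV s" "\<And>z. z \<notin> K \<Longrightarrow> s z = 0"
      by (auto simp: cc_fun_def s_def c0)
    have s_le: "\<bar>s z\<bar> \<le> c z" for z
    proof -
      have "\<bar>max (-1) (min 1 (d z / e))\<bar> \<le> 1" by auto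
      then have "\<bar>max (-1) (min 1 (d z / e))\<bar> * c z \<le> 1 * c z" by (rule mult_right_mono[OF _ c(2)])
      then show ?thesis using c(2)[of z] by (simp add: s_def abs_mult)
    qed
    obtain \<eta> where \<eta>: "test_fun (interior K1) \<eta>" "\<And>x. \<bar>\<eta> x - s x\<bar> \<le> e * \<sigma> x"
      by (rule test_fun_approx[OF \<sigma> K(1) s e]) (auto intro: that)
    have \<eta>K1: "test_fun K1 \<eta>" by (rule test_fun_mono[OF \<eta>(1) interior_subset])
    note \<eta>cc = test_fun_imp_cc_fun[OF \<eta>K1]
    obtain \<xi> where \<xi>: "0 < \<xi>" "\<xi> < 1" and eq:
      "(\<integral>z. u z * \<eta> (z - h) \<partial>lebesgue) - (\<integral>z. u z * \<eta> z \<partial>lebesgue)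
        = (\<integral>z. (g z \<bullet> h) * \<eta> (z - \<xi> *\<^sub>R h) \<partial>lebesgue)"
      by (rule integral_shift_mean_value[OF g continuous_on_imp_loc_integrable[OF u] \<eta>K1 K1 seg]) auto
    then have \<xi>': "0 \<le> \<xi>" "\<xi> \<le> 1" by auto
    have "(\<integral>z. d z * \<eta> z \<partial>lebesgue) = (\<integral>z. (g z \<bullet> h) * \<eta> (z - \<xi> *\<^sub>R h) \<partial>lebesgue)"
      unfolding d_def eq[symmetric] by (rule cc_fun_difference(2)[OF \<Omega> u \<eta>cc K1\<Omega>])
    also have "\<dots> \<le> (\<integral>z. ?G z * c (z - \<xi> *\<^sub>R h) + e * (?G z * \<sigma> (z - \<xi> *\<^sub>R h)) \<partial>lebesgue)"
    proof (rule integral_mono)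
      show "integrable lebesgue (\<lambda>z. (g z \<bullet> h) * \<eta> (z - \<xi> *\<^sub>R h))"
        by (rule loc_integrable_mult_cc[OF is_weak_grad_loc_integrable[OF g] shift_cc[OF \<eta>cc \<xi>']])
      show "integrable lebesgue (\<lambda>z. ?G z * c (z - \<xi> *\<^sub>R h) + e * (?G z * \<sigma> (z - \<xi> *\<^sub>R h)))"
        by (intro Bochner_Integration.integrable_add integrable_mult_right
            loc_integrable_mult_cc[OF G shift_cc[OF cK1 \<xi>']] loc_integrable_mult_cc[OF G shift_cc[OF \<sigma>K1 \<xi>']])
      fix z
      let ?y = "z - \<xi> *\<^sub>R h"
      have "(g z \<bullet> h) * \<eta> ?y \<le> ?G z * \<bar>\<eta> ?y\<bar>" by (metis abs_ge_self abs_mult)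
      also have "\<dots> \<le> ?G z * (c ?y + e * \<sigma> ?y)"
        using \<eta>(2)[of ?y] s_le[of ?y] by (intro mult_left_mono) auto
      finally show "(g z \<bullet> h) * \<eta> ?y \<le> ?G z * c ?y + e * (?G z * \<sigma> ?y)" by (simp add: algebra_simps)
    qed
    also have "\<dots> = (\<integral>z. ?G z * c (z - \<xi> *\<^sub>R h) \<partial>lebesgue) + e * (\<integral>z. ?G z * \<sigma> (z - \<xi> *\<^sub>R h) \<partial>lebesgue)"
      using loc_integrable_mult_cc[OF G shift_cc[OF cK1 \<xi>']] loc_integrable_mult_cc[OF G shift_cc[OF \<sigma>K1 \<xi>']]
      by simp
    also have "\<dots> \<le> B + e * S"
      using B[OF \<xi>'] S[OF \<xi>'] e by (intro add_mono mult_left_mono) auto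
    finally have 1: "(\<integral>z. d z * \<eta> z \<partial>lebesgue) \<le> B + e * S" .
    have ints: "integrable lebesgue (\<lambda>z. d z * \<eta> z)" "integrable lebesgue (\<lambda>z. \<bar>d z\<bar> * \<sigma> z)" "integrable lebesgue c"
      by (rule int_d[OF \<eta>cc], rule int_abs_d[OF \<sigma>K1 \<sigma>(2)], rule cc_fun_integrable[OF c(1)])
    have "(\<integral>z. \<bar>d z\<bar> * c z \<partial>lebesgue) \<le> (\<integral>z. d z * \<eta> z + e * (\<bar>d z\<bar> * \<sigma> z + c z) \<partial>lebesgue)"
    proof (rule integral_mono)
      show "integrable lebesgue (\<lambda>z. \<bar>d z\<bar> * c z)" by (rule int_abs_d[OF cK1 c(2)])
      show "integrable lebesgue (\<lambda>z. d z * \<eta> z + e * (\<bar>d z\<bar> * \<sigma> z + c z))"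
        using ints by (intro Bochner_Integration.integrable_add integrable_mult_right)
      fix z
      have "\<bar>d z\<bar> * c z \<le> (d z * max (-1) (min 1 (d z / e)) + e) * c z"
        by (rule mult_right_mono[OF abs_le_mult_clip[OF e] c(2)])
      also have "\<dots> = d z * s z + e * c z" by (simp add: s_def algebra_simps)
      finally have "\<bar>d z\<bar> * c z \<le> d z * s z + e * c z" .
      moreover have "d z * s z - d z * \<eta> z \<le> \<bar>d z\<bar> * (e * \<sigma> z)"
      proof -
        have "d z * s z - d z * \<eta> z \<le> \<bar>d z\<bar> * \<bar>\<eta> z - s z\<bar>"
          by (metis abs_ge_self abs_minus_commute abs_mult right_diff_distrib)
        also have "\<dots> \<le> \<bar>d z\<bar> * (e * \<sigma> z)" by (intro mult_left_mono \<eta>(2)) simp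
        finally show ?thesis .
      qed
      ultimately show "\<bar>d z\<bar> * c z \<le> d z * \<eta> z + e * (\<bar>d z\<bar> * \<sigma> z + c z)"
        by (simp add: algebra_simps)
    qed
    also have "\<dots> = (\<integral>z. d z * \<eta> z \<partial>lebesgue) + e * ((\<integral>z. \<bar>d z\<bar> * \<sigma> z \<partial>lebesgue) + (\<integral>z. c z \<partial>lebesgue))"
      using ints by simp
    also have "\<dots> \<le> B + e * Q" using 1 by (simp add: Q_def algebra_simps)
    finally show ?thesis .
  qed
  have "(\<integral>z. \<bar>d z\<bar> * c z \<partial>lebesgue) \<le> B"
  proof (rule field_le_epsilon)
    fix e :: real assume "e > 0"
    have "e * Q \<le> e * (\<bar>Q\<bar> + 1)" using \<open>e > 0\<close> by (intro mult_left_mono) auto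
    then have "e / (\<bar>Q\<bar> + 1) * Q \<le> e" by (simp add: divide_le_eq)
    then show "(\<integral>z. \<bar>d z\<bar> * c z \<partial>lebesgue) \<le> B + e"
      using *[of "e / (\<bar>Q\<bar> + 1)"] \<open>e > 0\<close> by simp
  qed
  then show ?thesis by (simp add: d_def)
qed

text \<open>The left-hand integral is, up to sign, the derivative at \<open>t = 0\<close> of the
  integral of \<open>u\<close> against \<open>\<psi> (z - t *\<^sub>R b)\<close>. In its difference
  quotient the shift is moved back onto \<open>u\<close>, the increments of \<open>u\<close> are
  replaced by those of the \<open>v i\<close>, and \<open>integral_abs_increment_le\<close> bounds
  these by the gradients.\<close>

lemma weak_derivative_bound:
  fixes u :: "'a::euclidean_space \<Rightarrow> real"
  assumes \<Omega>: "open \<Omega>" and u: "continuous_on \<Omega> u" and I: "finite I"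
    and v: "\<And>i. i \<in> I \<Longrightarrow> continuous_on \<Omega> (v i)" and g: "\<And>i. i \<in> I \<Longrightarrow> is_weak_grad \<Omega> (v i) (g i)"
    and L: "0 \<le> L"
    and incr: "\<And>K. compact K \<Longrightarrow> K \<subseteq> \<Omega> \<Longrightarrow> \<exists>\<delta>>0. \<forall>z\<in>K. \<forall>h. norm h < \<delta> \<longrightarrow>
      \<bar>u (z + h) - u z\<bar> \<le> L * (\<Sum>i\<in>I. \<bar>v i (z + h) - v i z\<bar>)"
    and \<psi>: "test_fun \<Omega> \<psi>"
  shows "\<bar>\<integral>z. u z * frechet_derivative \<psi> (at z) b \<partial>lebesgue\<bar>
    \<le> (\<integral>z. (L * (\<Sum>i\<in>I. \<bar>g i z \<bullet> b\<bar>)) * \<bar>\<psi> z\<bar> \<partial>lebesgue)"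
proof -
  from \<psi> obtain K where K: "smooth_fun \<psi>" "compact K" "K \<subseteq> \<Omega>" "\<And>x. x \<notin> K \<Longrightarrow> \<psi> x = 0"
    by (rule test_funE) blast
  have \<psi>K: "test_fun K \<psi>" by (rule test_funI[OF K(1,2) order_refl K(4)])
  obtain r1 K1 where r1: "0 < r1" and K1: "compact K1" "K1 \<subseteq> \<Omega>" "K \<subseteq> interior K1"
    and thick1: "\<And>z a. z \<in> K \<Longrightarrow> norm a \<le> r1 \<Longrightarrow> z + a \<in> K1"
    by (rule compact_thickening[OF K(2) \<Omega> K(3)]) blast
  obtain r2 K2 where r2: "0 < r2" and K2: "compact K2" "K2 \<subseteq> \<Omega>" "K1 \<subseteq> interior K2"
    and thick2: "\<And>z a. z \<in> K1 \<Longrightarrow> norm a \<le> r2 \<Longrightarrow> z + a \<in> K2"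
    by (rule compact_thickening[OF K1(1) \<Omega> K1(2)]) blast
  obtain \<delta> where \<delta>: "\<delta> > 0" "\<And>z h. z \<in> K \<Longrightarrow> norm h < \<delta> \<Longrightarrow>
      \<bar>u (z + h) - u z\<bar> \<le> L * (\<Sum>i\<in>I. \<bar>v i (z + h) - v i z\<bar>)"
    using incr[OF K(2,3)] by metis
  define c where "c z = \<bar>\<psi> z\<bar>" for z
  have c: "cc_fun K c" "\<And>z. 0 \<le> c z"
    unfolding c_def by (rule cc_fun_abs[OF test_fun_imp_cc_fun[OF \<psi>K]]) simp
  have c\<Omega>: "cc_fun \<Omega> c" by (rule cc_fun_mono[OF c(1) K(3)])
  define A where "A i = (\<integral>z. \<bar>g i z \<bullet> b\<bar> * c z \<partial>lebesgue)" for i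
  have G: "loc_integrable \<Omega> (\<lambda>z. \<bar>g i z \<bullet> b\<bar>)" if "i \<in> I" for i
    by (rule loc_integrable_abs[OF is_weak_grad_loc_integrable[OF g[OF that]]])
  have small: "\<forall>\<^sub>F t in at 0. norm (t *\<^sub>R b) < \<rho>" if "\<rho> > 0" for \<rho> :: real
  proof -
    have "((\<lambda>t. norm (t *\<^sub>R b)) \<longlongrightarrow> norm (0 *\<^sub>R b)) (at 0)" by (intro tendsto_intros)
    then show ?thesis using that by (intro order_tendstoD(2)) auto
  qed
  \<comment> \<open>The bound from \<open>integral_abs_increment_le\<close> must hold for every
    intermediate shift. For small \<open>t\<close> all these shifts are small, and continuity in the
    shift puts each integral within \<open>e\<close> of \<open>A i\<close>.\<close>
  have ev: "\<forall>\<^sub>F t in at 0. (\<integral>z. \<bar>v i (z + t *\<^sub>R b) - v i z\<bar> * c z \<partial>lebesgue) \<le> \<bar>t\<bar> * (A i + e)"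
    if e: "e > 0" and i: "i \<in> I" for e i
  proof -
    obtain \<rho> where \<rho>: "\<rho> > 0" "\<And>a. norm a < \<rho> \<Longrightarrow>
       \<bar>(\<integral>z. \<bar>g i z \<bullet> b\<bar> * c (z - a) \<partial>lebesgue) - (\<integral>z. \<bar>g i z \<bullet> b\<bar> * c z \<partial>lebesgue)\<bar> \<le> e"
      by (rule integral_mult_shift_continuous[OF \<Omega> G[OF i] c\<Omega> e]) blast
    have "\<forall>\<^sub>F t in at 0. norm (t *\<^sub>R b) < min \<rho> r2" using \<rho> r2 by (intro small) auto
    then show ?thesis
    proof eventually_elim
      case (elim t)
      have sc: "norm (s *\<^sub>R (t *\<^sub>R b)) \<le> norm (t *\<^sub>R b)" if "0 \<le> s" "s \<le> 1" for s :: real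
        by (subst norm_scaleR) (simp only: abs_of_nonneg[OF that(1)] mult_left_le_one_le[OF norm_ge_zero that])
      show ?case
      proof (rule integral_abs_increment_le[OF \<Omega> v[OF i] g[OF i] K(2) K1(3,1) K2(1,2) _ c])
        show "z + s *\<^sub>R (t *\<^sub>R b) \<in> K2" if "z \<in> K1" "0 \<le> s" "s \<le> 1" for z s
          using thick2[OF that(1)] sc[OF that(2,3)] elim by auto
        fix s :: real assume s: "0 \<le> s" "s \<le> 1"
        have "(\<integral>z. \<bar>g i z \<bullet> b\<bar> * c (z - s *\<^sub>R (t *\<^sub>R b)) \<partial>lebesgue) \<le> A i + e"
          using \<rho>(2)[of "s *\<^sub>R (t *\<^sub>R b)"] sc[OF s] elim by (auto simp: A_def)
        then have "\<bar>t\<bar> * (\<integral>z. \<bar>g i z \<bullet> b\<bar> * c (z - s *\<^sub>R (t *\<^sub>R b)) \<partial>lebesgue) \<le> \<bar>t\<bar> * (A i + e)"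
          by (rule mult_left_mono) simp
        then show "(\<integral>z. \<bar>g i z \<bullet> t *\<^sub>R b\<bar> * c (z - s *\<^sub>R (t *\<^sub>R b)) \<partial>lebesgue) \<le> \<bar>t\<bar> * (A i + e)"
          by (simp add: abs_mult mult.assoc)
      qed
    qed
  qed
  \<comment> \<open>A cut-off of \<open>u\<close> that is integrable on the whole space and agrees
    with \<open>u\<close> on the supports of all small translates of \<open>\<psi>\<close>.\<close>
  define w where "w z = indicator K1 z *\<^sub>R u z" for z
  have w: "integrable lebesgue w"
    using continuous_on_imp_loc_integrable[OF u] K1 unfolding w_def loc_integrable_def set_integrable_def by blast
  define F where "F t = (\<integral>z. w z * \<psi> (z - t *\<^sub>R b) \<partial>lebesgue)" for t
  have DK: "frechet_derivative \<psi> (at z) b = 0" if "z \<notin> K" for z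
    using test_fun_directional_derivative[OF \<psi>K, of b] that by (auto elim!: test_funE)
  have KK1: "K \<subseteq> K1" using K1(3) interior_subset by blast
  have F': "(F has_real_derivative - (\<integral>z. u z * frechet_derivative \<psi> (at z) b \<partial>lebesgue)) (at 0)"
  proof -
    have "(F has_real_derivative - (\<integral>z. w z * frechet_derivative \<psi> (at (z - 0 *\<^sub>R b)) b \<partial>lebesgue)) (at 0)"
      unfolding F_def by (rule integral_shift_has_derivative[OF w test_fun_mono[OF \<psi>]]) simp
    moreover have "(\<integral>z. w z * frechet_derivative \<psi> (at (z - 0 *\<^sub>R b)) b \<partial>lebesgue)
        = (\<integral>z. u z * frechet_derivative \<psi> (at z) b \<partial>lebesgue)"
      unfolding w_def using KK1 DK by (intro Bochner_Integration.integral_cong) (auto simp: indicator_def)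
    ultimately show ?thesis by simp
  qed
  have F_diff: "\<bar>(F (0 + t) - F 0) / t\<bar> \<le> L * (\<Sum>i\<in>I. A i + e)"
    if t: "t \<noteq> 0" "norm (t *\<^sub>R b) < min r1 \<delta>"
      and *: "\<And>i. i \<in> I \<Longrightarrow> (\<integral>z. \<bar>v i (z + t *\<^sub>R b) - v i z\<bar> * c z \<partial>lebesgue) \<le> \<bar>t\<bar> * (A i + e)" for t e
  proof -
    have Kt: "z + t *\<^sub>R b \<in> K1" if "z \<in> K" for z using thick1[OF that] t(2) by auto
    then have Kt': "z + t *\<^sub>R b \<in> \<Omega>" if "z \<in> K" for z using K1(2) that by blast
    note dif = cc_fun_difference[OF \<Omega> _ _ K(3) Kt']
    have "F t = (\<integral>z. u z * \<psi> (z - t *\<^sub>R b) \<partial>lebesgue)"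
      unfolding F_def w_def
    proof (intro Bochner_Integration.integral_cong refl)
      fix z show "indicator K1 z *\<^sub>R u z * \<psi> (z - t *\<^sub>R b) = u z * \<psi> (z - t *\<^sub>R b)"
        using Kt[of "z - t *\<^sub>R b"] K(4)[of "z - t *\<^sub>R b"] by (cases "z - t *\<^sub>R b \<in> K") auto
    qed
    moreover have "F 0 = (\<integral>z. u z * \<psi> z \<partial>lebesgue)"
      unfolding F_def w_def using KK1 K(4) by (intro Bochner_Integration.integral_cong) (auto simp: indicator_def)
    ultimately have "F t - F 0 = (\<integral>z. (u (z + t *\<^sub>R b) - u z) * \<psi> z \<partial>lebesgue)"
      using dif(2)[OF u test_fun_imp_cc_fun[OF \<psi>K]] by simp
    moreover have "\<bar>\<dots>\<bar> \<le> (\<integral>z. L * (\<Sum>i\<in>I. \<bar>v i (z + t *\<^sub>R b) - v i z\<bar> * c z) \<partial>lebesgue)"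
    proof (rule integral_abs_bound_integral)
      show "integrable lebesgue (\<lambda>z. (u (z + t *\<^sub>R b) - u z) * \<psi> z)"
        by (rule dif(1)[OF u test_fun_imp_cc_fun[OF \<psi>K]])
      have "integrable lebesgue (\<lambda>z. \<bar>v i (z + t *\<^sub>R b) - v i z\<bar> * c z)" if "i \<in> I" for i
        using integrable_abs[OF dif(1)[OF v[OF that] c(1)]] c(2) by (simp add: abs_mult)
      then show "integrable lebesgue (\<lambda>z. L * (\<Sum>i\<in>I. \<bar>v i (z + t *\<^sub>R b) - v i z\<bar> * c z))" by simp
      show "\<bar>(u (z + t *\<^sub>R b) - u z) * \<psi> z\<bar> \<le> L * (\<Sum>i\<in>I. \<bar>v i (z + t *\<^sub>R b) - v i z\<bar> * c z)" for z
      proof (cases "z \<in> K")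
        case True
        have "\<bar>u (z + t *\<^sub>R b) - u z\<bar> * c z \<le> L * (\<Sum>i\<in>I. \<bar>v i (z + t *\<^sub>R b) - v i z\<bar>) * c z"
          using \<delta>(2)[OF True, of "t *\<^sub>R b"] t(2) c(2) by (intro mult_right_mono) auto
        then show ?thesis by (simp add: abs_mult c_def sum_distrib_right mult.assoc)
      qed (simp add: K(4) c_def)
    qed
    moreover have "\<dots> = L * (\<Sum>i\<in>I. \<integral>z. \<bar>v i (z + t *\<^sub>R b) - v i z\<bar> * c z \<partial>lebesgue)"
    proof -
      have "integrable lebesgue (\<lambda>z. \<bar>v i (z + t *\<^sub>R b) - v i z\<bar> * c z)" if "i \<in> I" for i
        using integrable_abs[OF dif(1)[OF v[OF that] c(1)]] c(2) by (simp add: abs_mult)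
      then show ?thesis by (simp add: Bochner_Integration.integral_sum)
    qed
    moreover have "\<dots> \<le> L * (\<Sum>i\<in>I. \<bar>t\<bar> * (A i + e))"
      using * L by (intro mult_left_mono sum_mono) auto
    moreover have "\<dots> = (L * (\<Sum>i\<in>I. A i + e)) * \<bar>t\<bar>"
      by (simp add: sum_distrib_left[symmetric] mult_ac)
    ultimately have "\<bar>F t - F 0\<bar> \<le> (L * (\<Sum>i\<in>I. A i + e)) * \<bar>t\<bar>" by linarith
    then show ?thesis using t(1) by (simp add: divide_le_eq)
  qed
  have bound: "\<bar>\<integral>z. u z * frechet_derivative \<psi> (at z) b \<partial>lebesgue\<bar> \<le> L * (\<Sum>i\<in>I. A i + e)" if "e > 0" for e
  proof -
    have "((\<lambda>t. \<bar>(F (0 + t) - F 0) / t\<bar>) \<longlongrightarrow> \<bar>- (\<integral>z. u z * frechet_derivative \<psi> (at z) b \<partial>lebesgue)\<bar>) (at 0)"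
      using F' unfolding DERIV_def by (rule tendsto_rabs)
    moreover have "\<forall>\<^sub>F t in at 0. \<bar>(F (0 + t) - F 0) / t\<bar> \<le> L * (\<Sum>i\<in>I. A i + e)"
    proof -
      have "\<forall>\<^sub>F t in at 0. \<forall>i\<in>I. (\<integral>z. \<bar>v i (z + t *\<^sub>R b) - v i z\<bar> * c z \<partial>lebesgue) \<le> \<bar>t\<bar> * (A i + e)"
        using I ev[OF that] by (simp add: eventually_ball_finite)
      moreover have "\<forall>\<^sub>F t in at 0. norm (t *\<^sub>R b) < min r1 \<delta>" using r1 \<delta> by (intro small) auto
      moreover have "\<forall>\<^sub>F t::real in at 0. t \<noteq> 0" by (simp add: eventually_at_filter)
      ultimately show ?thesis by eventually_elim (rule F_diff, auto)
    qed
    ultimately have "\<bar>- (\<integral>z. u z * frechet_derivative \<psi> (at z) b \<partial>lebesgue)\<bar> \<le> L * (\<Sum>i\<in>I. A i + e)"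
      by (rule tendsto_upperbound) simp
    then show ?thesis by simp
  qed
  have "\<bar>\<integral>z. u z * frechet_derivative \<psi> (at z) b \<partial>lebesgue\<bar> \<le> L * (\<Sum>i\<in>I. A i)"
  proof (rule field_le_epsilon)
    fix e :: real assume "e > 0"
    \<comment> \<open>The error \<open>e\<close> occurs once in each summand, so the total error is
      \<open>N\<close> times as large.\<close>
    define N where "N = L * real (card I)"
    have "N \<ge> 0" using L by (simp add: N_def)
    have "e / (N + 1) * N \<le> e" using \<open>e > 0\<close> \<open>N \<ge> 0\<close> by (simp add: field_simps)
    moreover have "L * (\<Sum>i\<in>I. A i + e / (N + 1)) = L * (\<Sum>i\<in>I. A i) + e / (N + 1) * N"
      by (simp add: sum.distrib N_def algebra_simps)
    ultimately show "\<bar>\<integral>z. u z * frechet_derivative \<psi> (at z) b \<partial>lebesgue\<bar> \<le> L * (\<Sum>i\<in>I. A i) + e"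
      using bound[of "e / (N + 1)"] \<open>e > 0\<close> \<open>N \<ge> 0\<close> by simp
  qed
  also have "\<dots> = (\<integral>z. L * (\<Sum>i\<in>I. \<bar>g i z \<bullet> b\<bar> * c z) \<partial>lebesgue)"
    using loc_integrable_mult_cc[OF G c\<Omega>] unfolding A_def by (simp add: Bochner_Integration.integral_sum)
  also have "\<dots> = (\<integral>z. (L * (\<Sum>i\<in>I. \<bar>g i z \<bullet> b\<bar>)) * \<bar>\<psi> z\<bar> \<partial>lebesgue)"
    by (simp add: c_def sum_distrib_right mult.assoc)
  finally show ?thesis .
qed

section \<open>Functionals dominated by a locally integrable density\<close>

text \<open>For nonnegative terms sum and integral commute, so the sum has a finite integral and is
  finite almost everywhere.\<close>

lemma AE_summable_if_summable_integrals:
  fixes f :: "nat \<Rightarrow> 'b \<Rightarrow> real"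
  assumes f: "\<And>n. integrable M (f n)" "\<And>n x. 0 \<le> f n x" and sum: "summable (\<lambda>n. \<integral>x. f n x \<partial>M)"
  shows "AE x in M. summable (\<lambda>n. f n x)" and "integrable M (\<lambda>x. \<Sum>n. f n x)"
proof -
  have "(\<integral>\<^sup>+x. (\<Sum>n. ennreal (f n x)) \<partial>M) = (\<Sum>n. \<integral>\<^sup>+x. ennreal (f n x) \<partial>M)"
    using f(1) by (intro nn_integral_suminf measurable_compose[OF borel_measurable_integrable measurable_ennreal])
  also have "\<dots> = (\<Sum>n. ennreal (\<integral>x. f n x \<partial>M))"
    using f by (intro suminf_cong nn_integral_eq_integral) auto
  also have "\<dots> = ennreal (\<Sum>n. \<integral>x. f n x \<partial>M)"
    using sum f by (intro suminf_ennreal2 integral_nonneg_AE) auto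
  finally have "(\<integral>\<^sup>+x. (\<Sum>n. ennreal (f n x)) \<partial>M) \<noteq> \<infinity>" by simp
  moreover have "(\<lambda>x. \<Sum>n. ennreal (f n x)) \<in> borel_measurable M"
    using f(1) by (intro borel_measurable_suminf_order measurable_compose[OF borel_measurable_integrable measurable_ennreal])
  ultimately have "AE x in M. (\<Sum>n. ennreal (f n x)) \<noteq> \<infinity>" by (intro nn_integral_noteq_infinite)
  then show AE: "AE x in M. summable (\<lambda>n. f n x)"
    by eventually_elim (use f(2) in \<open>auto intro: summable_suminf_not_top\<close>)
  show "integrable M (\<lambda>x. \<Sum>n. f n x)"
    by (rule integrable_suminf[OF f(1)]) (use AE sum f(2) in auto)
qed

text \<open>The functional is represented by the minimiser of \<open>\<integral> N \<psi>\<^sup>2 - 2 T \<psi>\<close>: as in the proof of the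
  Riesz representation theorem, the parallelogram law makes a minimising sequence Cauchy, and choosing
  it fast enough makes it converge almost everywhere under an integrable bound.\<close>
lemma bounded_functional_representation:
  fixes N :: "'a::euclidean_space \<Rightarrow> real" and T :: "('a \<Rightarrow> real) \<Rightarrow> real"
  assumes N: "loc_integrable \<Omega> N" "\<And>x. 0 \<le> N x"
    and T_add: "\<And>a b. test_fun \<Omega> a \<Longrightarrow> test_fun \<Omega> b \<Longrightarrow> T (\<lambda>x. a x + b x) = T a + T b"
    and T_cmult: "\<And>s a. test_fun \<Omega> a \<Longrightarrow> T (\<lambda>x. s * a x) = s * T a"
    and T_bound: "\<And>a. test_fun \<Omega> a \<Longrightarrow> 2 * T a \<le> (\<integral>x. N x * (a x * a x) \<partial>lebesgue) + A"
  shows "\<exists>G. loc_integrable \<Omega> G \<and> (\<forall>\<psi>. test_fun \<Omega> \<psi> \<longrightarrow> T \<psi> = (\<integral>x. G x * \<psi> x \<partial>lebesgue))"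
proof -
  define B where "B a b = (\<integral>x. N x * (a x * b x) \<partial>lebesgue)" for a b :: "'a \<Rightarrow> real"
  define J where "J a = B a a - 2 * T a" for a
  have int: "integrable lebesgue (\<lambda>x. N x * (a x * b x))" if "test_fun \<Omega> a" "test_fun \<Omega> b" for a b
  proof (rule loc_integrable_mult_cc[OF N(1) cc_fun_mult[OF test_fun_imp_cc_fun[OF that(2)]]])
    show "continuous_on UNIV a" using that(1) by (auto elim!: test_funE intro: smooth_fun_continuous_on)
  qed
  \<comment> \<open>This exact expansion is used with \<open>s = 1\<close> and
    \<open>s = 1/2\<close> for the parallelogram law, and with small \<open>s\<close> of both signs
    for the condition at the minimum.\<close>
  have J_expand: "J (\<lambda>x. a x + s * b x) = J a + 2 * s * (B a b - T b) + s\<^sup>2 * B b b"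
    if ab: "test_fun \<Omega> a" "test_fun \<Omega> b" for a b s
  proof -
    have "B (\<lambda>x. a x + s * b x) (\<lambda>x. a x + s * b x)
        = (\<integral>x. N x * (a x * a x) + (2 * s) * (N x * (a x * b x)) + s\<^sup>2 * (N x * (b x * b x)) \<partial>lebesgue)"
      unfolding B_def by (intro Bochner_Integration.integral_cong) (auto simp: algebra_simps power2_eq_square)
    also have "\<dots> = B a a + 2 * s * B a b + s\<^sup>2 * B b b"
      unfolding B_def using int[OF ab(1,1)] int[OF ab] int[OF ab(2,2)] by simp
    finally show ?thesis
      unfolding J_def using T_add[OF ab(1) test_fun_cmult[OF ab(2), of s]] T_cmult[OF ab(2), of s]
      by (simp add: algebra_simps)
  qed
  have B_nonneg: "0 \<le> B a a" for a unfolding B_def using N(2) by (intro integral_nonneg_AE) auto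
  define m where "m = Inf (J ` {a. test_fun \<Omega> a})"
  have bdd: "bdd_below (J ` {a. test_fun \<Omega> a})"
    using T_bound by (intro bdd_belowI2[of _ "- A"]) (fastforce simp: J_def B_def)
  have m_le: "m \<le> J a" if "test_fun \<Omega> a" for a
    unfolding m_def using bdd that by (intro cInf_lower) auto
  \<comment> \<open>The rate is chosen so that the squared distances of consecutive terms, at most
    \<open>4 * (1/8)^n\<close>, stay summable after multiplication by \<open>2^n\<close>.\<close>
  have "\<exists>a. test_fun \<Omega> a \<and> J a < m + (1/8)^n" for n
  proof -
    have "\<exists>x\<in>J ` {a. test_fun \<Omega> a}. x < m + (1/8)^n"
      using cInf_lessD[of "J ` {a. test_fun \<Omega> a}" "m + (1/8)^n"] test_fun_zero unfolding m_def[symmetric]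
      by auto
    then show ?thesis by auto
  qed
  then obtain a where a: "\<And>n. test_fun \<Omega> (a n)" "\<And>n. J (a n) < m + (1/8)^n" by metis
  define d where "d n x = a (Suc n) x - a n x" for n x
  have d: "test_fun \<Omega> (d n)" for n
    using test_fun_add[OF a(1)[of "Suc n"] test_fun_cmult[OF a(1)[of n], of "-1"]] by (simp add: d_def[abs_def])
  have Bd: "B (d n) (d n) \<le> 4 * (1/8)^n" for n
  proof -
    have 1: "J (a (Suc n)) = J (a n) + 2 * (B (a n) (d n) - T (d n)) + B (d n) (d n)"
      using J_expand[OF a(1)[of n] d[of n], of 1] by (simp add: d_def)
    have 2: "J (\<lambda>x. a n x + (1/2) * d n x) = J (a n) + (B (a n) (d n) - T (d n)) + B (d n) (d n) / 4"
      using J_expand[OF a(1)[of n] d[of n], of "1/2"] by (simp add: power2_eq_square)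
    have 3: "m \<le> J (a n) + (B (a n) (d n) - T (d n)) + B (d n) (d n) / 4"
      unfolding 2[symmetric] by (intro m_le test_fun_add test_fun_cmult a d)
    have 4: "J (a (Suc n)) < m + (1/8)^n"
    proof -
      have "(1/8::real)^Suc n \<le> (1/8)^n" by (rule power_decreasing) auto
      then show ?thesis using a(2)[of "Suc n"] by linarith
    qed
    \<comment> \<open>Eliminating \<open>t\<close> turns the value at the midpoint into
      \<open>(j + j') / 2 - b / 4\<close>, the parallelogram law; being at least \<open>m\<close>,
      it bounds \<open>b\<close>.\<close>
    have "b \<le> 4 * e"
      if "j < m + e" "j' < m + e" "j' = j + 2 * t + b" "m \<le> j + t + b / 4" for b e j j' t :: real
      using that by argo
    from this[OF a(2)[of n] 4 1 3] show ?thesis .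
  qed
  define f where "f n x = 2^n * (N x * (d n x * d n x))" for n x
  have f: "integrable lebesgue (f n)" "0 \<le> f n x" for n x
    unfolding f_def using int[OF d d] N(2) by (auto intro!: mult_nonneg_nonneg)
  have "(\<integral>x. f n x \<partial>lebesgue) = 2^n * B (d n) (d n)" for n
    unfolding f_def B_def by simp
  moreover have "2^n * B (d n) (d n) \<le> 4 * (1/4)^n" for n
  proof -
    have "2^n * B (d n) (d n) \<le> 2^n * (4 * (1/8)^n)" by (intro mult_left_mono Bd) simp
    also have "\<dots> = 4 * (2 * (1/8))^n" by (simp only: power_mult_distrib mult_ac)
    also have "\<dots> = 4 * (1/4)^n" by simp
    finally show ?thesis .
  qed
  ultimately have f_le: "(\<integral>x. f n x \<partial>lebesgue) \<le> 4 * (1/4)^n" for n by simp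
  have "0 \<le> (\<integral>x. f n x \<partial>lebesgue)" for n using f(2) by (intro integral_nonneg_AE) auto
  then have norm_f: "norm (\<integral>x. f n x \<partial>lebesgue) \<le> 4 * (1/4)^n" for n using f_le[of n] by (simp only: real_norm_def abs_of_nonneg)
  have "summable (\<lambda>n. 4 * (1/4::real)^n)" by (intro summable_mult summable_geometric) simp
  then have "summable (\<lambda>n. \<integral>x. f n x \<partial>lebesgue)"
    by (rule summable_comparison_test'[where N = 0]) (rule norm_f)
  note AE_f = AE_summable_if_summable_integrals[OF f this]
  \<comment> \<open>From \<open>\<bar>d\<bar> \<le> 2^n * d^2 + (1/2)^n\<close> the increments of
    \<open>a n x\<close> are summable. Multiplied by \<open>N x\<close>, the first terms sum to at
    most the series of \<open>f\<close> and the second to at most \<open>2 * N x\<close>.\<close>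
  define D where "D x = N x * \<bar>a 0 x\<bar> + (\<Sum>n. f n x) + 2 * N x" for x
  define G where "G x = N x * lim (\<lambda>n. a n x)" for x
  have lim_dom: "(\<lambda>n. N x * a n x) \<longlonglongrightarrow> G x \<and> (\<forall>n. \<bar>N x * a n x\<bar> \<le> D x)" if x: "summable (\<lambda>n. f n x)" for x
  proof (cases "N x = 0")
    \<comment> \<open>Where \<open>N\<close> vanishes the sequence \<open>a n x\<close> need not
      converge, but all products with \<open>N x\<close> are 0, whatever value \<open>lim\<close>
      takes.\<close>
    case True
    then show ?thesis by (simp add: G_def D_def f_def)
  next
    case False
    then have Nx: "N x > 0" using N(2)[of x] by simp
    have le: "\<bar>d n x\<bar> \<le> 2^n * (d n x * d n x) + (1/2)^n" for n
    proof (cases "\<bar>d n x\<bar> \<le> (1/2)^n")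
      case False
      then have "1 \<le> 2^n * \<bar>d n x\<bar>" by (simp add: field_simps power_one_over)
      then have "1 * \<bar>d n x\<bar> \<le> (2^n * \<bar>d n x\<bar>) * \<bar>d n x\<bar>" by (rule mult_right_mono) simp
      also have "\<dots> = 2^n * (d n x * d n x)" by simp
      finally show ?thesis by (simp add: add_increasing2)
    qed (simp add: add_increasing)
    have geo: "summable (\<lambda>n. (1/2::real)^n)" "(\<Sum>n. (1/2::real)^n) = 2"
      using summable_geometric[of "1/2::real"] suminf_geometric[of "1/2::real"] by auto
    have "summable (\<lambda>n. f n x / N x)" using x by (rule summable_divide)
    then have s2: "summable (\<lambda>n. 2^n * (d n x * d n x))" using Nx by (simp add: f_def)
    have sd: "summable (\<lambda>n. \<bar>d n x\<bar>)"
      by (rule summable_comparison_test'[OF summable_add[OF s2 geo(1)], of 0]) (use le in auto)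
    have a_eq: "a n x = a 0 x + (\<Sum>k<n. d k x)" for n
      using sum_lessThan_telescope[of "\<lambda>k. a k x" n] by (simp add: d_def)
    have "(\<lambda>n. a 0 x + (\<Sum>k<n. d k x)) \<longlonglongrightarrow> a 0 x + (\<Sum>k. d k x)"
      by (intro tendsto_add tendsto_const summable_LIMSEQ summable_rabs_cancel[OF sd])
    then have "(\<lambda>n. a n x) \<longlonglongrightarrow> lim (\<lambda>n. a n x)"
      unfolding a_eq[symmetric] by (metis limI)
    then have "(\<lambda>n. N x * a n x) \<longlonglongrightarrow> G x" unfolding G_def by (rule tendsto_mult_left)
    moreover have "\<bar>N x * a n x\<bar> \<le> D x" for n
    proof -
      have "\<bar>a n x\<bar> \<le> \<bar>a 0 x\<bar> + (\<Sum>k<n. \<bar>d k x\<bar>)"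
        unfolding a_eq[of n] by (rule order_trans[OF abs_triangle_ineq add_left_mono[OF sum_abs]])
      also have "\<dots> \<le> \<bar>a 0 x\<bar> + (\<Sum>k<n. 2^k * (d k x * d k x) + (1/2)^k)"
        by (intro add_left_mono sum_mono le)
      also have "\<dots> = \<bar>a 0 x\<bar> + (\<Sum>k<n. 2^k * (d k x * d k x)) + (\<Sum>k<n. (1/2)^k)"
        by (simp add: sum.distrib)
      finally have "N x * \<bar>a n x\<bar> \<le> N x * (\<bar>a 0 x\<bar> + (\<Sum>k<n. 2^k * (d k x * d k x)) + (\<Sum>k<n. (1/2)^k))"
        using Nx by (intro mult_left_mono) auto
      also have "\<dots> = N x * \<bar>a 0 x\<bar> + (\<Sum>k<n. f k x) + N x * (\<Sum>k<n. (1/2)^k)"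
        by (simp add: f_def sum_distrib_left algebra_simps)
      also have "\<dots> \<le> N x * \<bar>a 0 x\<bar> + (\<Sum>k. f k x) + N x * 2"
      proof (intro add_mono order_refl mult_left_mono)
        show "(\<Sum>k<n. f k x) \<le> (\<Sum>k. f k x)" using x f(2) by (intro sum_le_suminf) auto
        show "(\<Sum>k<n. (1/2::real)^k) \<le> 2" using sum_le_suminf[OF geo(1), of "{..<n}"] geo(2) by simp
      qed (use Nx in simp)
      finally show ?thesis using Nx by (simp add: D_def abs_mult)
    qed
    ultimately show ?thesis by blast
  qed
  have F_loc: "loc_integrable \<Omega> (\<lambda>x. \<Sum>n. f n x)"
    unfolding loc_integrable_def set_integrable_def
    by (intro allI impI integrable_mult_indicator AE_f(2) fmeasurableD[OF lmeasurable_compact]) simp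
  have a_cont: "continuous_on UNIV (a n)" for n
    using a(1) by (auto elim!: test_funE intro: smooth_fun_continuous_on)
  have a_meas: "a n \<in> borel_measurable lebesgue" for n
    by (rule continuous_on_UNIV_measurable_lebesgue[OF a_cont])
  text \<open>Both the local integrability of \<open>G\<close> and the passage to the limit are instances of the following
    statement, with \<open>c\<close> an indicator or a test function.\<close>
  have dct: "integrable lebesgue (\<lambda>x. G x * c x) \<and>
      (\<lambda>n. \<integral>x. (N x * a n x) * c x \<partial>lebesgue) \<longlonglongrightarrow> (\<integral>x. G x * c x \<partial>lebesgue)"
    if c: "c \<in> borel_measurable lebesgue" "\<And>x. \<bar>c x\<bar> \<le> b" and K: "compact K" "K \<subseteq> \<Omega>" "\<And>x. x \<notin> K \<Longrightarrow> c x = 0"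
    for c b K
  proof -
    have Nc: "integrable lebesgue (\<lambda>x. N x * c x)"
      by (rule loc_integrable_mult_bounded[OF N(1) K(1,2) c K(3)])
    have Nc_meas: "(\<lambda>x. N x * c x) \<in> borel_measurable lebesgue" by (rule borel_measurable_integrable[OF Nc])
    have "(\<lambda>x. (N x * c x) * lim (\<lambda>n. a n x)) \<in> borel_measurable lebesgue"
      by (intro borel_measurable_times Nc_meas borel_measurable_lim_metric a_meas)
    then have G_meas: "(\<lambda>x. G x * c x) \<in> borel_measurable lebesgue" by (simp add: G_def mult_ac)
    have meas: "(\<lambda>x. (N x * a n x) * c x) \<in> borel_measurable lebesgue" for n
      using borel_measurable_times[OF Nc_meas a_meas[of n]] by (simp add: mult_ac)
    have "integrable lebesgue (\<lambda>x. N x * (\<bar>a 0 x\<bar> * \<bar>c x\<bar>))"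
    proof -
      obtain b0 where b0: "\<And>x. \<bar>a 0 x\<bar> \<le> b0" by (rule cc_fun_bounded[OF test_fun_imp_cc_fun[OF a(1)]]) blast
      show ?thesis
      proof (rule loc_integrable_mult_bounded[OF N(1) K(1,2), of _ "b0 * b"])
        show "(\<lambda>x. \<bar>a 0 x\<bar> * \<bar>c x\<bar>) \<in> borel_measurable lebesgue"
          using a_meas c by (intro borel_measurable_times borel_measurable_abs)
        have "0 \<le> b0" using b0 abs_ge_zero order_trans by blast
        then show "\<bar>\<bar>a 0 x\<bar> * \<bar>c x\<bar>\<bar> \<le> b0 * b" for x
          using b0[of x] c(2)[of x] by (simp add: abs_mult mult_mono)
        show "\<bar>a 0 x\<bar> * \<bar>c x\<bar> = 0" if "x \<notin> K" for x using K(3)[OF that] by simp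
      qed
    qed
    moreover have "integrable lebesgue (\<lambda>x. (\<Sum>n. f n x) * \<bar>c x\<bar>)"
      by (rule loc_integrable_mult_bounded[OF F_loc K(1,2), of _ b]) (use c K(3) in auto)
    moreover have "integrable lebesgue (\<lambda>x. N x * \<bar>c x\<bar>)"
      by (rule loc_integrable_mult_bounded[OF N(1) K(1,2), of _ b]) (use c K(3) in auto)
    ultimately have D_int: "integrable lebesgue (\<lambda>x. D x * \<bar>c x\<bar>)"
      by (simp add: D_def ring_distribs mult.assoc)
    have lim: "AE x in lebesgue. (\<lambda>n. (N x * a n x) * c x) \<longlonglongrightarrow> G x * c x"
      using AE_f(1) by eventually_elim (use lim_dom in \<open>auto intro!: tendsto_mult_right\<close>)
    have dom: "AE x in lebesgue. norm ((N x * a n x) * c x) \<le> D x * \<bar>c x\<bar>" for n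
      using AE_f(1)
    proof eventually_elim
      case (elim x)
      then have "\<bar>N x * a n x\<bar> * \<bar>c x\<bar> \<le> D x * \<bar>c x\<bar>" using lim_dom by (intro mult_right_mono) auto
      then show ?case by (simp add: abs_mult)
    qed
    show ?thesis
      using integrable_dominated_convergence[OF G_meas meas D_int lim dom]
        integral_dominated_convergence[OF G_meas meas D_int lim dom] by blast
  qed
  have G_loc: "loc_integrable \<Omega> G"
    unfolding loc_integrable_def set_integrable_def
  proof (intro allI impI)
    fix K assume "compact K \<and> K \<subseteq> \<Omega>"
    then have "integrable lebesgue (\<lambda>x. G x * indicator K x)"
      by (intro conjunct1[OF dct[of _ 1 K]] borel_measurable_indicator fmeasurableD[OF lmeasurable_compact])
         (auto simp: indicator_def)
    then show "integrable lebesgue (\<lambda>x. indicator K x *\<^sub>R G x)" by (simp add: mult.commute)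
  qed
  moreover have "T \<psi> = (\<integral>x. G x * \<psi> x \<partial>lebesgue)" if \<psi>: "test_fun \<Omega> \<psi>" for \<psi>
  proof -
    obtain K where K: "smooth_fun \<psi>" "compact K" "K \<subseteq> \<Omega>" "\<And>x. x \<notin> K \<Longrightarrow> \<psi> x = 0"
      by (rule test_funE[OF \<psi>]) blast
    obtain b where b: "\<And>x. \<bar>\<psi> x\<bar> \<le> b" by (rule cc_fun_bounded[OF test_fun_imp_cc_fun[OF \<psi>]]) blast
    have lim: "(\<lambda>n. B (a n) \<psi>) \<longlonglongrightarrow> (\<integral>x. G x * \<psi> x \<partial>lebesgue)"
      using dct[OF continuous_on_UNIV_measurable_lebesgue[OF smooth_fun_continuous_on[OF K(1)]] b K(2-4)]
      by (simp add: B_def mult.assoc)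
    have le: "norm (B (a n) \<psi> - T \<psi>) \<le> (1 + B \<psi> \<psi>) * (1/2)^n" for n
    proof -
      have *: "- ((1/8)^n) \<le> 2 * s * (B (a n) \<psi> - T \<psi>) + s\<^sup>2 * B \<psi> \<psi>" for s
      proof -
        have "m \<le> J (\<lambda>x. a n x + s * \<psi> x)" by (intro m_le test_fun_add test_fun_cmult a \<psi>)
        then show ?thesis using J_expand[OF a(1)[of n] \<psi>, of s] a(2)[of n] by linarith
      qed
      \<comment> \<open>With this step \<open>(1/8)^n\<close> is \<open>t^3\<close>. Near-minimality
        in the directions \<open>t\<close> and \<open>- t\<close> then leaves an error of order
        \<open>t\<close> after division by \<open>t\<close>, so the limit satisfies the
        Euler-Lagrange equation exactly.\<close>
      define t where "t = (1/2::real)^n"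
      have "(1/8::real)^n = (1/2 * (1/2)\<^sup>2)^n" by (simp add: power2_eq_square)
      also have "\<dots> = t * t\<^sup>2"
        unfolding t_def power_mult_distrib power_mult[symmetric] by (simp only: mult.commute)
      finally have t: "t > 0" "t \<le> 1" "(1/8)^n = t * t\<^sup>2" by (auto simp: t_def power_le_one)
      have "t * (2 * \<bar>B (a n) \<psi> - T \<psi>\<bar>) \<le> t * (t\<^sup>2 + t * B \<psi> \<psi>)"
        using *[of t] *[of "- t"] unfolding t(3) by (simp add: abs_if power2_eq_square algebra_simps)
      then have "2 * \<bar>B (a n) \<psi> - T \<psi>\<bar> \<le> t\<^sup>2 + t * B \<psi> \<psi>" using t(1) by simp
      also have "\<dots> \<le> t + t * B \<psi> \<psi>" using t by (simp add: power2_eq_square mult_left_le)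
      also have "\<dots> \<le> 2 * (t + t * B \<psi> \<psi>)" using t B_nonneg[of \<psi>] by simp
      finally show ?thesis by (simp add: t_def algebra_simps)
    qed
    have "(\<lambda>n. (1 + B \<psi> \<psi>) * (1/2)^n) \<longlonglongrightarrow> 0"
      by (intro tendsto_mult_right_zero LIMSEQ_power_zero) simp
    then have "(\<lambda>n. B (a n) \<psi> - T \<psi>) \<longlonglongrightarrow> 0"
      by (rule Lim_null_comparison[OF always_eventually[OF allI[OF le]]])
    then have "(\<lambda>n. B (a n) \<psi>) \<longlonglongrightarrow> T \<psi>" by (rule LIM_zero_cancel)
    then show ?thesis using lim by (rule LIMSEQ_unique)
  qed
  ultimately show ?thesis by blast
qed

text \<open>A sum of multiples of the indicators of a compact exhaustion. Every compact part of
  \<open>\<Omega>\<close> lies in a single member of the exhaustion, which gives the positive lower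
  bound there.\<close>

lemma positive_weight_exists:
  fixes M :: "'a::euclidean_space \<Rightarrow> real"
  assumes \<Omega>: "open \<Omega>" and M: "loc_integrable \<Omega> M" "\<And>x. 0 \<le> M x"
  obtains \<rho> where "\<rho> \<in> borel_measurable lebesgue" "\<And>x. 0 \<le> \<rho> x" "\<And>x. x \<in> \<Omega> \<Longrightarrow> 0 < \<rho> x"
    "integrable lebesgue (\<lambda>x. M x * \<rho> x)"
    "\<And>K. compact K \<Longrightarrow> K \<subseteq> \<Omega> \<Longrightarrow> \<exists>r>0. \<forall>x\<in>K. r \<le> \<rho> x"
proof -
  obtain C :: "nat \<Rightarrow> 'a set" where C: "\<And>n. compact (C n)" "\<And>n. C n \<subseteq> \<Omega>" "\<Union>(range C) = \<Omega>"
    "\<And>K. compact K \<Longrightarrow> K \<subseteq> \<Omega> \<Longrightarrow> \<exists>N. \<forall>n\<ge>N. K \<subseteq> C n"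
    using open_Union_compact_subsets[OF \<Omega>] by metis
  define k where "k n x = M x * indicator (C n) x" for n x
  have k: "integrable lebesgue (k n)" "0 \<le> k n x" for n x
    using M C unfolding loc_integrable_def set_integrable_def k_def[abs_def] by (auto simp: mult.commute)
  define a where "a n = (\<integral>x. k n x \<partial>lebesgue)" for n
  have a: "0 \<le> a n" for n unfolding a_def using k by (intro integral_nonneg_AE) auto
  \<comment> \<open>The denominator makes both \<open>r n\<close> and \<open>r n * a n\<close> at
    most \<open>(1/2)^n\<close>: the first for convergence of \<open>\<rho>\<close>, the second for
    integrability of \<open>M * \<rho>\<close>.\<close>
  define r where "r n = (1/2)^n / (1 + a n)" for n
  have r: "0 < r n" "r n \<le> (1/2)^n" "r n * a n \<le> (1/2)^n" for n
  proof -
    show "0 < r n" using a[of n] by (simp add: r_def)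
    show "r n \<le> (1/2)^n" using a[of n] divide_left_mono[of 1 "1 + a n" "(1/2)^n"] by (simp add: r_def)
    have "a n / (1 + a n) \<le> 1" using a[of n] by simp
    then have "(1/2)^n * (a n / (1 + a n)) \<le> (1/2)^n * 1" by (intro mult_left_mono) auto
    then show "r n * a n \<le> (1/2)^n" by (simp add: r_def)
  qed
  have geo: "summable (\<lambda>n. (1/2::real)^n)" by (rule summable_geometric) simp
  define \<rho> where "\<rho> x = (\<Sum>n. r n * indicator (C n) x)" for x
  have sum: "summable (\<lambda>n. r n * indicator (C n) x)" for x
    by (rule summable_comparison_test'[OF geo, of 0]) (use r in \<open>auto simp: indicator_def less_imp_le\<close>)
  have r_le: "r n \<le> \<rho> x" if "x \<in> C n" for n x
    using sum_le_suminf[OF sum, of "{n}" x] r that unfolding \<rho>_def by (auto simp: indicator_def less_imp_le)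
  show ?thesis
  proof
    show "\<rho> \<in> borel_measurable lebesgue" unfolding \<rho>_def
      using C by (intro borel_measurable_suminf borel_measurable_times borel_measurable_indicator
          fmeasurableD[OF lmeasurable_compact]) auto
    show "0 \<le> \<rho> x" for x unfolding \<rho>_def using r by (intro suminf_nonneg sum) (auto simp: indicator_def less_imp_le)
    show "0 < \<rho> x" if "x \<in> \<Omega>" for x
    proof -
      obtain n where "x \<in> C n" using \<open>x \<in> \<Omega>\<close> C(3) by blast
      then show ?thesis using r(1)[of n] r_le by fastforce
    qed
    show "\<exists>e>0. \<forall>x\<in>K. e \<le> \<rho> x" if "compact K" "K \<subseteq> \<Omega>" for K
      using C(4)[OF that] r(1) r_le by (meson order_refl subsetD)
    have "integrable lebesgue (\<lambda>x. \<Sum>n. r n * k n x)"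
    proof (rule AE_summable_if_summable_integrals(2))
      show "integrable lebesgue (\<lambda>x. r n * k n x)" for n using k by simp
      show "0 \<le> r n * k n x" for n x using k r by (simp add: less_imp_le)
      show "summable (\<lambda>n. \<integral>x. r n * k n x \<partial>lebesgue)"
        by (rule summable_comparison_test'[OF geo, of 0])
           (use r a in \<open>auto simp: a_def[symmetric] abs_mult less_imp_le\<close>)
    qed
    moreover have "(\<Sum>n. r n * k n x) = M x * \<rho> x" for x
      unfolding \<rho>_def suminf_mult[OF sum, symmetric] by (simp add: k_def mult_ac)
    ultimately show "integrable lebesgue (\<lambda>x. M x * \<rho> x)" by simp
  qed
qed

text \<open>Expanding \<open>(\<bar>a x\<bar> - \<rho> x)^2 \<ge> 0\<close> and multiplying by
  \<open>M x / \<rho> x\<close> turns the assumed bound into the quadratic one with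
  \<open>N = M / \<rho>\<close> and the finite constant given by the integral of
  \<open>M * \<rho>\<close>. The density found in this way is then compared with \<open>M\<close> by
  testing with nonnegative functions.\<close>

lemma dominated_functional_representation:
  fixes M :: "'a::euclidean_space \<Rightarrow> real" and T :: "('a \<Rightarrow> real) \<Rightarrow> real"
  assumes \<Omega>: "open \<Omega>" and M: "loc_integrable \<Omega> M" "\<And>x. 0 \<le> M x"
    and T_add: "\<And>a b. test_fun \<Omega> a \<Longrightarrow> test_fun \<Omega> b \<Longrightarrow> T (\<lambda>x. a x + b x) = T a + T b"
    and T_cmult: "\<And>s a. test_fun \<Omega> a \<Longrightarrow> T (\<lambda>x. s * a x) = s * T a"
    and T_bound: "\<And>a. test_fun \<Omega> a \<Longrightarrow> \<bar>T a\<bar> \<le> (\<integral>x. M x * \<bar>a x\<bar> \<partial>lebesgue)"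
  obtains G where "loc_integrable \<Omega> G" "\<And>\<psi>. test_fun \<Omega> \<psi> \<Longrightarrow> T \<psi> = (\<integral>x. G x * \<psi> x \<partial>lebesgue)"
    "AE x in lebesgue. x \<in> \<Omega> \<longrightarrow> \<bar>G x\<bar> \<le> M x"
proof -
  obtain \<rho> where \<rho>: "\<rho> \<in> borel_measurable lebesgue" "\<And>x. 0 \<le> \<rho> x" "\<And>x. x \<in> \<Omega> \<Longrightarrow> 0 < \<rho> x"
    "integrable lebesgue (\<lambda>x. M x * \<rho> x)"
    "\<And>K. compact K \<Longrightarrow> K \<subseteq> \<Omega> \<Longrightarrow> \<exists>r>0. \<forall>x\<in>K. r \<le> \<rho> x"
    by (rule positive_weight_exists[OF \<Omega> M]) blast
  define N where "N x = M x / \<rho> x" for x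
  have N_nonneg: "0 \<le> N x" for x using M(2) \<rho>(2) by (simp add: N_def)
  have N: "loc_integrable \<Omega> N"
    unfolding loc_integrable_def set_integrable_def
  proof (intro allI impI)
    fix K assume K: "compact K \<and> K \<subseteq> \<Omega>"
    obtain r where r: "r > 0" "\<And>x. x \<in> K \<Longrightarrow> r \<le> \<rho> x" using \<rho>(5)[of K] K by auto
    have "integrable lebesgue (\<lambda>x. M x * (indicator K x / \<rho> x))"
    proof (rule loc_integrable_mult_bounded[OF M(1), of K _ "1 / r"])
      show "(\<lambda>x. indicator K x / \<rho> x) \<in> borel_measurable lebesgue"
        using K \<rho>(1) by (intro borel_measurable_divide borel_measurable_indicator fmeasurableD[OF lmeasurable_compact]) auto
      show "\<bar>indicator K x / \<rho> x\<bar> \<le> 1 / r" for x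
        using r(1) r(2)[of x] by (auto simp: indicator_def frac_le)
    qed (use K in auto)
    then show "integrable lebesgue (\<lambda>x. indicator K x *\<^sub>R N x)" by (simp add: N_def mult.commute)
  qed
  have "2 * T a \<le> (\<integral>x. N x * (a x * a x) \<partial>lebesgue) + (\<integral>x. M x * \<rho> x \<partial>lebesgue)" if a: "test_fun \<Omega> a" for a
  proof -
    note cc = test_fun_imp_cc_fun[OF a]
    have cont: "continuous_on UNIV a" using cc by (simp add: cc_fun_def)
    have i1: "integrable lebesgue (\<lambda>x. M x * \<bar>a x\<bar>)" by (rule loc_integrable_mult_cc[OF M(1) cc_fun_abs[OF cc]])
    have i2: "integrable lebesgue (\<lambda>x. N x * (a x * a x))" by (rule loc_integrable_mult_cc[OF N cc_fun_mult[OF cc cont]])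
    have "2 * T a \<le> 2 * (\<integral>x. M x * \<bar>a x\<bar> \<partial>lebesgue)" using T_bound[OF a] by linarith
    also have "\<dots> = (\<integral>x. 2 * (M x * \<bar>a x\<bar>) \<partial>lebesgue)" by simp
    also have "\<dots> \<le> (\<integral>x. N x * (a x * a x) + M x * \<rho> x \<partial>lebesgue)"
    proof (rule integral_mono)
      show "integrable lebesgue (\<lambda>x. 2 * (M x * \<bar>a x\<bar>))" using i1 by simp
      show "integrable lebesgue (\<lambda>x. N x * (a x * a x) + M x * \<rho> x)" using i2 \<rho>(4) by simp
      show "2 * (M x * \<bar>a x\<bar>) \<le> N x * (a x * a x) + M x * \<rho> x" for x
      proof (cases "x \<in> \<Omega>")
        case True
        then have pos: "\<rho> x > 0" by (rule \<rho>(3))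
        have "0 \<le> (\<bar>a x\<bar> - \<rho> x)\<^sup>2" by simp
        then have "2 * \<bar>a x\<bar> * \<rho> x \<le> a x * a x + \<rho> x * \<rho> x" by (simp add: power2_eq_square algebra_simps)
        then have "2 * \<bar>a x\<bar> \<le> a x * a x / \<rho> x + \<rho> x" using pos by (simp add: field_simps)
        then have "M x * (2 * \<bar>a x\<bar>) \<le> M x * (a x * a x / \<rho> x + \<rho> x)" by (rule mult_left_mono[OF _ M(2)])
        then show ?thesis by (simp add: N_def algebra_simps)
      next
        case False
        then have "a x = 0" using cc by (auto simp: cc_fun_def)
        then show ?thesis using M(2) \<rho>(2) by simp
      qed
    qed
    also have "\<dots> = (\<integral>x. N x * (a x * a x) \<partial>lebesgue) + (\<integral>x. M x * \<rho> x \<partial>lebesgue)" using i2 \<rho>(4) by simp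
    finally show ?thesis .
  qed
  from bounded_functional_representation[OF N N_nonneg T_add T_cmult this]
  obtain G where G: "loc_integrable \<Omega> G" "\<And>\<psi>. test_fun \<Omega> \<psi> \<Longrightarrow> T \<psi> = (\<integral>x. G x * \<psi> x \<partial>lebesgue)"
    by blast
  have i: "integrable lebesgue (\<lambda>x. M x * \<psi> x)" "integrable lebesgue (\<lambda>x. G x * \<psi> x)" if "test_fun \<Omega> \<psi>" for \<psi>
    by (rule loc_integrable_mult_cc[OF M(1) test_fun_imp_cc_fun[OF that]],
        rule loc_integrable_mult_cc[OF G(1) test_fun_imp_cc_fun[OF that]])
  have "AE x in lebesgue. x \<in> \<Omega> \<longrightarrow> 0 \<le> M x - G x"
  proof (rule AE_nonneg_if_integral_test_fun_nonneg[OF \<Omega> loc_integrable_diff[OF M(1) G(1)]])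
    fix \<psi> assume \<psi>: "test_fun \<Omega> \<psi>" "\<And>x. 0 \<le> \<psi> x"
    then show "0 \<le> (\<integral>x. (M x - G x) * \<psi> x \<partial>lebesgue)"
      using T_bound[OF \<psi>(1)] G(2)[OF \<psi>(1)] i[OF \<psi>(1)] by (simp add: left_diff_distrib)
  qed
  \<comment> \<open>The sum \<open>M x + G x\<close> in the shape that
    \<open>loc_integrable_diff\<close> handles.\<close>
  moreover have "AE x in lebesgue. x \<in> \<Omega> \<longrightarrow> 0 \<le> M x - (0 - G x)"
  proof (rule AE_nonneg_if_integral_test_fun_nonneg[OF \<Omega> loc_integrable_diff[OF M(1) loc_integrable_diff[OF _ G(1)]]])
    show "loc_integrable \<Omega> (\<lambda>_. 0)" by (rule continuous_on_imp_loc_integrable) simp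
    fix \<psi> assume \<psi>: "test_fun \<Omega> \<psi>" "\<And>x. 0 \<le> \<psi> x"
    then show "0 \<le> (\<integral>x. (M x - (0 - G x)) * \<psi> x \<partial>lebesgue)"
      using T_bound[OF \<psi>(1)] G(2)[OF \<psi>(1)] i[OF \<psi>(1)] by (simp add: distrib_right)
  qed
  ultimately have "AE x in lebesgue. x \<in> \<Omega> \<longrightarrow> \<bar>G x\<bar> \<le> M x" by eventually_elim auto
  then show ?thesis using that G by blast
qed

section \<open>Composition with locally Lipschitz functions\<close>

text \<open>Up to sign the integral is the derivative at 0 of the integral of
  \<open>\<theta> (z - t *\<^sub>R b)\<close>, which is constant in \<open>t\<close> by translation
  invariance.\<close>

lemma integral_frechet_derivative_test_fun:
  fixes \<theta> :: "'a::euclidean_space \<Rightarrow> real"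
  assumes "test_fun UNIV \<theta>"
  shows "(\<integral>z. frechet_derivative \<theta> (at z) b \<partial>lebesgue) = 0"
proof -
  obtain K where K: "smooth_fun \<theta>" "compact K" "\<And>x. x \<notin> K \<Longrightarrow> \<theta> x = 0"
    by (rule test_funE[OF assms]) blast
  have \<theta>K: "test_fun K \<theta>" by (rule test_funI[OF K(1,2) order_refl K(3)])
  obtain r K1 where r: "0 < r" and K1: "compact K1" "K \<subseteq> interior K1"
    and thick: "\<And>z a. z \<in> K \<Longrightarrow> norm a \<le> r \<Longrightarrow> z + a \<in> K1"
    by (rule compact_thickening[OF K(2) open_UNIV subset_UNIV]) blast
  have DK: "frechet_derivative \<theta> (at z) b = 0" if "z \<notin> K" for z
    using test_fun_directional_derivative[OF \<theta>K, of b] that by (auto elim!: test_funE)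
  have KK1: "K \<subseteq> K1" using K1(2) interior_subset by blast
  \<comment> \<open>The indicator replaces the constant function 1, which is not integrable. Small
    translates of \<open>\<theta>\<close> are supported in \<open>K1\<close>, so nothing is
    lost.\<close>
  let ?F = "\<lambda>t. \<integral>z. indicator K1 z * \<theta> (z - t *\<^sub>R b) \<partial>lebesgue"
  have "integrable lebesgue (indicator K1 :: 'a \<Rightarrow> real)"
    using lmeasurable_compact[OF K1(1)] by (simp only: lmeasurable_iff_integrable)
  then have "(?F has_real_derivative - (\<integral>z. indicator K1 z * frechet_derivative \<theta> (at (z - 0 *\<^sub>R b)) b \<partial>lebesgue)) (at 0)"
    by (rule integral_shift_has_derivative[OF _ assms])
  moreover have "(\<integral>z. indicator K1 z * frechet_derivative \<theta> (at (z - 0 *\<^sub>R b)) b \<partial>lebesgue)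
      = (\<integral>z. frechet_derivative \<theta> (at z) b \<partial>lebesgue)"
    using KK1 DK by (intro Bochner_Integration.integral_cong) (auto simp: indicator_def)
  ultimately have 1: "(?F has_real_derivative - (\<integral>z. frechet_derivative \<theta> (at z) b \<partial>lebesgue)) (at 0)" by simp
  have F_const: "?F t = (\<integral>z. \<theta> z \<partial>lebesgue)" if t: "norm (t *\<^sub>R b) \<le> r" for t
  proof -
    have "?F t = (\<integral>z. \<theta> (z - t *\<^sub>R b) \<partial>lebesgue)"
    proof (intro Bochner_Integration.integral_cong refl)
      fix z show "indicator K1 z * \<theta> (z - t *\<^sub>R b) = \<theta> (z - t *\<^sub>R b)"
        using thick[of "z - t *\<^sub>R b" "t *\<^sub>R b"] t K(3)[of "z - t *\<^sub>R b"] by (cases "z - t *\<^sub>R b \<in> K") auto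
    qed
    also have "\<dots> = (\<integral>z. \<theta> z \<partial>lebesgue)"
      using integral_lebesgue_shift[of \<theta> "- (t *\<^sub>R b)"] smooth_fun_continuous_on[OF K(1)]
      by (auto intro: borel_measurable_continuous_onI)
    finally show ?thesis .
  qed
  have "((\<lambda>t. norm (t *\<^sub>R b)) \<longlongrightarrow> norm (0 *\<^sub>R b)) (nhds 0)" by (intro tendsto_intros) (auto simp: filterlim_ident)
  then have "\<forall>\<^sub>F t in nhds 0. norm (t *\<^sub>R b) < r" using r by (intro order_tendstoD(2)) auto
  then have "\<forall>\<^sub>F t in nhds 0. ?F t = (\<integral>z. \<theta> z \<partial>lebesgue)" by eventually_elim (rule F_const, simp)
  then have "(?F has_real_derivative 0) (at 0)"
    by (subst DERIV_cong_ev[OF refl _ refl]) auto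
  from DERIV_unique[OF 1 this] show ?thesis by simp
qed

text \<open>The product of the coordinate and \<open>\<psi>\<close> is again a test function, so its
  derivative integrates to 0; the product rule then separates the two terms. Coordinates are the
  functions on which the operator is tested.\<close>

lemma is_weak_grad_inner:
  assumes "open \<Omega>"
  shows "is_weak_grad \<Omega> (\<lambda>y. y \<bullet> b) (\<lambda>_. b)"
  unfolding is_weak_grad_iff
proof (intro conjI ballI allI impI)
  show "loc_integrable \<Omega> (\<lambda>x. b \<bullet> b')" for b' by (rule continuous_on_imp_loc_integrable) simp
  fix \<psi> and b' :: 'a assume "test_fun \<Omega> \<psi> \<and> b' \<in> Basis"
  then have \<psi>: "test_fun UNIV \<psi>" "smooth_fun \<psi>" using test_fun_mono by (auto simp: test_fun_def)
  have \<theta>: "test_fun UNIV (\<lambda>y. (y \<bullet> b) * \<psi> y)" by (rule test_fun_mult[OF smooth_fun_inner \<psi>(1)])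
  have D: "frechet_derivative (\<lambda>y. (y \<bullet> b) * \<psi> y) (at x) b' = (x \<bullet> b) * frechet_derivative \<psi> (at x) b' + (b \<bullet> b') * \<psi> x" for x
  proof -
    have "((\<lambda>y. (y \<bullet> b) * \<psi> y) has_derivative
        (\<lambda>h. (x \<bullet> b) * frechet_derivative \<psi> (at x) h + (h \<bullet> b) * \<psi> x)) (at x)"
      by (intro has_derivative_mult smooth_fun_has_derivative \<psi>) (auto intro!: derivative_eq_intros)
    from frechet_derivative_at[OF this, symmetric] show ?thesis by (simp add: inner_commute)
  qed
  have "integrable lebesgue (\<lambda>x. (x \<bullet> b) * frechet_derivative \<psi> (at x) b')"
    by (rule loc_integrable_mult_cc[OF continuous_on_imp_loc_integrable test_fun_imp_cc_fun[OF test_fun_directional_derivative[OF \<psi>(1)]]])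
       (intro continuous_intros)
  moreover have "integrable lebesgue (\<lambda>x. (b \<bullet> b') * \<psi> x)"
    using cc_fun_integrable[OF test_fun_imp_cc_fun[OF \<psi>(1)]] by simp
  ultimately have "(\<integral>x. (x \<bullet> b) * frechet_derivative \<psi> (at x) b' \<partial>lebesgue) + (\<integral>x. (b \<bullet> b') * \<psi> x \<partial>lebesgue) = 0"
    using integral_frechet_derivative_test_fun[OF \<theta>, of b'] unfolding D by simp
  then show "(\<integral>x. (x \<bullet> b) * frechet_derivative \<psi> (at x) b' \<partial>lebesgue) = - (\<integral>x. (b \<bullet> b') * \<psi> x \<partial>lebesgue)"
    by linarith
qed

text \<open>Since \<open>\<Omega>'\<close> need not be convex, \<open>f\<close> is Lipschitz with
  constant \<open>L\<close> only on balls inside it. The compact image of \<open>K\<close> leaves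
  room for balls of a common radius \<open>R\<close>, and uniform continuity of
  \<open>\<phi>\<close> keeps small increments within them.\<close>

lemma composition_increment_le:
  fixes \<phi> :: "'a::euclidean_space \<Rightarrow> 'b::euclidean_space"
  assumes \<Omega>: "open \<Omega>" "open \<Omega>'" and \<phi>: "continuous_on \<Omega> \<phi>" "\<phi> ` \<Omega> \<subseteq> \<Omega>'"
    and f: "continuous_on \<Omega>' f" "is_weak_grad \<Omega>' f gf" "AE z in lebesgue. z \<in> \<Omega>' \<longrightarrow> norm (gf z) \<le> L"
    and L: "0 \<le> L" and K: "compact K" "K \<subseteq> \<Omega>"
  shows "\<exists>\<delta>>0. \<forall>z\<in>K. \<forall>h. norm h < \<delta> \<longrightarrow>
      \<bar>(f \<circ> \<phi>) (z + h) - (f \<circ> \<phi>) z\<bar> \<le> L * (\<Sum>i\<in>Basis. \<bar>\<phi> (z + h) \<bullet> i - \<phi> z \<bullet> i\<bar>)"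
proof -
  have "compact (\<phi> ` K)" by (intro compact_continuous_image continuous_on_subset[OF \<phi>(1)] K)
  moreover have "\<phi> ` K \<subseteq> \<Omega>'" using \<phi>(2) K(2) by blast
  ultimately obtain R where R: "R > 0" "(\<Union>y\<in>\<phi> ` K. cball y R) \<subseteq> \<Omega>'"
    using compact_subset_open_imp_cball_epsilon_subset[OF _ \<Omega>(2)] by blast
  obtain r K1 where r: "0 < r" and K1: "compact K1" "K1 \<subseteq> \<Omega>" "K \<subseteq> interior K1"
    and thick: "\<And>z a. z \<in> K \<Longrightarrow> norm a \<le> r \<Longrightarrow> z + a \<in> K1"
    by (rule compact_thickening[OF K(1) \<Omega>(1) K(2)]) blast
  have "uniformly_continuous_on K1 \<phi>"
    by (intro compact_uniformly_continuous continuous_on_subset[OF \<phi>(1)] K1)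
  then obtain \<delta> where \<delta>: "\<delta> > 0" "\<And>x y. x \<in> K1 \<Longrightarrow> y \<in> K1 \<Longrightarrow> dist y x < \<delta> \<Longrightarrow> dist (\<phi> y) (\<phi> x) < R"
    unfolding uniformly_continuous_on_def using R(1) by metis
  have "\<bar>f (\<phi> (z + h)) - f (\<phi> z)\<bar> \<le> L * (\<Sum>i\<in>Basis. \<bar>\<phi> (z + h) \<bullet> i - \<phi> z \<bullet> i\<bar>)"
    if z: "z \<in> K" and h: "norm h < min \<delta> r" for z h
  proof -
    have "z \<in> K1" "z + h \<in> K1" using thick[OF z, of 0] thick[OF z, of h] h r by auto
    then have "dist (\<phi> (z + h)) (\<phi> z) < R" using h by (intro \<delta>(2)) (auto simp: dist_norm)
    then have "\<phi> (z + h) \<in> ball (\<phi> z) R" by (simp add: dist_commute)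
    moreover have "ball (\<phi> z) R \<subseteq> \<Omega>'" using R(2) z by force
    ultimately have "\<bar>f (\<phi> (z + h)) - f (\<phi> z)\<bar> \<le> L * norm (\<phi> (z + h) - \<phi> z)"
      using R(1) by (intro continuous_weak_grad_bounded_lipschitz[OF f(1) \<Omega>(2) f(2,3) convex_ball open_ball]) auto
    also have "\<dots> \<le> L * (\<Sum>i\<in>Basis. \<bar>(\<phi> (z + h) - \<phi> z) \<bullet> i\<bar>)"
      by (intro mult_left_mono norm_le_l1 L)
    finally show ?thesis by (simp add: inner_diff_left)
  qed
  then show ?thesis using \<delta>(1) r by (intro exI[of _ "min \<delta> r"]) (auto simp: o_def)
qed

lemma loc_integrable_abs_combination:
  assumes "finite I" "\<And>i. i \<in> I \<Longrightarrow> loc_integrable \<Omega> (h i)"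
  shows "loc_integrable \<Omega> (\<lambda>x. L * (\<Sum>i\<in>I. \<bar>h i x\<bar>))"
  unfolding loc_integrable_def set_integrable_def
proof (intro allI impI)
  fix K assume K: "compact K \<and> K \<subseteq> \<Omega>"
  have "integrable lebesgue (\<lambda>x. \<bar>indicator K x *\<^sub>R h i x\<bar>)" if "i \<in> I" for i
    using assms(2)[OF that] K unfolding loc_integrable_def set_integrable_def by (intro integrable_abs) auto
  then have "integrable lebesgue (\<lambda>x. L * (\<Sum>i\<in>I. \<bar>indicator K x *\<^sub>R h i x\<bar>))"
    by (intro integrable_mult_right Bochner_Integration.integrable_sum)
  moreover have eq: "L * (\<Sum>i\<in>I. \<bar>indicator K x *\<^sub>R h i x\<bar>) = indicator K x *\<^sub>R (L * (\<Sum>i\<in>I. \<bar>h i x\<bar>))" for x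
    by (cases "x \<in> K") auto
  ultimately show "integrable lebesgue (\<lambda>x. indicator K x *\<^sub>R (L * (\<Sum>i\<in>I. \<bar>h i x\<bar>)))" by (simp only: eq)
qed

text \<open>Each direction \<open>b\<close> has its own functional and dominating density
  \<open>M b\<close>; the resulting scalar densities are the coordinates of the gradient.\<close>

lemma composition_weak_grad:
  fixes \<phi> :: "'a::euclidean_space \<Rightarrow> 'b::euclidean_space"
  assumes \<Omega>: "open \<Omega>" "open \<Omega>'" and \<phi>: "continuous_on \<Omega> \<phi>" "\<phi> ` \<Omega> \<subseteq> \<Omega>'"
    and g: "\<And>i. i \<in> Basis \<Longrightarrow> is_weak_grad \<Omega> (\<lambda>x. \<phi> x \<bullet> i) (g i)"
    and f: "continuous_on \<Omega>' f" "is_weak_grad \<Omega>' f gf" "AE z in lebesgue. z \<in> \<Omega>' \<longrightarrow> norm (gf z) \<le> L"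
    and L: "0 \<le> L"
  obtains G where "is_weak_grad \<Omega> (f \<circ> \<phi>) G"
    "AE x in lebesgue. x \<in> \<Omega> \<longrightarrow> norm (G x) \<le> L * (real DIM('a) * (\<Sum>i\<in>Basis. norm (g i x)))"
proof -
  let ?u = "f \<circ> \<phi>"
  have u: "continuous_on \<Omega> ?u" by (intro continuous_on_compose \<phi>(1) continuous_on_subset[OF f(1) \<phi>(2)])
  define M where "M b x = L * (\<Sum>i\<in>Basis. \<bar>g i x \<bullet> b\<bar>)" for b x
  have M_nonneg: "0 \<le> M b x" for b x unfolding M_def using L by (intro mult_nonneg_nonneg sum_nonneg) auto
  have M: "loc_integrable \<Omega> (M b)" for b
    unfolding M_def[abs_def] by (intro loc_integrable_abs_combination is_weak_grad_loc_integrable[OF g]) auto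
  define T where "T b \<psi> = - (\<integral>x. ?u x * frechet_derivative \<psi> (at x) b \<partial>lebesgue)" for b \<psi>
  have int: "integrable lebesgue (\<lambda>x. ?u x * frechet_derivative \<psi> (at x) b)" if "test_fun \<Omega> \<psi>" for \<psi> b
    by (rule loc_integrable_mult_cc[OF continuous_on_imp_loc_integrable[OF u]
          test_fun_imp_cc_fun[OF test_fun_directional_derivative[OF that]]])
  have D: "(\<psi> has_derivative frechet_derivative \<psi> (at x)) (at x)" if "test_fun \<Omega> \<psi>" for \<psi> x
    using that by (auto simp: test_fun_def intro: smooth_fun_has_derivative)
  have "\<exists>G. loc_integrable \<Omega> G \<and> (\<forall>\<psi>. test_fun \<Omega> \<psi> \<longrightarrow> T b \<psi> = (\<integral>x. G x * \<psi> x \<partial>lebesgue)) \<and>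
      (AE x in lebesgue. x \<in> \<Omega> \<longrightarrow> \<bar>G x\<bar> \<le> M b x)" for b
  proof -
    have T_add: "T b (\<lambda>x. a x + c x) = T b a + T b c" if "test_fun \<Omega> a" "test_fun \<Omega> c" for a c
    proof -
      have "frechet_derivative (\<lambda>x. a x + c x) (at x) = (\<lambda>h. frechet_derivative a (at x) h + frechet_derivative c (at x) h)" for x
        using frechet_derivative_at[OF has_derivative_add[OF D[OF that(1)] D[OF that(2)]]] by simp
      then show ?thesis using int[OF that(1)] int[OF that(2)] unfolding T_def by (simp add: distrib_left)
    qed
    have T_cmult: "T b (\<lambda>x. s * a x) = s * T b a" if "test_fun \<Omega> a" for s a
    proof -
      have "frechet_derivative (\<lambda>x. s * a x) (at x) = (\<lambda>h. s * frechet_derivative a (at x) h)" for x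
        using frechet_derivative_at[OF has_derivative_mult_right[OF D[OF that]]] by simp
      then show ?thesis unfolding T_def by (simp add: mult.left_commute)
    qed
    have T_bound: "\<bar>T b a\<bar> \<le> (\<integral>x. M b x * \<bar>a x\<bar> \<partial>lebesgue)" if "test_fun \<Omega> a" for a
      unfolding T_def M_def abs_minus_cancel
    proof (rule weak_derivative_bound[OF \<Omega>(1) u finite_Basis _ g L _ that])
      show "continuous_on \<Omega> (\<lambda>x. \<phi> x \<bullet> i)" for i by (intro continuous_intros \<phi>(1))
      show "\<exists>\<delta>>0. \<forall>z\<in>K. \<forall>h. norm h < \<delta> \<longrightarrow>
        \<bar>?u (z + h) - ?u z\<bar> \<le> L * (\<Sum>i\<in>Basis. \<bar>\<phi> (z + h) \<bullet> i - \<phi> z \<bullet> i\<bar>)"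
        if "compact K" "K \<subseteq> \<Omega>" for K
        by (rule composition_increment_le[OF \<Omega> \<phi> f L that])
    qed
    show ?thesis
      by (rule dominated_functional_representation[OF \<Omega>(1) M M_nonneg T_add T_cmult T_bound]) (assumption | blast)+
  qed
  then obtain H where H: "\<And>b. loc_integrable \<Omega> (H b)"
    "\<And>b \<psi>. test_fun \<Omega> \<psi> \<Longrightarrow> T b \<psi> = (\<integral>x. H b x * \<psi> x \<partial>lebesgue)"
    "\<And>b. AE x in lebesgue. x \<in> \<Omega> \<longrightarrow> \<bar>H b x\<bar> \<le> M b x"
    by metis
  define G where "G x = (\<Sum>b\<in>Basis. H b x *\<^sub>R b)" for x
  have G_inner: "G x \<bullet> b = H b x" if "b \<in> Basis" for x b
    unfolding G_def using that by (simp add: inner_sum_left inner_Basis if_distrib sum.delta cong: if_cong)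
  have "is_weak_grad \<Omega> ?u G"
    unfolding is_weak_grad_iff
  proof (intro conjI ballI allI impI)
    show "loc_integrable \<Omega> (\<lambda>x. G x \<bullet> b)" if "b \<in> Basis" for b using H(1) by (simp add: G_inner[OF that])
    show "(\<integral>x. ?u x * frechet_derivative \<psi> (at x) b \<partial>lebesgue) = - (\<integral>x. (G x \<bullet> b) * \<psi> x \<partial>lebesgue)"
      if "test_fun \<Omega> \<psi> \<and> b \<in> Basis" for \<psi> b
      using H(2)[of \<psi> b] that by (simp add: T_def G_inner)
  qed
  moreover have "AE x in lebesgue. x \<in> \<Omega> \<longrightarrow> norm (G x) \<le> L * (real DIM('a) * (\<Sum>i\<in>Basis. norm (g i x)))"
  proof -
    have "AE x in lebesgue. \<forall>b\<in>Basis. x \<in> \<Omega> \<longrightarrow> \<bar>H b x\<bar> \<le> M b x"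
      by (intro AE_finite_allI finite_Basis H(3))
    then show ?thesis
    proof (eventually_elim, intro impI)
      fix x assume x: "\<forall>b\<in>Basis. x \<in> \<Omega> \<longrightarrow> \<bar>H b x\<bar> \<le> M b x" "x \<in> \<Omega>"
      \<comment> \<open>Passing to the sum of the coordinates is the origin of the factor
        \<open>DIM('a)\<close>, since every coordinate has the same bound.\<close>
      have "norm (G x) \<le> (\<Sum>b\<in>Basis. \<bar>G x \<bullet> b\<bar>)" by (rule norm_le_l1)
      also have "\<dots> \<le> (\<Sum>b\<in>(Basis :: 'a set). L * (\<Sum>i\<in>Basis. norm (g i x)))"
      proof (rule sum_mono)
        fix b :: 'a assume b: "b \<in> Basis"
        have "\<bar>G x \<bullet> b\<bar> \<le> M b x" using x b by (simp add: G_inner)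
        also have "\<dots> \<le> L * (\<Sum>i\<in>Basis. norm (g i x))"
          unfolding M_def by (intro mult_left_mono sum_mono Basis_le_norm b L)
        finally show "\<bar>G x \<bullet> b\<bar> \<le> L * (\<Sum>i\<in>Basis. norm (g i x))" .
      qed
      finally show "norm (G x) \<le> L * (real DIM('a) * (\<Sum>i\<in>Basis. norm (g i x)))"
        by (simp add: mult_ac)
    qed
  qed
  ultimately show ?thesis using that by blast
qed

section \<open>Measurability and energy estimates\<close>

lemma loc_integrable_measurable:
  fixes h :: "'a::euclidean_space \<Rightarrow> real"
  assumes "open \<Omega>" "loc_integrable \<Omega> h"
  shows "(\<lambda>x. indicator \<Omega> x * h x) \<in> borel_measurable lebesgue"
proof -
  obtain C :: "nat \<Rightarrow> 'a set" where C: "\<And>n. compact (C n)" "\<And>n. C n \<subseteq> \<Omega>"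
    "\<And>K. compact K \<Longrightarrow> K \<subseteq> \<Omega> \<Longrightarrow> \<exists>N. \<forall>n\<ge>N. K \<subseteq> C n"
    using open_Union_compact_subsets[OF assms(1)] by metis
  show ?thesis
  proof (rule borel_measurable_LIMSEQ_real)
    show "(\<lambda>x. indicator (C n) x * h x) \<in> borel_measurable lebesgue" for n
    proof -
      have "integrable lebesgue (\<lambda>x. indicator (C n) x *\<^sub>R h x)"
        using assms(2) C(1,2) unfolding loc_integrable_def set_integrable_def by blast
      then show ?thesis using borel_measurable_integrable by simp
    qed
    show "(\<lambda>n. indicator (C n) x * h x) \<longlonglongrightarrow> indicator \<Omega> x * h x" for x
    proof (cases "x \<in> \<Omega>")
      case True
      then obtain n0 where "\<forall>n\<ge>n0. {x} \<subseteq> C n" using C(3)[of "{x}"] by auto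
      then have "\<forall>\<^sub>F n in sequentially. indicator (C n) x * h x = indicator \<Omega> x * h x"
        unfolding eventually_sequentially using True by (auto simp: indicator_def)
      then show ?thesis by (rule tendsto_eventually)
    next
      case False
      then have "x \<notin> C n" for n using C(2) by blast
      then show ?thesis using False by simp
    qed
  qed
qed

text \<open>Each summand is at most the largest one, and the power of the largest is one of the
  summands on the right.\<close>

lemma sum_powr_le:
  fixes a :: "'i \<Rightarrow> real"
  assumes "finite I" "\<And>i. i \<in> I \<Longrightarrow> 0 \<le> a i" "0 < q"
  shows "(\<Sum>i\<in>I. a i) powr q \<le> real (card I) powr q * (\<Sum>i\<in>I. a i powr q)"
proof (cases "I = {}")
  case False
  define m where "m = Max (a ` I)"
  have m: "a i \<le> m" if "i \<in> I" for i using assms(1) that by (simp add: m_def)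
  have "m \<in> a ` I" unfolding m_def using assms(1) False by (intro Max_in) auto
  then obtain j where j: "j \<in> I" "m = a j" by blast
  have "(\<Sum>i\<in>I. a i) \<le> real (card I) * m" using sum_mono[of I a "\<lambda>_. m"] m by simp
  then have "(\<Sum>i\<in>I. a i) powr q \<le> (real (card I) * m) powr q"
    using assms by (intro powr_mono2 sum_nonneg) auto
  also have "\<dots> = real (card I) powr q * a j powr q" using assms(2) j by (simp add: powr_mult)
  also have "\<dots> \<le> real (card I) powr q * (\<Sum>i\<in>I. a i powr q)"
    using assms(1) j by (intro mult_left_mono member_le_sum) auto
  finally show ?thesis .
qed simp

text \<open>The pointwise bound is raised to the power \<open>q\<close> with
  \<open>sum_powr_le\<close>, which contributes the factor \<open>card I\<close>. Measurability of
  the individual energies then lets the finite sum leave the integral.\<close>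

lemma grad_energy_le:
  fixes w :: "'a::euclidean_space \<Rightarrow> real"
  assumes \<Omega>: "open \<Omega>" and w: "weight w" and q: "1 < q" and c: "0 \<le> c" and I: "finite I"
    and v: "\<And>i. i \<in> I \<Longrightarrow> weakly_diff \<Omega> (v i)"
    and G: "is_weak_grad \<Omega> u G" "AE x in lebesgue. x \<in> \<Omega> \<longrightarrow> norm (G x) \<le> c * (\<Sum>i\<in>I. norm (weak_grad \<Omega> (v i) x))"
  shows "grad_energy \<Omega> w q u \<le> ennreal ((c * real (card I)) powr q) * (\<Sum>i\<in>I. grad_energy \<Omega> w q (v i))"
proof -
  let ?e = "\<lambda>i x. norm (weak_grad \<Omega> (v i) x) powr q * w x powr q"
  have w0: "0 \<le> w x" for x using w by (simp add: weight_def)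
  have w_meas: "w \<in> borel_measurable lebesgue"
    using loc_integrable_measurable[of UNIV w] w by (simp add: weight_def)
  have meas: "(\<lambda>x. ennreal (?e i x) * indicator \<Omega> x) \<in> borel_measurable lebesgue" if "i \<in> I" for i
  proof -
    have g: "is_weak_grad \<Omega> (v i) (weak_grad \<Omega> (v i))"
      using v[OF that] is_weak_grad_weak_grad unfolding weakly_diff_def by blast
    have "(\<lambda>x. \<Sum>b\<in>Basis. (indicator \<Omega> x * (weak_grad \<Omega> (v i) x \<bullet> b)) *\<^sub>R b) \<in> borel_measurable lebesgue"
      by (intro borel_measurable_sum borel_measurable_scaleR loc_integrable_measurable[OF \<Omega>]
          is_weak_grad_loc_integrable[OF g]) auto
    moreover have "(\<Sum>b\<in>Basis. (indicator \<Omega> x * (weak_grad \<Omega> (v i) x \<bullet> b)) *\<^sub>R b) = indicator \<Omega> x *\<^sub>R weak_grad \<Omega> (v i) x" for x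
      by (subst (2) euclidean_representation[symmetric]) (simp add: scaleR_sum_right)
    ultimately have m: "(\<lambda>x. indicator \<Omega> x *\<^sub>R weak_grad \<Omega> (v i) x) \<in> borel_measurable lebesgue" by simp
    have "(\<lambda>x. ennreal (norm (indicator \<Omega> x *\<^sub>R weak_grad \<Omega> (v i) x) powr q * w x powr q)) \<in> borel_measurable lebesgue"
      using m w_meas by measurable
    moreover have eq: "ennreal (norm (indicator \<Omega> x *\<^sub>R weak_grad \<Omega> (v i) x) powr q * w x powr q) = ennreal (?e i x) * indicator \<Omega> x" for x
      using q by (auto simp: indicator_def)
    ultimately show ?thesis by (simp only: eq)
  qed
  have "grad_energy \<Omega> w q u \<le> (\<integral>\<^sup>+x. ennreal ((c * real (card I)) powr q) * (\<Sum>i\<in>I. ennreal (?e i x) * indicator \<Omega> x) \<partial>lebesgue)"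
    unfolding grad_energy_def
  proof (rule nn_integral_mono_AE)
    show "AE x in lebesgue. ennreal (norm (weak_grad \<Omega> u x) powr q * w x powr q) * indicator \<Omega> x
        \<le> ennreal ((c * real (card I)) powr q) * (\<Sum>i\<in>I. ennreal (?e i x) * indicator \<Omega> x)"
      using weak_grad_AE_eq[OF \<Omega> G(1)] G(2)
    proof eventually_elim
      case (elim x)
      show ?case
      proof (cases "x \<in> \<Omega>")
        case True
        let ?s = "\<Sum>i\<in>I. norm (weak_grad \<Omega> (v i) x)"
        have "norm (weak_grad \<Omega> u x) powr q \<le> (c * ?s) powr q"
          using elim True q by (intro powr_mono2) auto
        also have "\<dots> = c powr q * ?s powr q" using c by (simp add: powr_mult sum_nonneg)
        also have "\<dots> \<le> c powr q * (real (card I) powr q * (\<Sum>i\<in>I. norm (weak_grad \<Omega> (v i) x) powr q))"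
          using I q by (intro mult_left_mono sum_powr_le) auto
        also have "\<dots> = (c * real (card I)) powr q * (\<Sum>i\<in>I. norm (weak_grad \<Omega> (v i) x) powr q)"
          using c by (simp add: powr_mult)
        finally have "norm (weak_grad \<Omega> u x) powr q * w x powr q
            \<le> (c * real (card I)) powr q * (\<Sum>i\<in>I. norm (weak_grad \<Omega> (v i) x) powr q) * w x powr q"
          by (rule mult_right_mono) simp
        also have "\<dots> = (c * real (card I)) powr q * (\<Sum>i\<in>I. ?e i x)"
          by (simp add: sum_distrib_right mult.assoc)
        finally have "ennreal (norm (weak_grad \<Omega> u x) powr q * w x powr q)
            \<le> ennreal ((c * real (card I)) powr q * (\<Sum>i\<in>I. ?e i x))" by (rule ennreal_leI)
        also have "\<dots> = ennreal ((c * real (card I)) powr q) * (\<Sum>i\<in>I. ennreal (?e i x))"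
          by (subst ennreal_mult'') (auto simp: sum_ennreal intro: sum_nonneg)
        finally show ?thesis using True by simp
      qed simp
    qed
  qed
  also have "\<dots> = ennreal ((c * real (card I)) powr q) * (\<integral>\<^sup>+x. (\<Sum>i\<in>I. ennreal (?e i x) * indicator \<Omega> x) \<partial>lebesgue)"
    using meas by (intro nn_integral_cmult borel_measurable_sum)
  also have "(\<integral>\<^sup>+x. (\<Sum>i\<in>I. ennreal (?e i x) * indicator \<Omega> x) \<partial>lebesgue) = (\<Sum>i\<in>I. grad_energy \<Omega> w q (v i))"
    unfolding grad_energy_def using meas by (intro nn_integral_sum)
  finally show ?thesis .
qed

text \<open>A nonempty open set is not null, so the bound holds at some point of it. This makes
  every competitor in the infimum \<open>L1inf_norm\<close> an admissible Lipschitz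
  constant.\<close>

lemma AE_norm_bound_nonneg:
  assumes "open \<Omega>" "\<Omega> \<noteq> {}" "AE x in lebesgue. x \<in> \<Omega> \<longrightarrow> norm (g x) \<le> C"
  shows "0 \<le> C"
proof (rule ccontr)
  assume "\<not> 0 \<le> C"
  then have "AE x in lebesgue. x \<notin> \<Omega>"
    using assms(3) by (auto elim!: eventually_mono dest: order_trans[OF norm_ge_zero])
  then have "negligible \<Omega>" using assms(1) by (simp add: negligible_iff_null_sets AE_iff_null_sets)
  then show False using open_not_negligible[OF assms(1,2)] by blast
qed

theorem theorem2p1:
  fixes \<Omega> \<Omega>' :: "'a::euclidean_space set"
    and w :: "'a \<Rightarrow> real" and q :: real and \<phi> :: "'a \<Rightarrow> 'a"
  assumes "DIM('a) \<ge> 2"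
    and "domain \<Omega>" and "domain \<Omega>'"
    and "1 < q"
    and "weight w" and "Muckenhoupt_pow q w"
    and "\<exists>\<psi>. homeomorphism \<Omega> \<Omega>' \<phi> \<psi>"
  shows "bounded_comp_op_inf \<Omega> \<Omega>' w q \<phi> \<longleftrightarrow> map_in_L1p \<Omega> w q \<phi>"
proof
  have \<Omega>: "open \<Omega>" "open \<Omega>'" "\<Omega>' \<noteq> {}" using assms(2,3) by (auto simp: domain_def)
  assume "bounded_comp_op_inf \<Omega> \<Omega>' w q \<phi>"
  then have comp: "in_L1p \<Omega> w q (f \<circ> \<phi>)" if "in_L1inf \<Omega>' f" "continuous_on \<Omega>' f" for f
    using that unfolding bounded_comp_op_inf_def by blast
  have "in_L1p \<Omega> w q (\<lambda>x. \<phi> x \<bullet> b)" if b: "b \<in> Basis" for b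
  proof -
    have g: "is_weak_grad \<Omega>' (\<lambda>y. y \<bullet> b) (\<lambda>_. b)" by (rule is_weak_grad_inner[OF \<Omega>(2)])
    have cont: "continuous_on \<Omega>' (\<lambda>y. y \<bullet> b)" by (intro continuous_intros)
    \<comment> \<open>A coordinate has the unit vector \<open>b\<close> as weak gradient, so its
      seminorm bound is 1.\<close>
    have "AE x in lebesgue. x \<in> \<Omega>' \<longrightarrow> norm (weak_grad \<Omega>' (\<lambda>y. y \<bullet> b) x) \<le> 1"
      using weak_grad_AE_eq[OF \<Omega>(2) g] by eventually_elim (use b in auto)
    then have "in_L1inf \<Omega>' (\<lambda>y. y \<bullet> b)"
      using g continuous_on_imp_loc_integrable[OF cont] unfolding in_L1inf_def weakly_diff_def by blast
    from comp[OF this cont] show ?thesis by (simp add: o_def)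
  qed
  then show "map_in_L1p \<Omega> w q \<phi>" unfolding map_in_L1p_def by blast
next
  have \<Omega>: "open \<Omega>" "open \<Omega>'" "\<Omega>' \<noteq> {}" using assms(2,3) by (auto simp: domain_def)
  have \<phi>: "continuous_on \<Omega> \<phi>" "\<phi> ` \<Omega> \<subseteq> \<Omega>'" using assms(7) by (auto simp: homeomorphism_def)
  assume "map_in_L1p \<Omega> w q \<phi>"
  then have v: "weakly_diff \<Omega> (\<lambda>x. \<phi> x \<bullet> i)" "grad_energy \<Omega> w q (\<lambda>x. \<phi> x \<bullet> i) < \<infinity>" if "i \<in> Basis" for i
    using that unfolding map_in_L1p_def in_L1p_def by auto
  have g: "is_weak_grad \<Omega> (\<lambda>x. \<phi> x \<bullet> i) (weak_grad \<Omega> (\<lambda>x. \<phi> x \<bullet> i))" if "i \<in> Basis" for i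
    using v(1)[OF that] is_weak_grad_weak_grad unfolding weakly_diff_def by blast
  define n where "n = real DIM('a)"
  define E where "E = (\<Sum>i\<in>(Basis::'a set). grad_energy \<Omega> w q (\<lambda>x. \<phi> x \<bullet> i))"
  have E: "E < \<infinity>" unfolding E_def using v(2) by (simp add: less_top[symmetric])
  \<comment> \<open>One factor \<open>n\<close> comes from assembling the gradient out of its
    coordinates, the other from the power of a sum of \<open>n\<close> terms. The summand 1 makes
    \<open>K\<close> positive, so that division by it is possible below.\<close>
  define K where "K = n * n * enn2real E powr (1 / q) + 1"
  have K: "0 < K" unfolding K_def n_def by (intro add_nonneg_pos) auto
  \<comment> \<open>Stated for every essential bound \<open>C\<close>, not only the least one,
    because the seminorm is the infimum of all of them.\<close>
  have main: "weakly_diff \<Omega> (f \<circ> \<phi>) \<and> grad_energy \<Omega> w q (f \<circ> \<phi>) < \<infinity> \<and> L1p_norm \<Omega> w q (f \<circ> \<phi>) \<le> K * C"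
    if f: "weakly_diff \<Omega>' f" "continuous_on \<Omega>' f"
      and C: "AE x in lebesgue. x \<in> \<Omega>' \<longrightarrow> norm (weak_grad \<Omega>' f x) \<le> C" for f C
  proof -
    have C0: "0 \<le> C" by (rule AE_norm_bound_nonneg[OF \<Omega>(2,3) C])
    have gf: "is_weak_grad \<Omega>' f (weak_grad \<Omega>' f)"
      using f(1) is_weak_grad_weak_grad unfolding weakly_diff_def by blast
    obtain G where G: "is_weak_grad \<Omega> (f \<circ> \<phi>) G"
      "AE x in lebesgue. x \<in> \<Omega> \<longrightarrow> norm (G x) \<le> C * (real DIM('a) * (\<Sum>i\<in>Basis. norm (weak_grad \<Omega> (\<lambda>x. \<phi> x \<bullet> i) x)))"
      by (rule composition_weak_grad[OF \<Omega>(1,2) \<phi> g f(2) gf C C0]) auto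
    have "continuous_on \<Omega> (f \<circ> \<phi>)" by (intro continuous_on_compose \<phi>(1) continuous_on_subset[OF f(2) \<phi>(2)])
    then have wd: "weakly_diff \<Omega> (f \<circ> \<phi>)"
      using G(1) continuous_on_imp_loc_integrable unfolding weakly_diff_def by blast
    have "grad_energy \<Omega> w q (f \<circ> \<phi>) \<le> ennreal ((C * n * real (card (Basis :: 'a set))) powr q) * E"
      unfolding E_def
      by (rule grad_energy_le[OF \<Omega>(1) assms(5,4) _ finite_Basis v(1) G(1)])
         (use G(2) C0 in \<open>auto simp: n_def mult.assoc\<close>)
    then have le: "grad_energy \<Omega> w q (f \<circ> \<phi>) \<le> ennreal ((C * n * n) powr q) * E" by (simp add: n_def)
    also have E_eq: "\<dots> = ennreal ((C * n * n) powr q * enn2real E)"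
      using E by (simp add: ennreal_mult' ennreal_enn2real)
    finally have le': "grad_energy \<Omega> w q (f \<circ> \<phi>) \<le> ennreal ((C * n * n) powr q * enn2real E)" .
    then have fin: "grad_energy \<Omega> w q (f \<circ> \<phi>) < \<infinity>" by (auto simp: less_top[symmetric] top_unique)
    have "enn2real (grad_energy \<Omega> w q (f \<circ> \<phi>)) \<le> (C * n * n) powr q * enn2real E"
      using enn2real_mono[OF le'] by simp
    then have "L1p_norm \<Omega> w q (f \<circ> \<phi>) \<le> ((C * n * n) powr q * enn2real E) powr (1 / q)"
      unfolding L1p_norm_def using assms(4) by (intro powr_mono2) auto
    also have "\<dots> = C * n * n * enn2real E powr (1 / q)"
      using C0 assms(4) by (simp add: powr_mult powr_powr n_def)
    also have "\<dots> \<le> K * C" using C0 by (simp add: K_def algebra_simps)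
    finally show ?thesis using wd fin by blast
  qed
  show "bounded_comp_op_inf \<Omega> \<Omega>' w q \<phi>"
    unfolding bounded_comp_op_inf_def
  proof (intro exI[of _ K] allI impI conjI)
    fix f assume f: "in_L1inf \<Omega>' f \<and> continuous_on \<Omega>' f"
    then have wf: "weakly_diff \<Omega>' f" by (simp add: in_L1inf_def)
    obtain C where C: "AE x in lebesgue. x \<in> \<Omega>' \<longrightarrow> norm (weak_grad \<Omega>' f x) \<le> C"
      using f by (auto simp: in_L1inf_def)
    show "in_L1p \<Omega> w q (f \<circ> \<phi>)" using main[OF wf conjunct2[OF f] C] by (simp add: in_L1p_def)
    \<comment> \<open>Dividing by \<open>K\<close> turns the family of estimates into a lower bound
      for all competitors, and hence for their infimum.\<close>
    have "L1p_norm \<Omega> w q (f \<circ> \<phi>) / K \<le> L1inf_norm \<Omega>' f"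
      unfolding L1inf_norm_def
    proof (rule cInf_greatest)
      show "{C. AE x in lebesgue. x \<in> \<Omega>' \<longrightarrow> norm (weak_grad \<Omega>' f x) \<le> C} \<noteq> {}" using C by blast
      fix C assume "C \<in> {C. AE x in lebesgue. x \<in> \<Omega>' \<longrightarrow> norm (weak_grad \<Omega>' f x) \<le> C}"
      then have "L1p_norm \<Omega> w q (f \<circ> \<phi>) \<le> K * C" using main[OF wf conjunct2[OF f]] by blast
      then show "L1p_norm \<Omega> w q (f \<circ> \<phi>) / K \<le> C" using K by (simp add: divide_le_eq mult.commute)
    qed
    then show "L1p_norm \<Omega> w q (f \<circ> \<phi>) \<le> K * L1inf_norm \<Omega>' f"
      using K by (simp add: divide_le_eq mult.commute)
  qed
qed

end
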